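(* Let $0<q<p$ be coprime odd integers, let $V=\mathbb{Q}[X]/(P_{p-1})$ be the Frobenius algebra attached to $(p,q)$ and let $\Omega\in V$ be its associated element. Let $\tau_n\in V/\{\pm1\}$ ($n=1,2$) be the Reidemeister torsion of $S^3\setminus K(p,q)$ with coefficients in $\rho_n$ (all notions as defined in the context). Then, up to sign, $$\tau_1=\frac{2}{x^2\mathcal{P}_{\ell-1}}\qquad\text{and}\qquad \tau_2=\frac{\Omega}{4x^2\mathcal{P}_{\ell-1}^2},$$ where $0<\ell<p$ is the unique odd integer satisfying $q\ell\equiv\pm1\pmod p$.
   Context: **Knot group.** $K(p,q)$ is the two-bridge knot with parameters $(p,q)$ (its double branched cover is the lens space $L(p,q)$), $M$ is its complement in $S^3$. Put $\epsilon_k=(-1)^{\lfloor kq/p\rfloor}$ for $k\in\mathbb{Z}$. The knot group is $G=\langle u,v\mid r\rangle$, $r=wuw^{-1}v^{-1}$, $w=u^{\epsilon_1}v^{\epsilon_2}\cdots u^{\epsilon_{p-2}}v^{\epsilon_{p-1}}$, with $u,v$ meridians. **Algebra.** Define $P_k\in\mathbb{Z}[X]$ by $P_{-1}=0$, $P_0=1$, $P_k=\epsilon_kXP_{k-1}+P_{k-2}$. Let $V=\mathbb{Q}[X]/(P_{p-1})$ (a semi-simple $\mathbb{Q}$-algebra); $x,\mathcal{P}_k$ denote the images of $X,P_k$ in $V$. The formulas $\rho(u)=\begin{pmatrix} 1 & x \\ 0 & 1 \end{pmatrix}$, $\rho(v)=\begin{pmatrix} 1 & 0 \\ x & 1 \end{pmatrix}$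 define a representation $\rho:G\to\mathrm{SL}_2(V)$ (the tautological parabolic representation). **Frobenius structure.** Let $\epsilon:V\to\mathbb{Q}$ be the linear form with $\epsilon(\mathcal{P}_0)=1$, $\epsilon(\mathcal{P}_k)=0$ for $0<k<p-1$, and $\eta(a,b)=\epsilon(ab)$. This bilinear form is non-degenerate, and $\mathcal{P}_0,\dots,\mathcal{P}_{p-2}$ is an orthogonal basis with $\eta(\mathcal{P}_k,\mathcal{P}_k)=(-1)^k\epsilon_{k+1}$. The element $\Omega$ is $\sum_i a_ib_i$ where $\eta^{-1}=\sum_i a_i\otimes b_i\in V\otimes V$; explicitly $\Omega=\sum_{k=0}^{p-2}(-1)^k\epsilon_{k+1}\mathcal{P}_k^2$. **Torsion.** $\rho_n=s_n\circ\rho$, where $s_n$ is the action of $\mathrm{SL}_2(V)$ on $\mathrm{S}^nV^2$; so $\rho_1=\rho$, and $\rho_2$ is identified with the adjoint action on $\mathrm{sl}_2(V)$, with basis $\mathfrak{e}_1=E=\begin{pmatrix} 0 & 1 \\ 0 & 0 \end{pmatrix}$, $\mathfrak{e}_2=\tfrac12\begin{pmatrix} 1 & 0 \\ 0 & -1 \end{pmatrix}$, $\mathfrak{e}_3=F=\begin{pmatrix} 0 & 0 \\ 1 & 0 \end{pmatrix}$ and invariant pairing $\langle\xi,\eta\rangle=\mathrm{Tr}(\xi\eta)$. The twisted cochain complex of $M$ is $$C^*:\ \mathrm{S}^nV^2\xrightarrow{D^0}\mathrm{S}^nV^2\oplus\mathrm{S}^nV^2\xrightarrow{D^1}\mathrm{S}^nV^2,$$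 $D^0(\xi)=(\rho_n(u-1)\xi,\rho_n(v-1)\xi)$, $D^1(\xi,\eta)=\rho_n(\tfrac{\partial r}{\partial u})\xi+\rho_n(\tfrac{\partial r}{\partial v})\eta$ (Fox derivatives). For an acyclic complex $C^0\xrightarrow{D^0}C^1\xrightarrow{D^1}C^2\to\cdots$ of based free modules, the torsion is $\prod_i\Delta_i^{(-1)^{i+1}}$ up to sign (Cayley formula), where one chooses row sets so that $\Delta_i$ is the (invertible) maximal minor of the matrix of $D^i$ whose columns are those basis vectors of $C^i$ not used as rows for $\Delta_{i-1}$. For $n=1$ the complex $C^*$ is acyclic and $\tau_1$ is its torsion ($\tau_1=\Delta_1/\Delta_0$). For $n=2$, $H^k(M,\mathrm{S}^2V^2)$ vanishes except for $k=1,2$. Let $m$ be the meridian $u$, lying on the boundary torus $\partial M$ of the knot exterior. The restriction maps $H^1(M,\mathrm{S}^2V^2)\to H^1(m,\mathrm{S}^2V^2)$, $H^2(M,\mathrm{S}^2V^2)\to H^2(\partial M,\mathrm{S}^2V^2)$ are isomorphisms and, using Poincaré duality and the pairing, the targets are identified with $H^0(m,\mathrm{S}^2V^2)^*$ and $H^0(\partial M,\mathrm{S}^2V^2)^*$. Both $H^0$'s are free of rank one generated by $\mathfrak{e}_1$; evaluating at $\mathfrak{e}_1$ gives isomorphisms $H^1(M,\mathrm{S}^2V^2)\cong V$, induced by $f_1(\xi,\eta)=\langle\xi,\mathfrak{e}_1\rangle$ on $C^1$, and $H^2(M,\mathrm{S}^2V^2)\cong V$, induced by a linear map $f_2:C^2\to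 V$. Then $\tau_2$ is the torsion of the acyclic mapping cone $$\mathrm{S}^2V^2\xrightarrow{D^0}\mathrm{S}^2V^2\oplus\mathrm{S}^2V^2\xrightarrow{(D^1,f_1)}\mathrm{S}^2V^2\oplus V\xrightarrow{(f_2,0)}V,$$ i.e. $\tau_2=\Delta_1/(\Delta_0\Delta_2)$. All torsions are considered up to sign. *)

theory Defs
  imports
    "Jordan_Normal_Form.Matrix_Kernel"
    "Jordan_Normal_Form.DL_Submatrix"
    "HOL-Number_Theory.Cong"
begin

section \<open>The algebra V and its Frobenius structure\<close>

definition tb_sign :: "nat \<Rightarrow> nat \<Rightarrow> nat \<Rightarrow> int" where
  "tb_sign p q k = (-1) ^ (k * q div p)"

text \<open>The second equation is the recursion with the convention that the polynomial of
  index -1 is 0.\<close>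

fun tb_poly :: "nat \<Rightarrow> nat \<Rightarrow> nat \<Rightarrow> int poly" where
  "tb_poly p q 0 = 1"
| "tb_poly p q (Suc 0) = [:0, tb_sign p q 1:]"
| "tb_poly p q (Suc (Suc k)) =
     [:0, tb_sign p q (Suc (Suc k)):] * tb_poly p q (Suc k) + tb_poly p q k"

abbreviation tb_rat_poly :: "nat \<Rightarrow> nat \<Rightarrow> nat \<Rightarrow> rat poly" where
  "tb_rat_poly p q k \<equiv> map_poly rat_of_int (tb_poly p q k)"

text \<open>The quotient of the rational polynomial ring by the ideal generated by the polynomial of
  index p - 1 depends on p and q, so it is not one HOL type.  It is presented as any commutative
  ring together with a quotient map: a surjective ring homomorphism whose kernel is that ideal.
  The scalar c acts on V as multiplication by the image of the constant polynomial c.\<close>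

definition tb_algebra :: "nat \<Rightarrow> nat \<Rightarrow> (rat poly \<Rightarrow> 'a::comm_ring_1) \<Rightarrow> bool" where
  "tb_algebra p q \<pi> \<longleftrightarrow> comm_ring_hom \<pi> \<and> surj \<pi> \<and>
     (\<forall>f. \<pi> f = 0 \<longleftrightarrow> tb_rat_poly p q (p - 1) dvd f)"

definition frobenius_form ::
  "nat \<Rightarrow> nat \<Rightarrow> (rat poly \<Rightarrow> 'a::comm_ring_1) \<Rightarrow> ('a \<Rightarrow> rat) \<Rightarrow> bool" where
  "frobenius_form p q \<pi> \<epsilon> \<longleftrightarrow>
     (\<forall>a b. \<epsilon> (a + b) = \<epsilon> a + \<epsilon> b) \<and> (\<forall>c a. \<epsilon> (\<pi> [:c:] * a) = c * \<epsilon> a) \<and>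
     \<epsilon> (\<pi> (tb_rat_poly p q 0)) = 1 \<and>
     (\<forall>k. 0 < k \<and> k < p - 1 \<longrightarrow> \<epsilon> (\<pi> (tb_rat_poly p q k)) = 0)"

text \<open>The tensor with components \<open>a i\<close>, \<open>b i\<close> (\<open>i < N\<close>) is the inverse of the bilinear
  form \<open>\<eta>(a, b) = \<epsilon>(a b)\<close>: contracting it with \<open>\<eta>\<close> gives the identity of V.\<close>

definition inverse_form ::
  "(rat poly \<Rightarrow> 'a::comm_ring_1) \<Rightarrow> ('a \<Rightarrow> rat) \<Rightarrow> nat \<Rightarrow> (nat \<Rightarrow> 'a) \<Rightarrow> (nat \<Rightarrow> 'a) \<Rightarrow> bool" where
  "inverse_form \<pi> \<epsilon> N a b \<longleftrightarrow> (\<forall>y. (\<Sum>i<N. \<pi> [:\<epsilon> (b i * y):] * a i) = y)"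

definition is_Omega :: "nat \<Rightarrow> nat \<Rightarrow> (rat poly \<Rightarrow> 'a::comm_ring_1) \<Rightarrow> 'a \<Rightarrow> bool" where
  "is_Omega p q \<pi> \<Omega> \<longleftrightarrow> (\<exists>\<epsilon> N a b. frobenius_form p q \<pi> \<epsilon> \<and> inverse_form \<pi> \<epsilon> N a b \<and>
     \<Omega> = (\<Sum>i<N. a i * b i))"


section \<open>The knot group\<close>

text \<open>A word is a list of letters; \<open>(g, True)\<close> stands for the generator \<open>g\<close> and \<open>(g, False)\<close>
  for its inverse.  An element of the group ring of the free group is a list of pairs of an
  integer coefficient and a word.\<close>

datatype gen = gu | gv

type_synonym gword = "(gen \<times> bool) list"
type_synonym gchain = "(int \<times> gword) list"

definition inv_word :: "gword \<Rightarrow> gword" where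
  "inv_word w = rev (map (\<lambda>(g, s). (g, \<not> s)) w)"

definition tb_letter :: "nat \<Rightarrow> nat \<Rightarrow> nat \<Rightarrow> gen \<times> bool" where
  "tb_letter p q k = (if odd k then gu else gv, tb_sign p q k = 1)"

definition tb_w :: "nat \<Rightarrow> nat \<Rightarrow> gword" where
  "tb_w p q = map (tb_letter p q) [1..<p]"

definition tb_r :: "nat \<Rightarrow> nat \<Rightarrow> gword" where
  "tb_r p q = tb_w p q @ [(gu, True)] @ inv_word (tb_w p q) @ [(gv, False)]"

fun fox :: "gen \<Rightarrow> gword \<Rightarrow> gchain" where
  "fox g [] = []"
| "fox g ((h, s) # w) =
     (if h = g then if s then [(1, [])] else [(-1, [(h, False)])] else []) @
     map (\<lambda>(c, z). (c, (h, s) # z)) (fox g w)"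


section \<open>The boundary torus\<close>

text \<open>The peripheral subgroup containing the meridian \<open>u\<close> is generated by \<open>u\<close> and the preferred
  longitude \<open>\<lambda> = w' w u\<^sup>-\<^sup>2\<^sup>e\<close>, where \<open>w'\<close> is \<open>w\<close> read backwards (without inverting
  letters) and \<open>e\<close> is the exponent sum of \<open>w\<close>.\<close>

definition u_power :: "int \<Rightarrow> gword" where
  "u_power n = replicate (nat \<bar>n\<bar>) (gu, 0 \<le> n)"

definition tb_longitude :: "nat \<Rightarrow> nat \<Rightarrow> gword" where
  "tb_longitude p q = rev (tb_w p q) @ tb_w p q @ u_power (- 2 * (\<Sum>k=1..<p. tb_sign p q k))"

text \<open>The image of the 2-cell \<open>[u, \<lambda>]\<close> of the torus under a cellular approximation of the
  inclusion of the torus into the presentation complex of the knot group.  If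
  \<open>[u, \<lambda>] = \<Prod>\<^sub>i g\<^sub>i r\<^sup>c\<^sup>i g\<^sub>i\<^sup>-\<^sup>1\<close> in the free group (where all exponents are \<open>1\<close> or \<open>-1\<close>), the
  2-cell is sent to \<open>\<Sum>\<^sub>i c\<^sub>i g\<^sub>i\<close> times the 2-cell \<open>r\<close>.  Here
  \<open>[u, \<lambda>] = h\<^sup>-\<^sup>1 r h \<cdot> w' r\<^sup>-\<^sup>1 w'\<^sup>-\<^sup>1\<close>, where \<open>h\<close> is the prefix of \<open>r\<close> of length \<open>c - 1\<close> and
  \<open>c\<close> is the inverse of \<open>q\<close> modulo \<open>2 p\<close>; this is the lemma \<open>boundary_chain\<close> below.\<close>

definition boundary_chain :: "nat \<Rightarrow> nat \<Rightarrow> gchain" where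
  "boundary_chain p q =
     (let c = (LEAST c. [q * c = 1] (mod 2 * p)); h = take (c - 1) (tb_r p q)
      in [(1, inv_word h), (-1, rev (tb_w p q))])"

definition conjugates :: "gword \<Rightarrow> gchain \<Rightarrow> gword" where
  "conjugates r zs = concat (map (\<lambda>(c, g). g @ (if c = 1 then r else inv_word r) @ inv_word g) zs)"

text \<open>An identity between words holds in the free group iff it holds in every group for all
  values of the generators.\<close>

definition word_eval :: "('g, 'b) monoid_scheme \<Rightarrow> (gen \<Rightarrow> 'g) \<Rightarrow> gword \<Rightarrow> 'g" where
  "word_eval G f w =
     foldr (\<lambda>(g, s) z. (if s then f g else inv\<^bsub>G\<^esub> (f g)) \<otimes>\<^bsub>G\<^esub> z) w \<one>\<^bsub>G\<^esub>"

context
begin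

private definition sg :: "nat \<Rightarrow> nat \<Rightarrow> int \<Rightarrow> bool" where
  "sg p q k = even ((2 * k * int q - 1) div (2 * int p))"

private lemma div_flip:
  fixes t n m :: int assumes "n > 0" "\<not> n dvd t"
  shows "(n * m - t) div n = m - 1 - t div n"
proof -
  have 1: "(n * m - t) div n = m + (- t) div n"
    using assms(1) by (metis add.commute diff_conv_add_uminus div_mult_self2 order_less_irrefl)
  show ?thesis using assms unfolding 1 zdiv_zminus1_eq_if[OF less_imp_neq[OF assms(1), symmetric]]
    by (simp add: dvd_eq_mod_eq_0)
qed

private lemma sg_flip:
  assumes "p > 0" "int q * c = 1 + 2 * int p * m"
  shows "sg p q (c - k) = (\<not> sg p q k)"
proof -
  have nd: "\<not> 2 * int p dvd 2 * k * int q - 1"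
  proof
    assume "2 * int p dvd 2 * k * int q - 1"
    hence "2 dvd 2 * k * int q - 1" by (rule dvd_mult_left)
    thus False by simp
  qed
  have e: "2 * (c - k) * int q - 1 = 2 * int p * (2 * m) - (2 * k * int q - 1)"
    using assms(2) by (simp add: algebra_simps)
  have "(2 * (c - k) * int q - 1) div (2 * int p) = 2 * m - 1 - (2 * k * int q - 1) div (2 * int p)"
    unfolding e using assms(1) by (intro div_flip[OF _ nd]) simp
  then show ?thesis
    unfolding sg_def by (simp only:) simp
qed

private lemma div_half:
  fixes k q p :: int assumes "p > 0" "\<not> p dvd k * q"
  shows "(2 * k * q - 1) div (2 * p) = k * q div p"
proof -
  define d m where "d = k * q div p" and "m = k * q mod p"
  have e: "k * q = d * p + m" unfolding d_def m_def by simp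
  have m: "0 < m" "m < p"
    using assms pos_mod_sign[of p "k * q"] pos_mod_bound[of p "k * q"]
    by (auto simp: m_def dvd_eq_mod_eq_0 order_less_le)
  have e2: "2 * k * q - 1 = (2 * m - 1) + d * (2 * p)"
    using e by (simp add: algebra_simps)
  have "(2 * k * q - 1) div (2 * p) = d + (2 * m - 1) div (2 * p)"
    using assms(1) by (simp only: e2 div_mult_self1[of "2*p"])
  also have "(2 * m - 1) div (2 * p) = 0"
    using m by (intro div_pos_pos_trivial) auto
  finally show ?thesis by (simp add: d_def)
qed

private lemma sign_sg:
  assumes "coprime p q" "0 < k" "k < p"
  shows "(tb_sign p q k = 1) = sg p q (int k)"
proof -
  have "\<not> p dvd k * q"
    using assms by (metis coprime_dvd_mult_left_iff dvd_imp_le not_le)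
  hence "\<not> int p dvd int k * int q" by (metis of_nat_dvd_iff of_nat_mult)
  hence "(2 * int k * int q - 1) div (2 * int p) = int (k * q div p)"
    using div_half[of "int p" "int k" "int q"] assms by (simp add: zdiv_int)
  thus ?thesis unfolding sg_def tb_sign_def by (simp add: minus_one_power_iff)
qed

private lemma length_w [simp]: "length (tb_w p q) = p - 1"
  by (simp add: tb_w_def)

private lemma length_inv [simp]: "length (inv_word w) = length w"
  by (simp add: inv_word_def)

private lemma nth_inv: "i < length w \<Longrightarrow>
    inv_word w ! i = (fst (w ! (length w - 1 - i)), \<not> snd (w ! (length w - 1 - i)))"
  by (simp add: inv_word_def rev_nth case_prod_unfold)

private lemma nth_w: "coprime p q \<Longrightarrow> i < p - 1 \<Longrightarrow>
    tb_w p q ! i = (if even i then gu else gv, sg p q (int i + 1))"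
  using sign_sg[of p q "Suc i"] by (auto simp: tb_w_def tb_letter_def add.commute)

private lemma length_r: "p > 0 \<Longrightarrow> length (tb_r p q) = 2 * p"
  by (simp add: tb_r_def)

private lemma sg_2p:
  assumes "coprime p q" "0 < k" "k < p"
  shows "sg p q (2 * int p - int k) = (\<not> sg p q (int k))"
proof -
  have "\<not> p dvd k * q"
    using assms by (metis coprime_dvd_mult_left_iff dvd_imp_le not_le)
  hence nd: "\<not> int p dvd int k * int q" by (metis of_nat_dvd_iff of_nat_mult)
  have e: "(2 * int p - int k) * int q = int p * (2 * int q) - int k * int q"
    by (simp add: algebra_simps)
  have nd2: "\<not> int p dvd (2 * int p - int k) * int q"
    unfolding e using nd by (simp add: dvd_diff_right_iff)
  show ?thesis
    unfolding sg_def using div_half[OF _ nd] div_half[OF _ nd2] div_flip[OF _ nd, of "2 * int q"] assms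
    by (simp add: e)
qed

private lemma nth_r:
  assumes "coprime p q" "odd p" "odd q" "j < 2 * p"
  shows "tb_r p q ! j = (if even j then gu else gv, sg p q (int j + 1))"
proof -
  have p: "p > 0" using assms by auto
  consider "j < p - 1" | "j = p - 1" | "p \<le> j" "j < 2 * p - 1" | "j = 2 * p - 1"
    using assms(4) by linarith
  then show ?thesis
  proof cases
    case 1
    then show ?thesis using nth_w[OF assms(1) 1] by (simp add: tb_r_def nth_append)
  next
    case 2
    have "(2 * int p * int q - 1) div (2 * int p) = int q - 1"
      using div_flip[of "2 * int p" 1 "int q"] p by (simp add: zdvd1_eq div_pos_pos_trivial)
    then show ?thesis using 2 p assms by (simp add: tb_r_def nth_append sg_def)
  next
    case 3
    define k where "k = 2 * p - 1 - j"
    have k: "0 < k" "k < p" "k - 1 < p - 1" "j = 2 * p - 1 - k" "int j + 1 = 2 * int p - int k"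
      using 3 by (auto simp: k_def)
    have "\<not> j < p - 1" "j - (p - 1) = Suc (j - p)" "j - p < p - 1"
      using 3 p by auto
    hence "tb_r p q ! j = inv_word (tb_w p q) ! (j - p)"
      by (simp add: tb_r_def nth_append)
    also have "\<dots> = (fst (tb_w p q ! (k - 1)), \<not> snd (tb_w p q ! (k - 1)))"
    proof -
      have "j - p < length (tb_w p q)" "length (tb_w p q) - 1 - (j - p) = k - 1"
        using 3 by (auto simp: k_def)
      then show ?thesis using nth_inv by metis
    qed
    also have "\<dots> = (if even j then gu else gv, sg p q (int j + 1))"
    proof -
      have "even (k - 1) = even j" using k(1) 3 by (auto simp: k_def even_diff_nat)
      moreover have "int (k - 1) + 1 = int k" using k by simp
      ultimately show ?thesis
        using nth_w[OF assms(1) k(3)] sg_2p[OF assms(1) k(1,2)] k(5) by simp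
    qed
    finally show ?thesis .
  next
    case 4
    have "(2 * (2 * int p) * int q - 1) div (2 * int p) = 2 * int q - 1"
      using div_flip[of "2 * int p" 1 "2 * int q"] p by (simp add: zdvd1_eq div_pos_pos_trivial algebra_simps)
    moreover have "int j + 1 = 2 * int p" using 4 p by simp
    ultimately have "\<not> sg p q (int j + 1)" by (simp add: sg_def)
    moreover have "odd j" "\<not> j < p - 1" "j - (p - 1) = Suc (p - 1)" using 4 p by auto
    ultimately show ?thesis by (simp add: tb_r_def nth_append)
  qed
qed

private lemma tb_sign_sym:
  assumes "coprime p q" "odd q" "0 < k" "k < p"
  shows "tb_sign p q (p - k) = tb_sign p q k"
proof -
  have "\<not> p dvd k * q"
    using assms by (metis coprime_dvd_mult_left_iff dvd_imp_le not_le)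
  hence nd: "\<not> int p dvd int k * int q" by (metis of_nat_dvd_iff of_nat_mult)
  have "int ((p - k) * q div p) = (int p * int q - int k * int q) div int p"
    using assms by (simp add: zdiv_int of_nat_diff algebra_simps)
  also have "\<dots> = int q - 1 - int (k * q div p)"
    using div_flip[OF _ nd, of "int q"] assms by (simp add: zdiv_int)
  finally have "even (int ((p - k) * q div p)) = even (int (k * q div p))"
    using assms(2) by simp
  thus ?thesis by (simp add: tb_sign_def minus_one_power_iff)
qed

private fun swap :: "gen \<times> bool \<Rightarrow> gen \<times> bool" where
  "swap (g, s) = (if g = gu then gv else gu, s)"

private lemma swap_w:
  assumes "coprime p q" "odd p" "odd q"
  shows "map swap (tb_w p q) = rev (tb_w p q)"
proof (rule nth_equalityI)
  fix i assume "i < length (map swap (tb_w p q))"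
  hence i: "i < p - 1" by simp
  have "rev (tb_w p q) ! i = tb_letter p q (p - Suc i)"
    using i by (simp add: rev_nth tb_w_def Suc_diff_Suc)
  moreover have "odd (p - Suc i) = even (Suc i)" using i assms(2) by (auto simp: even_diff_nat)
  ultimately show "map swap (tb_w p q) ! i = rev (tb_w p q) ! i"
    using i tb_sign_sym[of p q "Suc i"] assms by (simp add: tb_w_def tb_letter_def)
qed simp

private lemma swap_r:
  assumes "coprime p q" "odd p" "odd q" "n < 2 * p" "[q * (n + 1) = 1] (mod 2 * p)"
  shows "map swap (tb_r p q) = inv_word (take n (tb_r p q)) @ inv_word (drop n (tb_r p q))"
proof (rule nth_equalityI)
  have p: "p > 0" using assms by auto
  have "[int q * int (n + 1) = 1] (mod 2 * int p)"
    using assms(5) by (metis cong_int_iff of_nat_1 of_nat_mult of_nat_numeral)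
  then obtain m where m: "int q * (int n + 1) = 1 + 2 * int p * m"
    by (metis cong_iff_lin cong_sym of_nat_Suc Suc_eq_plus1 add.commute)
  have n: "even n"
  proof -
    have "odd (int q * (int n + 1))" unfolding m by simp
    thus ?thesis by simp
  qed
  show "length (map swap (tb_r p q)) =
      length (inv_word (take n (tb_r p q)) @ inv_word (drop n (tb_r p q)))"
    using p assms(4) by (simp add: length_r)
  fix j assume "j < length (map swap (tb_r p q))"
  hence j: "j < 2 * p" using p by (simp add: length_r)
  have L: "map swap (tb_r p q) ! j = (if even j then gv else gu, sg p q (int j + 1))"
    using j p nth_r[OF assms(1-3) j] by (simp add: length_r)
  have per: "sg p q (k + 2 * int p) = sg p q k" for k
  proof -
    have "2 * (k + 2 * int p) * int q - 1 = (2 * k * int q - 1) + (2 * int q) * (2 * int p)"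
      by (simp add: algebra_simps)
    thus ?thesis unfolding sg_def using p by (simp only: div_mult_self1) simp
  qed
  have flip: "sg p q (int n + 1 - k) = (\<not> sg p q k)" for k
    by (rule sg_flip[OF p m])
  show "map swap (tb_r p q) ! j =
      (inv_word (take n (tb_r p q)) @ inv_word (drop n (tb_r p q))) ! j"
  proof (cases "j < n")
    case True
    define i where "i = n - 1 - j"
    have i: "i < 2 * p" "i < n" "even i = odd j" "int i + 1 = int n + 1 - (int j + 1)"
      using True n assms(4) by (auto simp: i_def even_diff_nat)
    have "(inv_word (take n (tb_r p q)) @ inv_word (drop n (tb_r p q))) ! j =
        (fst (tb_r p q ! i), \<not> snd (tb_r p q ! i))"
      using True assms(4) p i by (simp add: nth_append length_r nth_inv min_def i_def)
    thus ?thesis unfolding L nth_r[OF assms(1-3) i(1)] i(4) flip using i(3) by simp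
  next
    case False
    define i where "i = n + (2 * p - 1 - j)"
    have i: "i < 2 * p" "even i = odd j" "int i + 1 = int n + 1 - (int j + 1) + 2 * int p"
      using False n j by (auto simp: i_def even_diff_nat)
    have "(inv_word (take n (tb_r p q)) @ inv_word (drop n (tb_r p q))) ! j =
        inv_word (drop n (tb_r p q)) ! (j - n)"
      using False assms(4) p by (simp add: nth_append length_r min_def)
    also have "\<dots> = (fst (tb_r p q ! i), \<not> snd (tb_r p q ! i))"
    proof -
      have "length (drop n (tb_r p q)) - 1 - (j - n) = 2 * p - 1 - j"
        "j - n < length (drop n (tb_r p q))"
        using False j p by (auto simp: length_r)
      then show ?thesis using j p assms(4) by (simp add: nth_inv i_def length_r)
    qed
    finally show ?thesis unfolding L nth_r[OF assms(1-3) i(1)] i(3) per flip using i(2) by simp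
  qed
qed

private lemma swap_inv: "map swap (inv_word w) = inv_word (map swap w)"
  by (auto simp: inv_word_def rev_map)

private lemma eval_in:
  assumes "group G" "range f \<subseteq> carrier G"
  shows "word_eval G f w \<in> carrier G"
proof -
  interpret group G by fact
  show ?thesis using assms(2)
    by (induction w) (auto simp: word_eval_def image_subset_iff intro!: m_closed inv_closed)
qed

private lemma eval_app:
  assumes "group G" "range f \<subseteq> carrier G"
  shows "word_eval G f (v @ w) = word_eval G f v \<otimes>\<^bsub>G\<^esub> word_eval G f w"
proof -
  interpret group G by fact
  have fc: "f x \<in> carrier G" for x using assms(2) by auto
  have "word_eval G f (a # w) = (if snd a then f (fst a) else inv\<^bsub>G\<^esub> (f (fst a))) \<otimes>\<^bsub>G\<^esub> word_eval G f w"
    for a w by (simp add: word_eval_def case_prod_unfold)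
  note C = this
  have E: "word_eval G f [] = \<one>\<^bsub>G\<^esub>" by (simp add: word_eval_def)
  show ?thesis
    using eval_in[OF assms] fc by (induction v) (simp_all add: E C m_assoc)
qed

private lemma eval_inv:
  assumes "group G" "range f \<subseteq> carrier G"
  shows "word_eval G f (inv_word w) = inv\<^bsub>G\<^esub> (word_eval G f w)"
proof -
  interpret group G by fact
  have fc: "f x \<in> carrier G" for x using assms(2) by auto
  show ?thesis
  proof (induction w)
    case Nil
    show ?case by (simp add: inv_word_def word_eval_def)
  next
    case (Cons a w)
    have 1: "inv_word (a # w) = inv_word w @ inv_word [a]" by (simp add: inv_word_def)
    have 2: "word_eval G f (a # w) = word_eval G f [a] \<otimes>\<^bsub>G\<^esub> word_eval G f w"
      using eval_app[OF assms, of "[a]" w] by simp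
    have 3: "word_eval G f (inv_word [a]) = inv\<^bsub>G\<^esub> (word_eval G f [a])"
      using fc by (cases a) (simp add: inv_word_def word_eval_def)
    show ?case
      unfolding 1 2 using eval_app[OF assms] Cons 3 eval_in[OF assms] by (simp add: inv_mult_group)
  qed
qed

lemma boundary_chain:
  fixes G (structure)
  assumes G: "group G" "range f \<subseteq> carrier G"
    and pq: "coprime p q" "odd p" "odd q"
  shows "word_eval G f ([(gu, True)] @ tb_longitude p q @ [(gu, False)] @ inv_word (tb_longitude p q)) =
    word_eval G f (conjugates (tb_r p q) (boundary_chain p q))"
proof -
  interpret group G by fact
  let ?e = "word_eval G f"
  have fc: "f x \<in> carrier G" for x using G by auto
  note cl = eval_in[OF G] and app = eval_app[OF G] and einv = eval_inv[OF G]
  have p: "p > 0" using pq(2) by (cases p) auto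
  define c where "c = (LEAST c. [q * c = 1] (mod 2 * p))"
  have "coprime q (2 * p)" using pq by (simp add: coprime_commute)
  then obtain c0 where c0: "[q * c0 = 1] (mod 2 * p)" using cong_solve_coprime_nat[of q "2 * p"] by auto
  have c1: "[q * c = 1] (mod 2 * p)" unfolding c_def using c0 by (rule LeastI)
  have c2: "c < 2 * p"
  proof -
    have "[q * (c mod (2 * p)) = 1] (mod 2 * p)"
      using c1 by (metis cong_def mod_mult_right_eq)
    hence "c \<le> c mod (2 * p)" unfolding c_def by (rule Least_le)
    thus ?thesis using p by (metis le_less_trans mod_less_divisor mult_pos_pos zero_less_numeral)
  qed
  have c3: "c > 0"
  proof (rule ccontr)
    assume "\<not> c > 0"
    hence "[0 = 1] (mod 2 * p)" using c1 by simp
    thus False using p by (simp add: cong_def mod_if)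
  qed
  define n h d where "n = c - 1" and "h = take n (tb_r p q)" and "d = drop n (tb_r p q)"
  have n: "n < 2 * p" "[q * (n + 1) = 1] (mod 2 * p)"
    using c1 c2 c3 by (auto simp: n_def)
  have sr: "map swap (tb_r p q) = inv_word h @ inv_word d"
    unfolding h_def d_def by (rule swap_r[OF pq n])
  have r: "tb_r p q = h @ d" by (simp add: h_def d_def)
  define W W' H D a b z where defs: "W = ?e (tb_w p q)" "W' = ?e (rev (tb_w p q))" "H = ?e h"
    "D = ?e d" "a = f gu" "b = f gv" "z = ?e (u_power (- 2 * (\<Sum>k=1..<p. tb_sign p q k)))"
  have cl2 [simp]: "W \<in> carrier G" "W' \<in> carrier G" "H \<in> carrier G" "D \<in> carrier G"
    "a \<in> carrier G" "b \<in> carrier G" "z \<in> carrier G"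
    unfolding defs using cl fc by auto
  have one: "?e [(gu, True)] = a" "?e [(gv, True)] = b" "?e [(gu, False)] = inv a" "?e [(gv, False)] = inv b"
    unfolding defs using fc by (auto simp: word_eval_def)
  have R1: "?e (tb_r p q) = W \<otimes> a \<otimes> inv W \<otimes> inv b"
    unfolding tb_r_def app einv one defs(1)[symmetric] by (simp add: m_assoc)
  have R2: "?e (tb_r p q) = H \<otimes> D"
    unfolding r app defs by simp
  have "map swap (tb_r p q) = rev (tb_w p q) @ [(gv, True)] @ inv_word (rev (tb_w p q)) @ [(gu, False)]"
    by (simp add: tb_r_def swap_inv swap_w[OF pq])
  hence "?e (rev (tb_w p q) @ [(gv, True)] @ inv_word (rev (tb_w p q)) @ [(gu, False)]) = ?e (inv_word h @ inv_word d)"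
    using sr by simp
  hence S: "W' \<otimes> b \<otimes> inv W' \<otimes> inv a = inv H \<otimes> inv D"
    unfolding app einv one defs(2-4)[symmetric] by (simp add: m_assoc)
  have az: "a \<otimes> z = z \<otimes> a"
  proof -
    have "?e (replicate k (gu, s)) \<otimes> a = a \<otimes> ?e (replicate k (gu, s))" for k s
    proof (induction k)
      case 0
      show ?case by (simp add: word_eval_def)
    next
      case (Suc k)
      define y where "y = ?e [(gu, s)]"
      have y: "y \<in> carrier G" "y \<otimes> a = a \<otimes> y" unfolding y_def using one by (cases s; simp)+
      define t where "t = ?e (replicate k (gu, s))"
      have t: "t \<in> carrier G" "t \<otimes> a = a \<otimes> t" unfolding t_def using cl Suc by auto
      have "?e (replicate (Suc k) (gu, s)) = y \<otimes> t"
        unfolding y_def t_def using app[of "[(gu, s)]" "replicate k (gu, s)"] by simp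
      thus ?case using y t by (metis m_assoc cl2(5))
    qed
    thus ?thesis unfolding defs(7) u_power_def by simp
  qed
  have L: "?e (tb_longitude p q) = W' \<otimes> W \<otimes> z"
    unfolding tb_longitude_def app defs using cl by (simp add: m_assoc)
  have "?e ([(gu, True)] @ tb_longitude p q @ [(gu, False)] @ inv_word (tb_longitude p q))
      = a \<otimes> (W' \<otimes> W \<otimes> z) \<otimes> inv a \<otimes> inv (W' \<otimes> W \<otimes> z)"
    unfolding app einv L one by (simp add: m_assoc)
  also have "\<dots> = a \<otimes> W' \<otimes> W \<otimes> (z \<otimes> inv a \<otimes> inv z) \<otimes> inv W \<otimes> inv W'"
    by (simp add: m_assoc inv_mult_group)
  also have "z \<otimes> inv a \<otimes> inv z = inv a"
  proof -
    have "inv (z \<otimes> inv a \<otimes> inv z) = z \<otimes> a \<otimes> inv z" by (simp add: inv_mult_group m_assoc)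
    also have "\<dots> = a" unfolding az[symmetric] by (simp add: m_assoc)
    finally show ?thesis by (metis cl2(5,7) inv_closed inv_inv m_closed)
  qed
  finally have lhs: "?e ([(gu, True)] @ tb_longitude p q @ [(gu, False)] @ inv_word (tb_longitude p q))
      = a \<otimes> W' \<otimes> W \<otimes> inv a \<otimes> inv W \<otimes> inv W'" .
  have canc: "x \<otimes> (inv x \<otimes> y) = y" "inv x \<otimes> (x \<otimes> y) = y"
    if "x \<in> carrier G" "y \<in> carrier G" for x y
    using that by (simp_all add: m_assoc[symmetric])
  have DH: "D \<otimes> H = a \<otimes> W' \<otimes> inv b \<otimes> inv W'"
  proof -
    have "D \<otimes> H = inv (inv H \<otimes> inv D)" by (simp add: inv_mult_group)
    also have "\<dots> = inv (W' \<otimes> b \<otimes> inv W' \<otimes> inv a)" by (simp only: S)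
    also have "\<dots> = a \<otimes> W' \<otimes> inv b \<otimes> inv W'" by (simp add: inv_mult_group m_assoc)
    finally show ?thesis .
  qed
  have bc: "boundary_chain p q = [(1, inv_word h), (-1, rev (tb_w p q))]"
    unfolding boundary_chain_def Let_def c_def[symmetric] n_def[symmetric] h_def by simp
  have "?e (conjugates (tb_r p q) (boundary_chain p q))
     = inv H \<otimes> (H \<otimes> D) \<otimes> inv (inv H) \<otimes> (W' \<otimes> inv (W \<otimes> a \<otimes> inv W \<otimes> inv b) \<otimes> inv W')"
  proof -
    have "conjugates (tb_r p q) (boundary_chain p q) = inv_word h @ tb_r p q @ inv_word (inv_word h) @
        rev (tb_w p q) @ inv_word (tb_r p q) @ inv_word (rev (tb_w p q))"
      unfolding bc conjugates_def by simp
    hence "?e (conjugates (tb_r p q) (boundary_chain p q)) = inv H \<otimes> (?e (tb_r p q) \<otimes> (inv (inv H) \<otimes>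
        (W' \<otimes> (inv (?e (tb_r p q)) \<otimes> inv W'))))"
      by (simp only: app einv defs(2,3))
    also have "?e (tb_r p q) \<otimes> (inv (inv H) \<otimes> (W' \<otimes> (inv (?e (tb_r p q)) \<otimes> inv W')))
      = (H \<otimes> D) \<otimes> (inv (inv H) \<otimes> (W' \<otimes> (inv (W \<otimes> a \<otimes> inv W \<otimes> inv b) \<otimes> inv W')))"
      using R1 R2 by simp
    finally show ?thesis by (simp add: m_assoc)
  qed
  also have "\<dots> = (D \<otimes> H) \<otimes> (W' \<otimes> inv (W \<otimes> a \<otimes> inv W \<otimes> inv b) \<otimes> inv W')"
    by (simp add: m_assoc canc)
  also have "\<dots> = a \<otimes> W' \<otimes> W \<otimes> inv a \<otimes> inv W \<otimes> inv W'"
    unfolding DH by (simp add: m_assoc inv_mult_group canc)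
  finally show ?thesis using lhs by simp
qed

end


section \<open>The representations\<close>

definition rho_gen :: "'a::comm_ring_1 \<Rightarrow> gen \<Rightarrow> 'a mat" where
  "rho_gen x g = (case g of
     gu \<Rightarrow> mat_of_rows_list 2 [[1, x], [0, 1]]
   | gv \<Rightarrow> mat_of_rows_list 2 [[1, 0], [x, 1]])"

text \<open>The inverse of a 2 by 2 matrix of determinant 1.\<close>

definition sl2_inv :: "'a::comm_ring_1 mat \<Rightarrow> 'a mat" where
  "sl2_inv A = mat_of_rows_list 2
     [[A $$ (1, 1), - (A $$ (0, 1))], [- (A $$ (1, 0)), A $$ (0, 0)]]"

definition rho1 :: "'a::comm_ring_1 \<Rightarrow> gword \<Rightarrow> 'a mat" where
  "rho1 x w =
     foldr (\<lambda>(g, s) M. (if s then rho_gen x g else sl2_inv (rho_gen x g)) * M) w (1\<^sub>m 2)"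

text \<open>The parameter \<open>\<kappa>\<close> stands for the scalar 1/2 of V.  The list \<open>sl2_coords M\<close> consists of the
  coordinates of a trace-free matrix \<open>M\<close> in the basis \<open>sl2_basis \<kappa>\<close>; the column \<open>j\<close> of
  \<open>rho2 \<kappa> x w\<close> holds the coordinates of the basis element \<open>j\<close> conjugated by \<open>rho1 x w\<close>.\<close>

definition sl2_basis :: "'a::comm_ring_1 \<Rightarrow> 'a mat list" where
  "sl2_basis \<kappa> =
     [mat_of_rows_list 2 [[0, 1], [0, 0]],
      mat_of_rows_list 2 [[\<kappa>, 0], [0, - \<kappa>]],
      mat_of_rows_list 2 [[0, 0], [1, 0]]]"

definition sl2_coords :: "'a::comm_ring_1 mat \<Rightarrow> 'a list" where
  "sl2_coords M = [M $$ (0, 1), M $$ (0, 0) - M $$ (1, 1), M $$ (1, 0)]"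

definition rho2 :: "'a::comm_ring_1 \<Rightarrow> 'a \<Rightarrow> gword \<Rightarrow> 'a mat" where
  "rho2 \<kappa> x w = mat 3 3 (\<lambda>(i, j).
     sl2_coords (rho1 x w * (sl2_basis \<kappa> ! j) * sl2_inv (rho1 x w)) ! i)"

definition eval_chain :: "nat \<Rightarrow> (gword \<Rightarrow> 'a::comm_ring_1 mat) \<Rightarrow> gchain \<Rightarrow> 'a mat" where
  "eval_chain d \<rho> zs = foldr (\<lambda>(c, w) M. of_int c \<cdot>\<^sub>m \<rho> w + M) zs (0\<^sub>m d d)"


section \<open>The twisted complexes\<close>

definition hconcat :: "'a::zero mat \<Rightarrow> 'a mat \<Rightarrow> 'a mat" where
  "hconcat A B = four_block_mat A B (0\<^sub>m 0 (dim_col A)) (0\<^sub>m 0 (dim_col B))"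

definition D0 :: "nat \<Rightarrow> (gword \<Rightarrow> 'a::comm_ring_1 mat) \<Rightarrow> 'a mat" where
  "D0 d \<rho> = (\<rho> [(gu, True)] - 1\<^sub>m d) @\<^sub>r (\<rho> [(gv, True)] - 1\<^sub>m d)"

definition D1 :: "nat \<Rightarrow> nat \<Rightarrow> nat \<Rightarrow> (gword \<Rightarrow> 'a::comm_ring_1 mat) \<Rightarrow> 'a mat" where
  "D1 p q d \<rho> =
     hconcat (eval_chain d \<rho> (fox gu (tb_r p q))) (eval_chain d \<rho> (fox gv (tb_r p q)))"

definition complex1 :: "nat \<Rightarrow> nat \<Rightarrow> 'a::comm_ring_1 \<Rightarrow> 'a mat list" where
  "complex1 p q x = [D0 2 (rho1 x), D1 p q 2 (rho1 x)]"

text \<open>The row matrix of the linear form \<open>\<xi> \<mapsto> Tr(\<xi> E)\<close>.\<close>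

definition pair_E :: "'a::comm_ring_1 \<Rightarrow> 'a mat" where
  "pair_E \<kappa> = mat 1 3 (\<lambda>(_, j).
     (let M = (sl2_basis \<kappa> ! j) * (sl2_basis \<kappa> ! 0) in M $$ (0, 0) + M $$ (1, 1)))"

text \<open>A 1-cocycle restricts to the meridian as its value on \<open>u\<close>.  A 2-cochain \<open>\<zeta>\<close> restricts to the
  2-cell of the torus as the value of the boundary chain acting on \<open>\<zeta>\<close>.  Poincare duality on the
  circle and on the torus, evaluated at the invariant vector E, pairs these values with E.\<close>

definition f1 :: "'a::comm_ring_1 \<Rightarrow> 'a mat" where
  "f1 \<kappa> = hconcat (pair_E \<kappa>) (0\<^sub>m 1 3)"

definition f2 :: "nat \<Rightarrow> nat \<Rightarrow> 'a::comm_ring_1 \<Rightarrow> 'a \<Rightarrow> 'a mat" where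
  "f2 p q \<kappa> x = pair_E \<kappa> * eval_chain 3 (rho2 \<kappa> x) (boundary_chain p q)"

definition cone2 :: "nat \<Rightarrow> nat \<Rightarrow> 'a::comm_ring_1 \<Rightarrow> 'a \<Rightarrow> 'a mat list" where
  "cone2 p q \<kappa> x =
     [D0 3 (rho2 \<kappa> x),
      D1 p q 3 (rho2 \<kappa> x) @\<^sub>r f1 \<kappa>,
      hconcat (f2 p q \<kappa> x) (0\<^sub>m 1 1)]"


section \<open>Torsion\<close>

text \<open>A complex of based free modules is given by the list of the matrices of its differentials
  which act on column vectors.\<close>

definition mat_image :: "'a::comm_ring_1 mat \<Rightarrow> 'a vec set" where
  "mat_image A = (\<lambda>v. A *\<^sub>v v) ` carrier_vec (dim_col A)"

definition acyclic_complex :: "'a::comm_ring_1 mat list \<Rightarrow> bool" where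
  "acyclic_complex Ds \<longleftrightarrow> Ds \<noteq> [] \<and>
     mat_kernel (hd Ds) = {0\<^sub>v (dim_col (hd Ds))} \<and>
     (\<forall>i. Suc i < length Ds \<longrightarrow>
        dim_row (Ds ! i) = dim_col (Ds ! Suc i) \<and> mat_kernel (Ds ! Suc i) = mat_image (Ds ! i)) \<and>
     mat_image (last Ds) = carrier_vec (dim_row (last Ds))"

text \<open>\<open>J i\<close> is the set of basis vectors in degree \<open>i\<close> that are used as rows of the minor of the
  differential \<open>i - 1\<close>.  The determinant of a non-square matrix is 0 in the library, so that
  invertibility of a minor includes that it is square.  The last condition says that \<open>\<tau>\<close> is, up to
  sign, the alternating product of the minors.\<close>

definition cayley_minor :: "'a::comm_ring_1 mat list \<Rightarrow> (nat \<Rightarrow> nat set) \<Rightarrow> nat \<Rightarrow> 'a" where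
  "cayley_minor Ds J i = det (submatrix (Ds ! i) (J (Suc i)) ({..<dim_col (Ds ! i)} - J i))"

definition is_torsion :: "'a::comm_ring_1 mat list \<Rightarrow> 'a \<Rightarrow> bool" where
  "is_torsion Ds \<tau> \<longleftrightarrow> acyclic_complex Ds \<and>
     (\<exists>J. J 0 = {} \<and> J (length Ds) = {..<dim_row (last Ds)} \<and>
        (\<forall>i<length Ds. J (Suc i) \<subseteq> {..<dim_row (Ds ! i)} \<and> cayley_minor Ds J i dvd 1) \<and>
        (\<exists>s\<in>{1, -1}. \<tau> * (\<Prod>i | i < length Ds \<and> even i. cayley_minor Ds J i) =
           s * (\<Prod>i | i < length Ds \<and> odd i. cayley_minor Ds J i)))"

end

theory Submission
  imports
    Defs
    "Jordan_Normal_Form.Char_Poly"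
    "HOL-Computational_Algebra.Polynomial_Factorial"
    "HOL-Computational_Algebra.Field_as_Ring"
begin

text \<open>The image of \<open>w\<close> has first row \<open>(0, i)\<close> and is symmetric, because \<open>w\<close> is a palindrome
  up to exchanging \<open>u\<close> and \<open>v\<close>; hence \<open>i\<^sup>2 = -1\<close>.  The identity
  \<open>[u, \<lambda>] = h\<^sup>-\<^sup>1 r h \<cdot> w' r\<^sup>-\<^sup>1 w'\<^sup>-\<^sup>1\<close> differentiates to
  \<open>(h\<^sup>-\<^sup>1 - w') \<partial>r/\<partial>g = (1 - \<lambda>) \<partial>u/\<partial>g + (u - 1) \<partial>\<lambda>/\<partial>g\<close>, where the first column of \<open>h\<close> starts with
  \<open>P\<^bsub>l-1\<^esub>\<close>.  A row vector fixed by \<open>u\<close> kills the last term.  In the standard representation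
  \<open>\<lambda>\<close> acts on it by \<open>-1\<close>, which gives \<open>P\<^bsub>l-1\<^esub> \<Delta>\<^sub>1 = \<plusminus>2\<close>; in the adjoint representation \<open>\<lambda>\<close> fixes
  it, so that the linear form \<open>f\<^sub>2\<close>, whose last entry is \<open>P\<^bsub>l-1\<^esub>\<^sup>2\<close>, vanishes on the image of \<open>D\<^sup>1\<close>.  The
  only other entry of the adjoint complex that enters the torsion is a Fox derivative of \<open>w\<close>, an
  alternating sum of the squares of the odd \<open>P\<^sub>k\<close>.  It is \<open>-1/2\<close> times \<open>\<Omega>\<close> since
  \<open>\<epsilon>\<^bsub>k+1\<^esub> x P\<^sub>k\<^sup>2 = P\<^bsub>k+1\<^esub> P\<^sub>k - P\<^sub>k P\<^bsub>k-1\<^esub>\<close> telescopes.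

  The adjoint complex is acyclic only if \<open>\<Omega>\<close> is invertible.  Over the integers,
  \<open>x\<^sup>2 \<Omega> / 2\<close> is congruent to \<open>-1\<close> modulo 2, because the sum of squares is modulo 2 the square of
  the sum and the latter telescopes to \<open>i/x\<close>; so multiplication by it is injective on V.\<close>

section \<open>The algebra V\<close>

lemma tb_sign_sq: "tb_sign p q k * tb_sign p q k = 1"
  by (simp add: tb_sign_def flip: power_add)

text \<open>As p does not divide kq, the floors of kq/p and (p-k)q/p add up to q - 1, which is even.
  This is the symmetry of the exponents of w.\<close>

lemma tb_sign_palindrome:
  assumes "coprime p q" "odd q" "0 < k" "k < p"
  shows "tb_sign p q (p - k) = tb_sign p q k"
proof -
  have "\<not> p dvd k * q"
    using assms by (metis coprime_dvd_mult_left_iff dvd_imp_le not_le)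
  hence nd: "\<not> int p dvd int k * int q" by (metis of_nat_dvd_iff of_nat_mult)
  hence nd': "int k * int q mod int p \<noteq> 0" by (simp add: dvd_eq_mod_eq_0)
  have "int ((p - k) * q div p) = (- (int k * int q) + int p * int q) div int p"
    using assms by (simp add: zdiv_int of_nat_diff algebra_simps)
  also have "\<dots> = int q + (- (int k * int q)) div int p"
    using assms by (subst div_mult_self2) auto
  also have "(- (int k * int q)) div int p = - int (k * q div p) - 1"
    using nd' assms by (subst zdiv_zminus1_eq_if) (auto simp: zdiv_int)
  finally have "even (int ((p - k) * q div p)) = even (int (k * q div p))"
    using assms(2) by simp
  thus ?thesis by (simp add: tb_sign_def minus_one_power_iff)
qed

locale two_bridge =
  fixes p q :: nat and \<pi> :: "rat poly \<Rightarrow> 'a::comm_ring_1"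
  assumes q_pos: "0 < q" and q_less: "q < p" and coprime_pq: "coprime p q"
    and odd_p: "odd p" and odd_q: "odd q" and algebra: "tb_algebra p q \<pi>"
begin

definition x :: 'a where "x = \<pi> [:0, 1:]"
definition \<kappa> :: 'a where "\<kappa> = \<pi> [:1/2:]"
definition P :: "nat \<Rightarrow> 'a" where "P k = \<pi> (tb_rat_poly p q k)"
text \<open>\<open>Q k\<close> is the image of the polynomial of index k - 1, with value 0 at index
  -1, so that the recursion has one form for all k.\<close>

definition Q :: "nat \<Rightarrow> 'a" where "Q k = (case k of 0 \<Rightarrow> 0 | Suc j \<Rightarrow> P j)"
definition s :: "nat \<Rightarrow> 'a" where "s k = of_int (tb_sign p q k)"
text \<open>The integral subring, the image of Z[X]. Since 2 is invertible in V, a congruence modulo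
  2 has content only when the quotient is kept inside \<open>R\<close>.\<close>

definition R :: "'a set" where "R = range (\<lambda>F. \<pi> (map_poly rat_of_int F))"

sublocale \<pi>: comm_ring_hom \<pi>
  using algebra by (simp add: tb_algebra_def)

lemma surj_\<pi>: "surj \<pi>" and \<pi>_eq_0_iff: "\<pi> f = 0 \<longleftrightarrow> tb_rat_poly p q (p - 1) dvd f"
  using algebra by (simp_all add: tb_algebra_def)

lemma p_ge_3: "p \<ge> 3"
  using q_pos q_less odd_p by (cases "p = 2") auto

lemma s_sq [simp]: "s k * s k = 1" "s k * (s k * a) = a"
proof -
  show 1: "s k * s k = 1" by (simp add: s_def tb_sign_sq flip: of_int_mult)
  show "s k * (s k * a) = a" by (simp add: 1 flip: mult.assoc)
qed

lemma tb_sign_1: "tb_sign p q (Suc 0) = 1"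
  using q_less by (simp add: tb_sign_def)

lemma s_1 [simp]: "s (Suc 0) = 1"
  by (simp add: s_def tb_sign_1)

lemma \<pi>_of_int [simp]: "\<pi> [:rat_of_int n:] = of_int n"
  by (metis \<pi>.hom_of_int of_int_poly)

lemma two_\<kappa>: "2 * \<kappa> = 1"
proof -
  have "\<pi> [:2:] * \<pi> [:1/2:] = \<pi> 1" by (simp add: one_pCons flip: \<pi>.hom_mult)
  thus ?thesis using \<pi>_of_int[of 2] by (simp add: \<kappa>_def)
qed

lemma hom_int_poly: "\<pi> (map_poly rat_of_int (pCons a F)) = of_int a + x * \<pi> (map_poly rat_of_int F)"
proof -
  have "map_poly rat_of_int (pCons a F) = [:rat_of_int a:] + [:0,1:] * map_poly rat_of_int F"
    by (simp add: of_int_hom.map_poly_pCons_hom)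
  thus ?thesis by (simp only: \<pi>.hom_add \<pi>.hom_mult \<pi>_of_int x_def)
qed

lemma R_closed [intro]:
  "of_int n \<in> R" "x \<in> R" "a \<in> R \<Longrightarrow> b \<in> R \<Longrightarrow> a + b \<in> R" "a \<in> R \<Longrightarrow> b \<in> R \<Longrightarrow> a * b \<in> R"
proof -
  show "of_int n \<in> R" unfolding R_def
    using hom_int_poly[of n 0] by (intro image_eqI[of _ _ "[:n:]"]) auto
  show "x \<in> R" unfolding R_def
    using hom_int_poly[of 0 "[:1:]"] hom_int_poly[of 1 0] by (intro image_eqI[of _ _ "[:0,1:]"]) auto
  show "a \<in> R \<Longrightarrow> b \<in> R \<Longrightarrow> a + b \<in> R" "a \<in> R \<Longrightarrow> b \<in> R \<Longrightarrow> a * b \<in> R"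
    unfolding R_def
    by (auto simp: image_iff \<pi>.hom_add[symmetric] \<pi>.hom_mult[symmetric] of_int_poly_hom.hom_add[symmetric]
        of_int_poly_hom.hom_mult[symmetric] simp del: \<pi>.hom_add \<pi>.hom_mult of_int_poly_hom.hom_add of_int_poly_hom.hom_mult)
qed

lemma R_sum: "(\<And>i. i \<in> I \<Longrightarrow> f i \<in> R) \<Longrightarrow> sum f I \<in> R"
  by (induction I rule: infinite_finite_induct) (use R_closed(1)[of 0] in auto)

lemma P_0 [simp]: "P 0 = 1" and Q_0 [simp]: "Q 0 = 0" and Q_Suc [simp]: "Q (Suc k) = P k"
  by (simp_all add: P_def Q_def)

lemma P_Suc: "P (Suc k) = s (Suc k) * x * P k + Q k"
proof -
  have e: "\<pi> (map_poly rat_of_int [:0, tb_sign p q j:]) = s j * x" for j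
    by (simp add: hom_int_poly s_def mult.commute)
  show ?thesis
    by (cases k) (simp_all add: P_def of_int_poly_hom.hom_add of_int_poly_hom.hom_mult \<pi>.hom_add \<pi>.hom_mult e del: mult_pCons_left mult_pCons_right)
qed

lemma P_in_R: "P k \<in> R" by (auto simp: P_def R_def)

lemma s_in_R: "s k \<in> R" by (auto simp: s_def)

text \<open>The recursion solved for \<open>x * P k\<close>, a sign being its own inverse:
  multiplication by x is tridiagonal in the \<open>P k\<close>, with entries 1 and -1.\<close>

lemma x_P: "x * P k = s (Suc k) * (P (Suc k) - Q k)"
  by (simp add: P_Suc algebra_simps)

lemma P_last: "P (p - 1) = 0"
  by (simp add: P_def \<pi>_eq_0_iff)

section \<open>Invertibility of x and telescoping sums\<close>

lemma P_even: "\<exists>a. P (2 * k) = 1 + x * a" 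
proof (induction k)
  case (Suc k)
  then obtain a where "P (2 * k) = 1 + x * a" by auto
  hence "P (2 * Suc k) = 1 + x * (s (2 * k + 2) * P (2 * k + 1) + a)"
    using P_Suc[of "2 * k + 1"] by (simp add: algebra_simps)
  thus ?case by blast
qed (auto intro: exI[of _ 0])

text \<open>As p - 1 is even, \<open>P (p - 1)\<close> has constant term 1; it vanishes in V, so 1
  is a multiple of x.\<close>

lemma x_unit: "x dvd 1"
proof -
  obtain a where "P (2 * ((p - 1) div 2)) = 1 + x * a" using P_even by blast
  hence "1 = x * (- a)" using P_last odd_p by (simp add: eq_neg_iff_add_eq_0)
  thus ?thesis by (rule dvdI)
qed

lemma cancel_x: "x * a = x * b \<Longrightarrow> a = b"
proof -
  assume eq: "x * a = x * b"
  obtain y where y: "1 = x * y" using x_unit by (rule dvdE)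
  have "a = y * (x * a)" "b = y * (x * b)"
    by (simp_all add: y[symmetric] mult.commute[of y] flip: mult.assoc)
  thus "a = b" using eq by simp
qed

text \<open>Multiply the recursion by \<open>P n\<close>: each summand is the difference of
  consecutive products. At n = p - 1 the value is 0.\<close>

lemma sum_sign_P_sq: "(\<Sum>k<n. s (Suc k) * x * (P k)\<^sup>2) = P n * Q n"
  by (induction n) (simp_all add: P_Suc algebra_simps power2_eq_square)

text \<open>Each summand is \<open>Q (2 * j + 2) - Q (2 * j)\<close> by the recursion. At 2m = p - 1
  the value is the off-diagonal entry of the matrix of w.\<close>

lemma sum_even_P: "(\<Sum>j<m. s (2 * j + 1) * x * P (2 * j)) = Q (2 * m)"
  by (induction m) (simp_all add: P_Suc)

text \<open>The even and the odd part of Omega without the factor (-1)^k, so that Omega is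
  \<open>even_sum - odd_sum\<close>. The odd part is the one that appears as a Fox derivative of
  w.\<close>

definition even_sum :: 'a where "even_sum = (\<Sum>j<(p - 1) div 2. s (2 * j + 1) * (P (2 * j))\<^sup>2)"
definition odd_sum :: 'a where "odd_sum = (\<Sum>j<(p - 1) div 2. s (2 * j + 2) * (P (2 * j + 1))\<^sup>2)"

lemma sum_double: "(\<Sum>k<2 * m. f k) = (\<Sum>j<m. f (2 * j)) + (\<Sum>j<m. f (2 * j + 1))"
  for f :: "nat \<Rightarrow> 'a"
  by (induction m) (simp_all add: algebra_simps)

text \<open>Up to the unit x this is the telescoping sum ending in \<open>P (p - 1) = 0\<close>.
  Hence Omega equals \<open>2 * even_sum\<close> and also \<open>- 2 * odd_sum\<close>.\<close>

lemma even_sum_odd_sum: "even_sum + odd_sum = 0"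
proof -
  have "x * (even_sum + odd_sum) = (\<Sum>k<2 * ((p - 1) div 2). s (Suc k) * x * (P k)\<^sup>2)"
    unfolding sum_double even_sum_def odd_sum_def by (simp add: sum_distrib_left distrib_left algebra_simps)
  also have "\<dots> = 0" unfolding sum_sign_P_sq using P_last odd_p by simp
  finally show ?thesis using cancel_x[of "even_sum + odd_sum" 0] by simp
qed

text \<open>V is a quotient of the principal ideal domain Q[X] by a nonzero polynomial. A common
  factor of a representative and the modulus would give a zero divisor; without one, Bezout gives
  the inverse.\<close>

lemma unit_if_nonzerodivisor:
  fixes a :: 'a
  assumes "\<And>y. a * y = 0 \<Longrightarrow> y = 0"
  shows "a dvd 1"
proof -
  let ?f = "tb_rat_poly p q (p - 1)"
  obtain A where A: "a = \<pi> A" using surj_\<pi> by (metis surjD)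
  \<comment> \<open>Otherwise V would be Q[X] itself, in which X is not invertible.\<close>
  have f0: "?f \<noteq> 0"
  proof
    assume 0: "?f = 0"
    have "[:0,1:] * B \<noteq> (1 :: rat poly)" for B
    proof
      assume "[:0,1:] * B = 1"
      hence "poly ([:0,1:] * B) 0 = poly 1 0" by (rule arg_cong)
      thus False by simp
    qed
    moreover obtain b where b: "1 = x * b" using x_unit by (auto elim: dvdE)
    obtain B where "b = \<pi> B" using surj_\<pi> by (metis surjD)
    hence "\<pi> (1 - [:0,1:] * B) = 0" using b by (simp add: x_def \<pi>.hom_minus \<pi>.hom_mult del: mult_pCons_left mult_pCons_right)
    hence "1 - [:0,1:] * B = 0" using \<pi>_eq_0_iff[of "1 - [:0,1:] * B"] 0 by simp
    ultimately show False by (metis eq_iff_diff_eq_0)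
  qed
  define g where "g = gcd A ?f"
  obtain h A' where h: "?f = g * h" and A': "A = g * A'" by (metis g_def dvdE gcd_dvd1 gcd_dvd2)
  \<comment> \<open>The cofactor of the gcd is annihilated by a, since \<open>A * h\<close> is
    \<open>A'\<close> times the modulus.\<close>
  have "a * \<pi> h = 0"
    unfolding A \<pi>.hom_mult[symmetric] \<pi>_eq_0_iff using A' h by simp
  hence "?f dvd h" using assms \<pi>_eq_0_iff by blast
  then obtain k where "h = g * h * k" unfolding h by (metis dvdE)
  moreover have "h \<noteq> 0" using f0 h by auto
  moreover have "g * h * k = h * (g * k)" by (simp only: ac_simps)
  ultimately have "g * k = 1" by (simp only: mult_cancel_left1) simp
  hence "g dvd 1" by (metis dvdI)
  hence "coprime A ?f" unfolding g_def is_unit_gcd .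
  then obtain u v where "u * A + v * ?f = 1"
    by (metis bezout_coefficients_fst_snd coprime_imp_gcd_eq_1)
  hence "\<pi> u * a + \<pi> v * \<pi> ?f = 1" unfolding A by (metis \<pi>.hom_add \<pi>.hom_mult \<pi>.hom_one)
  moreover have "\<pi> ?f = 0" by (simp add: \<pi>_eq_0_iff)
  ultimately show ?thesis by (metis add.right_neutral dvd_triv_right mult_zero_right)
qed

text \<open>The cross terms of the square are even. The point is that the correction lies in
  \<open>R\<close>.\<close>

lemma sum_sq_mod_2:
  assumes "\<And>j. j < (m::nat) \<Longrightarrow> f j \<in> R"
  shows "\<exists>r\<in>R. (\<Sum>j<m. f j)\<^sup>2 = (\<Sum>j<m. (f j)\<^sup>2) + 2 * r"
  using assms
proof (induction m)
  case (Suc m)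
  then obtain r where r: "r \<in> R" "(\<Sum>j<m. f j)\<^sup>2 = (\<Sum>j<m. (f j)\<^sup>2) + 2 * r" by auto
  have "r + (\<Sum>j<m. f j) * f m \<in> R" using r(1) Suc.prems by (intro R_closed R_sum) auto
  moreover have "(\<Sum>j<Suc m. f j)\<^sup>2 = (\<Sum>j<Suc m. (f j)\<^sup>2) + 2 * (r + (\<Sum>j<m. f j) * f m)"
    using r(2) by (simp add: power2_eq_square algebra_simps)
  ultimately show ?case by blast
qed (use R_closed(1)[of 0] in \<open>auto intro!: bexI[of _ 0]\<close>)

end

section \<open>The Frobenius form\<close>

locale two_bridge_frobenius = two_bridge p q \<pi>
  for p q and \<pi> :: "rat poly \<Rightarrow> 'a::comm_ring_1" +
  fixes \<epsilon> :: "'a \<Rightarrow> rat"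
  assumes frobenius: "frobenius_form p q \<pi> \<epsilon>"
begin

lemma \<epsilon>_add: "\<epsilon> (a + b) = \<epsilon> a + \<epsilon> b" and \<epsilon>_scale: "\<epsilon> (\<pi> [:c:] * a) = c * \<epsilon> a"
  and \<epsilon>_1 [simp]: "\<epsilon> 1 = 1" and \<epsilon>_P: "0 < k \<Longrightarrow> k < p - 1 \<Longrightarrow> \<epsilon> (P k) = 0"
  using frobenius by (simp_all add: frobenius_form_def P_def)

lemma \<epsilon>_of_int: "\<epsilon> (of_int n * a) = of_int n * \<epsilon> a"
  using \<epsilon>_scale[of "of_int n"] by simp

lemma \<epsilon>_0 [simp]: "\<epsilon> 0 = 0"
  using \<epsilon>_of_int[of 0 0] by simp

lemma \<epsilon>_diff: "\<epsilon> (a - b) = \<epsilon> a - \<epsilon> b"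
  using \<epsilon>_add[of "a - b" b] by simp

text \<open>The diagonal entries of the form in the basis \<open>P k\<close>. They are signs, so the
  dual basis consists of the \<open>P k\<close> with the same signs.\<close>

definition \<eta> :: "nat \<Rightarrow> rat" where "\<eta> k = (-1) ^ k * of_int (tb_sign p q (Suc k))"

lemma \<eta>_sq: "\<eta> k * \<eta> k = 1"
  by (simp add: \<eta>_def mult.assoc mult.left_commute tb_sign_sq flip: of_int_mult power_add)

lemma tb_sign_sq_rat: "rat_of_int (tb_sign p q k) * rat_of_int (tb_sign p q k) = 1"
  by (simp add: tb_sign_sq flip: of_int_mult)

lemma \<pi>_const_mult: "\<pi> [:a * b:] = \<pi> [:a:] * \<pi> [:b:]"
  by (simp add: mult.commute flip: \<pi>.hom_mult)

text \<open>Multiplication by \<open>x\<close> is tridiagonal in the basis \<open>P\<^sub>k\<close> and self-adjoint for the diagonal form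
  with entries \<open>\<eta> k\<close>.\<close>

lemma orthogonal:
  "j < p - 1 \<Longrightarrow> k < p - 1 \<Longrightarrow> \<epsilon> (P j * P k) = (if j = k then \<eta> k else 0)"
proof (induction j arbitrary: k rule: less_induct)
  case (less j)
  show ?case
  proof (cases j)
    case 0
    then show ?thesis using \<epsilon>_P[of k] less.prems by (auto simp: \<eta>_def tb_sign_1)
  next
    case (Suc i)
    let ?t = "\<lambda>k. rat_of_int (tb_sign p q k)"
    have IH: "\<epsilon> (P i * P n) = (if i = n then \<eta> n else 0)" if "n < p - 1" for n
      using less that Suc by auto
    \<comment> \<open>For k = p - 2 the induction hypothesis does not apply; there
      \<open>P (Suc k)\<close> is \<open>P (p - 1) = 0\<close>.\<close>
    have i1: "\<epsilon> (P i * P (Suc k)) = (if i = Suc k then \<eta> (Suc k) else 0)"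
    proof (cases "Suc k < p - 1")
      case False
      hence "Suc k = p - 1" using less.prems by simp
      moreover have "i \<noteq> Suc k" using False less.prems Suc by auto
      ultimately show ?thesis using P_last by simp
    qed (use IH in auto)
    have i2: "\<epsilon> (P i * Q k) = (if Suc i = k then \<eta> i else 0)"
      using IH[of "k - 1"] less.prems by (cases k) auto
    have i3: "\<epsilon> (Q i * P k) = (if i = Suc k then \<eta> k else 0)"
    proof (cases i)
      case (Suc n)
      hence "\<epsilon> (P n * P k) = (if n = k then \<eta> k else 0)"
        using less.IH[of n k] less.prems \<open>j = Suc i\<close> by auto
      thus ?thesis using Suc by simp
    qed simp
    \<comment> \<open>The factor x in the recursion for \<open>P j\<close> is moved over to
      \<open>P k\<close>, where \<open>x_P\<close> applies; only indices below j remain on the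
      left.\<close>
    have "P j * P k = of_int (tb_sign p q j) * (of_int (tb_sign p q (Suc k)) * (P i * P (Suc k) - P i * Q k)) + Q i * P k"
    proof -
      have "P j * P k = s j * P i * (x * P k) + Q i * P k"
        unfolding Suc P_Suc by (simp add: algebra_simps)
      thus ?thesis unfolding x_P s_def by (simp add: algebra_simps)
    qed
    hence e: "\<epsilon> (P j * P k) = ?t j * (?t (Suc k) * ((if i = Suc k then \<eta> (Suc k) else 0) -
        (if Suc i = k then \<eta> i else 0))) + (if i = Suc k then \<eta> k else 0)"
      using i1 i2 i3 by (simp only: \<epsilon>_add \<epsilon>_of_int \<epsilon>_diff)
    \<comment> \<open>Two cases remain: k = j, which produces the diagonal entry, and k = j - 2,
      where two terms cancel. All other k give 0 termwise.\<close>
    have "?t j * (?t (Suc k) * (- \<eta> i)) = \<eta> k" if "Suc i = k"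
    proof -
      have "?t j * (?t (Suc k) * (- \<eta> i)) = (?t k * ?t k) * \<eta> k"
        using Suc by (simp add: \<eta>_def flip: that)
      thus ?thesis by (simp only: tb_sign_sq_rat mult_1)
    qed
    moreover have "?t j * (?t (Suc k) * \<eta> (Suc k)) + \<eta> k = 0" if "i = Suc k"
    proof -
      have "?t j * (?t (Suc k) * \<eta> (Suc k)) = (?t j * ?t j) * (- \<eta> k)"
        using Suc that by (simp add: \<eta>_def)
      thus ?thesis by (simp only: tb_sign_sq_rat mult_1 add.left_inverse)
    qed
    ultimately show ?thesis unfolding e using Suc by auto
  qed
qed

text \<open>The elements satisfying this form a rational subspace that contains 1 and is stable
  under multiplication by x, hence all of V. Stability holds because x is tridiagonal and
  \<open>P (p - 1)\<close> vanishes.\<close>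

lemma expansion: "y = (\<Sum>k<p-1. \<pi> [:\<eta> k * \<epsilon> (y * P k):] * P k)"
proof -
  define C where "C y \<longleftrightarrow> y = (\<Sum>k<p-1. \<pi> [:\<eta> k * \<epsilon> (y * P k):] * P k)" for y
  have add: "C (a + b)" if "C a" "C b" for a b
  proof -
    have "[:u + v:] = [:u:] + [:v:]" for u v :: rat by simp
    hence "(\<Sum>k<p-1. \<pi> [:\<eta> k * \<epsilon> ((a + b) * P k):] * P k) =
      (\<Sum>k<p-1. \<pi> [:\<eta> k * \<epsilon> (a * P k):] * P k) + (\<Sum>k<p-1. \<pi> [:\<eta> k * \<epsilon> (b * P k):] * P k)"
      by (simp only: distrib_right distrib_left \<epsilon>_add \<pi>.hom_add sum.distrib)
    thus ?thesis using that unfolding C_def by simp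
  qed
  have scale: "C (\<pi> [:c:] * a)" if "C a" for a c
  proof -
    have "\<pi> [:\<eta> k * \<epsilon> (\<pi> [:c:] * a * P k):] = \<pi> [:c:] * \<pi> [:\<eta> k * \<epsilon> (a * P k):]" for k
    proof -
      have "\<epsilon> (\<pi> [:c:] * a * P k) = c * \<epsilon> (a * P k)" by (simp only: mult.assoc \<epsilon>_scale)
      thus ?thesis by (simp only: \<pi>_const_mult ac_simps)
    qed
    hence "(\<Sum>k<p-1. \<pi> [:\<eta> k * \<epsilon> (\<pi> [:c:] * a * P k):] * P k) =
        \<pi> [:c:] * (\<Sum>k<p-1. \<pi> [:\<eta> k * \<epsilon> (a * P k):] * P k)"
      by (simp add: sum_distrib_left mult.assoc)
    thus ?thesis using that unfolding C_def by simp
  qed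
  have zero: "C 0" by (simp add: C_def)
  have neg: "C (- a)" if "C a" for a
    using scale[OF that, of "-1"] \<pi>_of_int[of "-1"] by simp
  have sgn: "C (s j * a)" if "C a" for a j
    using scale[OF that, of "of_int (tb_sign p q j)"] by (simp add: s_def)
  have P: "C (P j)" if "j < p - 1" for j
  proof -
    have "(\<Sum>k<p-1. \<pi> [:\<eta> k * \<epsilon> (P j * P k):] * P k) = (\<Sum>k<p-1. if k = j then P k else 0)"
      using that by (intro sum.cong) (auto simp: orthogonal \<eta>_sq simp flip: one_pCons)
    thus ?thesis using that by (simp add: C_def)
  qed
  have xP: "C (x * P j)" if "j < p - 1" for j
  proof -
    have "C (P (Suc j))"
    proof (cases "Suc j < p - 1")
      case False
      hence "Suc j = p - 1" using that by simp
      thus ?thesis using P_last zero by simp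
    qed (rule P)
    moreover have "C (Q j)" using P zero that by (cases j) auto
    ultimately show ?thesis unfolding x_P diff_conv_add_uminus by (intro sgn add neg)
  qed
  have sum: "C (sum f I)" if "\<And>i. i \<in> I \<Longrightarrow> C (f i)" for f and I :: "nat set"
    using that by (induction I rule: infinite_finite_induct) (auto intro: zero add)
  have mult_x: "C (x * a)" if "C a" for a
  proof -
    define c where "c = (\<lambda>k. \<pi> [:\<eta> k * \<epsilon> (a * P k):])"
    have a: "a = (\<Sum>k<p-1. c k * P k)" using that by (simp add: C_def c_def)
    have "x * a = (\<Sum>k<p-1. c k * (x * P k))"
      by (subst a) (simp add: sum_distrib_left mult.left_commute)
    thus ?thesis unfolding c_def by (auto intro!: sum scale xP)
  qed
  have "C (\<pi> f)" for f
  proof (induction f)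
    case (pCons c f)
    have "pCons c f = [:c:] * 1 + [:0,1:] * f" by simp
    hence "\<pi> (pCons c f) = \<pi> [:c:] * 1 + x * \<pi> f"
      by (simp only: \<pi>.hom_add \<pi>.hom_mult \<pi>.hom_one x_def)
    moreover have "C 1" using P[of 0] p_ge_3 by simp
    ultimately show ?case using pCons.IH add scale mult_x by metis
  qed (simp add: zero)
  moreover obtain f where "y = \<pi> f" using surj_\<pi> by (metis surjD)
  ultimately show ?thesis by (simp add: C_def)
qed

text \<open>Shows that Omega does not depend on how the inverse tensor is written.\<close>

lemma Omega_eq:
  assumes "inverse_form \<pi> \<epsilon> N a b"
  shows "(\<Sum>i<N. a i * b i) = even_sum - odd_sum"
proof -
  have inv: "(\<Sum>i<N. \<pi> [:\<epsilon> (b i * y):] * a i) = y" for y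
    using assms by (simp add: inverse_form_def)

  have "(\<Sum>i<N. a i * b i) = (\<Sum>i<N. a i * (\<Sum>k<p-1. \<pi> [:\<eta> k * \<epsilon> (b i * P k):] * P k))"
    using expansion by (intro sum.cong arg_cong2[where f = "(*)"] refl)
  \<comment> \<open>With the sums exchanged, the inner sum over i is the contraction of the tensor
    with \<open>P k\<close>, that is, \<open>P k\<close> itself.\<close>
  also have "\<dots> = (\<Sum>k<p-1. \<pi> [:\<eta> k:] * P k * (\<Sum>i<N. \<pi> [:\<epsilon> (b i * P k):] * a i))"
    unfolding sum_distrib_left \<pi>_const_mult by (subst sum.swap) (simp add: ac_simps)
  also have "\<dots> = (\<Sum>k<2 * ((p - 1) div 2). \<pi> [:\<eta> k:] * (P k)\<^sup>2)"
    using odd_p by (simp add: inv power2_eq_square mult.assoc)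
  also have "\<dots> = even_sum - odd_sum"
  proof -
    have "\<pi> [:\<eta> k:] = (-1) ^ k * s (Suc k)" for k
      using \<pi>_of_int[of "(-1) ^ k * tb_sign p q (Suc k)"] by (simp add: \<eta>_def s_def)
    thus ?thesis unfolding sum_double even_sum_def odd_sum_def by (simp add: sum_negf)
  qed
  finally show ?thesis .
qed

text \<open>Elements with integral pairings against all \<open>P k\<close> form an
  \<open>R\<close>-module, as multiplication by x only mixes neighbouring \<open>P k\<close> with
  signs; the proof runs through the integer polynomial by Horner's scheme.\<close>

lemma \<epsilon>_R_integral: "y \<in> R \<Longrightarrow> (\<And>k. k < p - 1 \<Longrightarrow> \<epsilon> (z * P k) \<in> \<int>) \<Longrightarrow> k < p - 1 \<Longrightarrow> \<epsilon> (y * z * P k) \<in> \<int>"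
proof -
  have "k < p - 1 \<Longrightarrow> \<epsilon> (\<pi> (map_poly rat_of_int F) * z * P k) \<in> \<int>" 
    if z: "\<And>k. k < p - 1 \<Longrightarrow> \<epsilon> (z * P k) \<in> \<int>" for F k
  proof (induction F arbitrary: k)
    case (pCons c F)
    let ?y = "\<pi> (map_poly rat_of_int F) * z"
    have 1: "\<epsilon> (?y * P (Suc k)) \<in> \<int>"
    proof (cases "Suc k < p - 1")
      case False
      hence "Suc k = p - 1" using pCons.prems by simp
      thus ?thesis using P_last by simp
    qed (rule pCons.IH)
    have 2: "\<epsilon> (?y * Q k) \<in> \<int>" using pCons by (cases k) auto
    have "\<pi> (map_poly rat_of_int (pCons c F)) * z * P k
        = of_int c * (z * P k) + of_int (tb_sign p q (Suc k)) * (?y * P (Suc k) - ?y * Q k)"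
    proof -
      have "\<pi> (map_poly rat_of_int (pCons c F)) * z * P k = of_int c * (z * P k) + ?y * (x * P k)"
        by (simp add: hom_int_poly algebra_simps)
      thus ?thesis unfolding x_P s_def by (simp add: algebra_simps)
    qed
    thus ?case using 1 2 z[OF pCons.prems] by (simp add: \<epsilon>_add \<epsilon>_of_int \<epsilon>_diff)
  qed simp
  thus "y \<in> R \<Longrightarrow> (\<And>k. k < p - 1 \<Longrightarrow> \<epsilon> (z * P k) \<in> \<int>) \<Longrightarrow> k < p - 1 \<Longrightarrow> \<epsilon> (y * z * P k) \<in> \<int>"
    by (auto simp: R_def)
qed

lemma common_denominator: "\<exists>d>0. \<forall>k<n::nat. of_int d * (f k :: rat) \<in> \<int>"
proof (induction n)
  case (Suc n)
  then obtain d where d: "d > 0" "\<forall>k<n. of_int d * f k \<in> \<int>" by auto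
  obtain a b where ab: "quotient_of (f n) = (a, b)" by fastforce
  have b: "b > 0" "f n = of_int a / of_int b" using ab quotient_of_denom_pos quotient_of_div by auto
  have "of_int (d * b) * f k \<in> \<int>" if "k < Suc n" for k
  proof (cases "k = n")
    case True
    have "of_int (d * b) * f k = of_int (d * a)" using b True by simp
    thus ?thesis by (metis Ints_of_int)
  next
    case False
    hence "of_int d * f k \<in> \<int>" using d that by auto
    from Ints_mult[OF Ints_of_int[of b] this] show ?thesis by (simp add: ac_simps)
  qed
  moreover have "d * b > 0" using d b by simp
  ultimately show ?case by blast
qed (auto intro: exI[of _ 1])

text \<open>A solution of \<open>y = 2 r y\<close> is divisible by all powers of 2, while the denominators of its
  coordinates are bounded.\<close>

lemma odd_nonzerodivisor:
  assumes r: "r \<in> R" and y: "y = 2 * r * y"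
  shows "y = 0"
proof -
  obtain d where d: "d > 0" "\<And>k. k < p - 1 \<Longrightarrow> of_int d * \<epsilon> (y * P k) \<in> \<int>"
    using common_denominator[of "p - 1" "\<lambda>k. \<epsilon> (y * P k)"] by auto
  \<comment> \<open>The multiple of y whose pairings with the basis are integers.\<close>
  let ?z = "of_int d * y"
  have z: "\<epsilon> (?z * P k) \<in> \<int>" if "k < p - 1" for k
    using d(2)[OF that] by (simp add: \<epsilon>_of_int mult.assoc)
  have pow: "y = of_int (2 ^ n) * (r ^ n * y)" for n
  proof (induction n)
    case (Suc n)
    have "r ^ n * y = r ^ n * (2 * r * y)" by (simp only: y[symmetric])
    hence "y = of_int (2 ^ n) * (r ^ n * (2 * r * y))" by (rule subst) (rule Suc)
    thus ?case by (simp only: of_int_mult of_int_numeral power_Suc ac_simps)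
  qed simp
  have rn: "r ^ n \<in> R" for n by (induction n) (use r R_closed(1)[of 1] in auto)
  have "\<epsilon> (y * P k) = 0" if k: "k < p - 1" for k
  proof (rule ccontr)
    assume nz: "\<epsilon> (y * P k) \<noteq> 0"
    obtain c where c: "\<epsilon> (?z * P k) = of_int c" using z[OF k] by (auto elim: Ints_cases)
    have "c \<noteq> 0" using nz c d(1) by (auto simp: \<epsilon>_of_int mult.assoc)
    have "2 ^ n dvd \<bar>c\<bar>" for n
    proof -
      obtain e where e: "\<epsilon> (r ^ n * ?z * P k) = of_int e"
        using \<epsilon>_R_integral[OF rn z k] by (auto elim: Ints_cases)
      have "?z * P k = of_int (2 ^ n) * (r ^ n * ?z * P k)"
        using arg_cong[OF pow[of n], of "\<lambda>a. of_int d * a * P k"] by (simp only: ac_simps)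
      hence "rat_of_int c = of_int (2 ^ n) * of_int e"
        unfolding c[symmetric] e[symmetric] \<epsilon>_of_int[symmetric] by (rule arg_cong)
      hence "c = 2 ^ n * e" by (simp only: of_int_mult[symmetric] of_int_eq_iff)
      thus ?thesis by simp
    qed
    \<comment> \<open>The exponent |c| already contradicts divisibility of a nonzero c.\<close>
    hence "2 ^ nat \<bar>c\<bar> \<le> \<bar>c\<bar>" using \<open>c \<noteq> 0\<close> by (intro zdvd_imp_le) auto
    moreover have "int (nat \<bar>c\<bar>) < 2 ^ nat \<bar>c\<bar>" using of_nat_less_two_power[of "nat \<bar>c\<bar>", where 'a = int] by simp
    ultimately show False by simp
  qed
  thus ?thesis using expansion[of y] by simp
qed

end

section \<open>Fox calculus in a representation of the free group\<close>

lemma eval_chain_Nil [simp]: "eval_chain d \<rho> [] = 0\<^sub>m d d"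
  and eval_chain_Cons [simp]: "eval_chain d \<rho> ((c, w) # zs) = of_int c \<cdot>\<^sub>m \<rho> w + eval_chain d \<rho> zs"
  by (simp_all add: eval_chain_def)

lemma inv_word_Nil [simp]: "inv_word [] = []"
  and inv_word_Cons: "inv_word ((g, t) # w) = inv_word w @ [(g, \<not> t)]"
  by (simp_all add: inv_word_def)

text \<open>The semidirect product of the invertible matrices with the additive group of d by d
  matrices. The translation parts multiply by the Fox product rule. The second entry stores the
  inverse of the first, which makes invertibility an equation.\<close>

definition affine_group :: "nat \<Rightarrow> ('a::comm_ring_1 mat \<times> 'a mat \<times> 'a mat) monoid" where
  "affine_group d = \<lparr>carrier = {(A, B, t). A \<in> carrier_mat d d \<and> B \<in> carrier_mat d d \<and>
       t \<in> carrier_mat d d \<and> A * B = 1\<^sub>m d \<and> B * A = 1\<^sub>m d},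
     monoid.mult = (\<lambda>(A, B, t) (A', B', t'). (A * A', B' * B, t + A * t')),
     one = (1\<^sub>m d, 1\<^sub>m d, 0\<^sub>m d d)\<rparr>"

lemma mult_carrier_sq [simp]:
  "A \<in> carrier_mat d d \<Longrightarrow> B \<in> carrier_mat d d \<Longrightarrow> A * B \<in> carrier_mat d d"
  by (rule mult_carrier_mat)

lemma smult_one_mat [simp]: "1 \<cdot>\<^sub>m A = (A :: 'a::comm_ring_1 mat)" "(-1) \<cdot>\<^sub>m A = - A"
  by (auto intro!: eq_matI)

lemma mult_cancel_middle:
  assumes "A \<in> carrier_mat d d" "A' \<in> carrier_mat d d" "B' \<in> carrier_mat d d" "B \<in> carrier_mat d d"
    and "A' * B' = 1\<^sub>m d" "A * B = 1\<^sub>m (d :: nat)"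
  shows "(A * A') * (B' * B) = (1\<^sub>m d :: 'a::comm_ring_1 mat)"
proof -
  have "(A * A') * (B' * B) = A * (A' * B') * B"
    using assms(1-4) by (simp add: assoc_mult_mat[of _ d d _ d _ d])
  thus ?thesis using assms by simp
qed

lemma group_affine_group: "group (affine_group d :: ('a::comm_ring_1 mat \<times> 'a mat \<times> 'a mat) monoid)"
proof (rule groupI)
  fix X Y Z :: "'a mat \<times> 'a mat \<times> 'a mat"
  assume X: "X \<in> carrier (affine_group d)"
  obtain A B t where X': "X = (A, B, t)" by (cases X) auto
  show "\<one>\<^bsub>affine_group d\<^esub> \<otimes>\<^bsub>affine_group d\<^esub> X = X"
    using X X' by (auto simp: affine_group_def)
  have "- (B * t) + B * t = 0\<^sub>m d d" using X X' by (auto simp: affine_group_def)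
  hence "(B, A, - (B * t)) \<otimes>\<^bsub>affine_group d\<^esub> X = \<one>\<^bsub>affine_group d\<^esub>"
    "(B, A, - (B * t)) \<in> carrier (affine_group d)"
    using X X' by (auto simp: affine_group_def)
  thus "\<exists>y\<in>carrier (affine_group d). y \<otimes>\<^bsub>affine_group d\<^esub> X = \<one>\<^bsub>affine_group d\<^esub>" by blast
  assume Y: "Y \<in> carrier (affine_group d)"
  thus "X \<otimes>\<^bsub>affine_group d\<^esub> Y \<in> carrier (affine_group d)"
    using X by (auto simp: affine_group_def mult_cancel_middle)
  assume Z: "Z \<in> carrier (affine_group d)"
  show "X \<otimes>\<^bsub>affine_group d\<^esub> Y \<otimes>\<^bsub>affine_group d\<^esub> Z = X \<otimes>\<^bsub>affine_group d\<^esub> (Y \<otimes>\<^bsub>affine_group d\<^esub> Z)"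
    using X Y Z by (auto simp: affine_group_def assoc_mult_mat[of _ d d _ d _ d]
        mult_add_distrib_mat[of _ d d _ d] assoc_add_mat[of _ d d])
qed (auto simp: affine_group_def)

text \<open>A matrix representation of the free group, given on unreduced words. The relator enters
  only as a hypothesis of individual lemmas.\<close>

locale word_rep =
  fixes d :: nat and \<rho> :: "gword \<Rightarrow> 'a::comm_ring_1 mat"
  assumes rep_carrier [simp, intro]: "\<rho> w \<in> carrier_mat d d"
    and rep_Nil [simp]: "\<rho> [] = 1\<^sub>m d"
    and rep_append: "\<rho> (v @ w) = \<rho> v * \<rho> w"
    and rep_letter: "\<rho> [(g, t)] * \<rho> [(g, \<not> t)] = 1\<^sub>m d"
begin

definition D :: "gen \<Rightarrow> gword \<Rightarrow> 'a mat" where "D g w = eval_chain d \<rho> (fox g w)"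

lemma dims [simp]: "dim_row (\<rho> w) = d" "dim_col (\<rho> w) = d"
  using rep_carrier[of w] by (blast dest: carrier_matD)+

lemma rep_Cons: "\<rho> (a # w) = \<rho> [a] * \<rho> w"
  using rep_append[of "[a]" w] by simp

lemma eval_chain_carrier [simp, intro]: "eval_chain d \<rho> zs \<in> carrier_mat d d"
  by (induction zs) auto

lemma eval_chain_append: "eval_chain d \<rho> (zs @ zs') = eval_chain d \<rho> zs + eval_chain d \<rho> zs'"
  by (induction zs) (auto simp: assoc_add_mat[of _ d d])

lemma eval_chain_shift:
  "eval_chain d \<rho> (map (\<lambda>(c, z). (c, a # z)) zs) = \<rho> [a] * eval_chain d \<rho> zs"
  by (induction zs) (auto simp: mult_add_distrib_mat[of _ d d _ d] mult_smult_distrib[of _ d d _ d] rep_Cons[of a "snd _"] simp flip: rep_Cons)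

lemma D_carrier [simp, intro]: "D g w \<in> carrier_mat d d"
  by (simp add: D_def)

lemma D_dims [simp]: "dim_row (D g w) = d" "dim_col (D g w) = d"
  using D_carrier[of g w] by (blast dest: carrier_matD)+

lemma D_Nil [simp]: "D g [] = 0\<^sub>m d d"
  by (simp add: D_def)

lemma D_letter: "D g [(h, t)] = (if h = g then if t then 1\<^sub>m d else - \<rho> [(h, False)] else 0\<^sub>m d d)"
  by (auto simp: D_def intro!: eq_matI)

lemma D_Cons: "D g (a # w) = D g [a] + \<rho> [a] * D g w"
proof -
  obtain h t where a: "a = (h, t)" by fastforce
  show ?thesis unfolding D_letter a unfolding D_def
    by (auto simp: eval_chain_append eval_chain_shift intro!: eq_matI simp del: index_mult_mat(1))
qed

lemma D_append: "D g (v @ w) = D g v + \<rho> v * D g w"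
proof (induction v)
  case (Cons a v)
  show ?case
    using Cons D_Cons[of g a "v @ w"] D_Cons[of g a v] rep_Cons[of a v]
    by (simp add: mult_add_distrib_mat[of _ d d _ d] assoc_mult_mat[of _ d d _ d _ d] assoc_add_mat[of _ d d])
qed (simp add: left_mult_one_mat[of _ d d] left_add_zero_mat[of _ d d])

lemma inv_left: "\<rho> (inv_word w) * \<rho> w = 1\<^sub>m d" and inv_right: "\<rho> w * \<rho> (inv_word w) = 1\<^sub>m d"
proof -
  show "\<rho> (inv_word w) * \<rho> w = 1\<^sub>m d"
  proof (induction w)
    case (Cons a w)
    obtain h t where a: "a = (h, t)" by fastforce
    show ?case unfolding a inv_word_Cons rep_append rep_Cons[of "(h, t)" w]
      using Cons rep_letter[of h "\<not> t"] by (intro mult_cancel_middle) auto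
  qed auto
  show "\<rho> w * \<rho> (inv_word w) = 1\<^sub>m d"
  proof (induction w)
    case (Cons a w)
    obtain h t where a: "a = (h, t)" by fastforce
    show ?case unfolding a inv_word_Cons rep_append rep_Cons[of "(h, t)" w]
      using Cons rep_letter[of h "t"] by (intro mult_cancel_middle) auto
  qed auto
qed

lemma D_letter_inv: "D g [(h, \<not> t)] = - (\<rho> [(h, \<not> t)] * D g [(h, t)])"
  using rep_letter[of h "\<not> t"] by (auto simp: D_letter)

text \<open>This is what the product rule forces on the derivative of w^-1 w.\<close>

lemma D_inv: "D g (inv_word w) = - (\<rho> (inv_word w) * D g w)"
proof (induction w)
  case (Cons a w)
  obtain h t where a: "a = (h, t)" by fastforce
  have 1: "D g (inv_word (a # w)) = - (\<rho> (inv_word w) * D g w) + \<rho> (inv_word w) * (- (\<rho> [(h, \<not> t)] * D g [a]))"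
    unfolding a inv_word_Cons D_append Cons D_letter_inv by simp
  have "\<rho> (inv_word (a # w)) * D g (a # w) =
     \<rho> (inv_word w) * (\<rho> [(h, \<not> t)] * D g [a]) + \<rho> (inv_word w) * ((\<rho> [(h, \<not> t)] * \<rho> [a]) * D g w)"
    unfolding D_Cons[of g a w] unfolding a inv_word_Cons rep_append
    by (simp add: mult_add_distrib_mat[of _ d d _ d] assoc_mult_mat[of _ d d _ d _ d])
  also have "\<rho> [(h, \<not> t)] * \<rho> [a] = 1\<^sub>m d" using rep_letter[of h "\<not> t"] a by simp
  finally have 2: "\<rho> (inv_word (a # w)) * D g (a # w) =
     \<rho> (inv_word w) * (\<rho> [(h, \<not> t)] * D g [a]) + \<rho> (inv_word w) * D g w" 
    by (simp add: left_mult_one_mat[of _ d d])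
  show ?case unfolding 1 2 by (auto intro!: eq_matI simp del: index_mult_mat(1))
qed auto

text \<open>The fundamental formula of Fox calculus: both sides obey the same product rule, so
  letters suffice. Applied to the relator it says D^1 D^0 = 0.\<close>

lemma D_fundamental:
  "D gu w * (\<rho> [(gu, True)] - 1\<^sub>m d) + D gv w * (\<rho> [(gv, True)] - 1\<^sub>m d) = \<rho> w - 1\<^sub>m d"
proof (induction w)
  case (Cons a w)
  let ?U = "\<rho> [(gu, True)] - 1\<^sub>m d" and ?V = "\<rho> [(gv, True)] - 1\<^sub>m d"
  obtain h t where a: "a = (h, t)" by fastforce
  have 1: "D gu [a] * ?U + D gv [a] * ?V = \<rho> [a] - 1\<^sub>m d"
    using rep_letter[of h False] unfolding a D_letter
    by (cases h; cases t) (auto simp: mult_minus_distrib_mat[of _ d d _ d] intro!: eq_matI simp del: index_mult_mat(1))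
  have "D gu (a # w) * ?U + D gv (a # w) * ?V =
      (D gu [a] * ?U + D gv [a] * ?V) + \<rho> [a] * (D gu w * ?U + D gv w * ?V)"
    unfolding D_Cons[of _ a w]
    by (auto simp: mult_add_distrib_mat[of _ d d _ d] add_mult_distrib_mat[of _ d d _ _ d] assoc_mult_mat[of _ d d _ d _ d]
         minus_carrier_mat intro!: eq_matI simp del: index_mult_mat(1))
  also have "\<dots> = \<rho> (a # w) - 1\<^sub>m d"
    unfolding 1 Cons rep_Cons[of a w]
    by (auto simp: mult_minus_distrib_mat[of _ d d _ d] intro!: eq_matI simp del: index_mult_mat(1))
  finally show ?case .
qed auto

section \<open>Fox derivatives as translation parts of an affine representation\<close>

definition affine :: "gen \<Rightarrow> gen \<Rightarrow> 'a mat \<times> 'a mat \<times> 'a mat" where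
  "affine g h = (\<rho> [(h, True)], \<rho> [(h, False)], if h = g then 1\<^sub>m d else 0\<^sub>m d d)"

lemma affine_carrier: "affine g h \<in> carrier (affine_group d)"
  using rep_letter[of h True] rep_letter[of h False] by (auto simp: affine_def affine_group_def)

lemma affine_inv:
  "inv\<^bsub>affine_group d\<^esub> (affine g h) = (\<rho> [(h, False)], \<rho> [(h, True)], D g [(h, False)])"
proof -
  interpret group "affine_group d :: ('a mat \<times> 'a mat \<times> 'a mat) monoid" by (rule group_affine_group)
  have "- \<rho> [(h, False)] + \<rho> [(h, False)] = 0\<^sub>m d d" by auto
  hence "(\<rho> [(h, False)], \<rho> [(h, True)], D g [(h, False)]) \<otimes>\<^bsub>affine_group d\<^esub> affine g h = \<one>\<^bsub>affine_group d\<^esub>"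
    using rep_letter[of h True] rep_letter[of h False] by (auto simp: affine_def affine_group_def D_letter)
  thus ?thesis
    using affine_carrier rep_letter[of h True] rep_letter[of h False]
    by (intro inv_equality) (auto simp: affine_group_def)
qed

text \<open>The reason for introducing the affine group: a word identity valid in every group can be
  differentiated by evaluating it here, without normal forms in the free group.\<close>

lemma word_eval_affine:
  "word_eval (affine_group d) (affine g) w = (\<rho> w, \<rho> (inv_word w), D g w)"
proof (induction w)
  case Nil
  show ?case by (simp add: word_eval_def affine_group_def)
next
  case (Cons a w)
  obtain h t where a: "a = (h, t)" by fastforce
  have "word_eval (affine_group d) (affine g) (a # w) =
     (if t then affine g h else inv\<^bsub>affine_group d\<^esub> (affine g h)) \<otimes>\<^bsub>affine_group d\<^esub>
       word_eval (affine_group d) (affine g) w"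
    by (simp add: word_eval_def a)
  also have "\<dots> = (\<rho> [a], \<rho> [(h, \<not> t)], D g [a]) \<otimes>\<^bsub>affine_group d\<^esub> (\<rho> w, \<rho> (inv_word w), D g w)"
    unfolding affine_inv Cons by (simp add: affine_def a D_letter)
  also have "\<dots> = (\<rho> (a # w), \<rho> (inv_word (a # w)), D g (a # w))"
    unfolding a inv_word_Cons rep_append rep_Cons[of "(h, t)" w] D_Cons[of g "(h, t)" w]
    by (simp add: affine_group_def)
  finally show ?case .
qed

text \<open>The contributions of z and of its inverse cancel because r acts trivially.\<close>

lemma D_conjugate:
  assumes "\<rho> r = 1\<^sub>m d"
  shows "D g (z @ r @ inv_word z) = \<rho> z * D g r" and "\<rho> (z @ r @ inv_word z) = 1\<^sub>m d"
proof -
  have e: "D g z + \<rho> z * (D g r + 1\<^sub>m d * - (\<rho> (inv_word z) * D g z)) =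
      D g z + (\<rho> z * D g r + - ((\<rho> z * \<rho> (inv_word z)) * D g z))"
    by (simp add: mult_add_distrib_mat[of _ d d _ d] assoc_mult_mat[of _ d d _ d _ d])
  show "D g (z @ r @ inv_word z) = \<rho> z * D g r"
    unfolding D_append rep_append assms D_inv e inv_right
    by (auto intro!: eq_matI simp del: index_mult_mat(1))
  show "\<rho> (z @ r @ inv_word z) = 1\<^sub>m d"
    by (simp add: rep_append assms inv_right)
qed

text \<open>Evaluating the identity \<open>[u, \<lambda>] = \<Prod> g\<^sub>i r\<^sup>c\<^sup>i g\<^sub>i\<^sup>-\<^sup>1\<close> in the affine group gives, in the
  translation part, its Fox derivatives.\<close>

lemma boundary_chain_D:
  assumes pq: "coprime p q" "odd p" "odd q" and r: "\<rho> (tb_r p q) = 1\<^sub>m d"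
  shows "eval_chain d \<rho> (boundary_chain p q) * D g (tb_r p q) =
    (1\<^sub>m d - \<rho> (tb_longitude p q)) * D g [(gu, True)] + (\<rho> [(gu, True)] - 1\<^sub>m d) * D g (tb_longitude p q)"
proof -
  \<comment> \<open>Only the shape of the chain matters here. This \<open>h\<close> is already the
    inverse of the prefix of the relator.\<close>
  obtain h w' where bc: "boundary_chain p q = [(1, h), (-1, w')]"
    by (simp add: boundary_chain_def Let_def)
  let ?r = "tb_r p q" and ?l = "tb_longitude p q" and ?U = "\<rho> [(gu, True)]"
  let ?L = "[(gu, True)] @ ?l @ [(gu, False)] @ inv_word ?l"
  let ?R = "(h @ ?r @ inv_word h) @ (w' @ inv_word ?r @ inv_word w')"
  have "word_eval (affine_group d) (affine g) ?L = word_eval (affine_group d) (affine g) ?R"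
    using boundary_chain[OF group_affine_group _ pq, of "affine g" d] affine_carrier
    by (auto simp: bc conjugates_def image_subset_iff)
  hence eq: "\<rho> ?L = \<rho> ?R" "D g ?L = D g ?R" unfolding word_eval_affine by auto
  have r': "\<rho> (inv_word ?r) = 1\<^sub>m d" using inv_left[of ?r] r by simp
  have R1: "\<rho> ?R = 1\<^sub>m d" unfolding rep_append[of "h @ ?r @ inv_word h"] D_conjugate(2)[OF r] D_conjugate(2)[OF r'] by simp
  have "D g ?R = \<rho> h * D g ?r + \<rho> w' * - D g ?r"
    unfolding D_append[of g "h @ ?r @ inv_word h"] D_conjugate[OF r] D_conjugate[OF r'] D_inv r'
    by simp
  also have "\<dots> = eval_chain d \<rho> (boundary_chain p q) * D g ?r"
    unfolding bc by (auto simp: add_mult_distrib_mat[of _ d d _ _ d] intro!: eq_matI simp del: index_mult_mat(1))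
  finally have R2: "D g ?R = eval_chain d \<rho> (boundary_chain p q) * D g ?r" .
  define Y where "Y = \<rho> [(gu, False)]"
  have Y: "Y * ?U = 1\<^sub>m d" "?U * Y = 1\<^sub>m d" "Y \<in> carrier_mat d d"
    using rep_letter[of gu False] rep_letter[of gu True] by (auto simp: Y_def)
  have c1: "?U * (\<rho> ?l * (Y * \<rho> (inv_word ?l))) = 1\<^sub>m d"
    using eq(1) R1 by (simp add: rep_append Y_def rep_Cons[of "(gu, True)" "_ @ _"] rep_Cons[of "(gu, False)" "inv_word _"])
  \<comment> \<open>In the representation u commutes with the longitude, by
    \<open>c1\<close>.\<close>
  have c2: "?U * (\<rho> ?l * Y) = \<rho> ?l"
  proof -
    have "?U * (\<rho> ?l * Y) = ?U * (\<rho> ?l * Y) * (\<rho> (inv_word ?l) * \<rho> ?l)"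
      using Y(3) by (simp add: inv_left right_mult_one_mat[of _ d d])
    also have "\<dots> = (?U * (\<rho> ?l * (Y * \<rho> (inv_word ?l)))) * \<rho> ?l"
      using Y(3) by (simp add: assoc_mult_mat[of _ d d _ d _ d])
    finally show ?thesis by (simp add: c1 left_mult_one_mat[of _ d d])
  qed
  have "D g ?L = D g [(gu, True)] + ?U * (D g ?l + \<rho> ?l * (- (Y * D g [(gu, True)]) +
      Y * - (\<rho> (inv_word ?l) * D g ?l)))"
    unfolding D_append rep_append D_inv using D_letter_inv[of g gu True] by (simp add: Y_def)
  also have "\<dots> = D g [(gu, True)] + (?U * D g ?l + (- (?U * (\<rho> ?l * Y) * D g [(gu, True)]) +
      - (?U * (\<rho> ?l * (Y * \<rho> (inv_word ?l))) * D g ?l)))"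
    using Y(3) by (simp add: mult_add_distrib_mat[of _ d d _ d] assoc_mult_mat[of _ d d _ d _ d])
  also have "\<dots> = (1\<^sub>m d - \<rho> ?l) * D g [(gu, True)] + (?U - 1\<^sub>m d) * D g ?l"
    unfolding c1 c2 by (auto simp: minus_mult_distrib_mat[of _ d d _ _ d] intro!: eq_matI simp del: index_mult_mat(1))
  finally show ?thesis using eq(2) R2 by simp
qed

end

section \<open>The parabolic representation and its symmetric square\<close>

text \<open>Matrices with named entries: together with the simplification rules below, matrix
  identities of size 2 and 3 become ring identities in the entries.\<close>

definition m2 :: "'a \<Rightarrow> 'a \<Rightarrow> 'a \<Rightarrow> 'a \<Rightarrow> 'a::comm_ring_1 mat" where
  "m2 a b c d = mat_of_rows_list 2 [[a, b], [c, d]]"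

definition m3 :: "'a \<Rightarrow> 'a \<Rightarrow> 'a \<Rightarrow> 'a \<Rightarrow> 'a \<Rightarrow> 'a \<Rightarrow> 'a \<Rightarrow> 'a \<Rightarrow> 'a \<Rightarrow> 'a::comm_ring_1 mat" where
  "m3 a b c d e f g h i = mat_of_rows_list 3 [[a, b, c], [d, e, f], [g, h, i]]"

lemma less_3_cases: "n < 3 \<Longrightarrow> n = 0 \<or> n = Suc 0 \<or> n = (2 :: nat)"
  by auto

lemma m2_carrier [simp]: "m2 a b c d \<in> carrier_mat 2 2"
  and m2_dims [simp]: "dim_row (m2 a b c d) = 2" "dim_col (m2 a b c d) = 2"
  and m2_index [simp]: "m2 a b c d $$ (0, 0) = a" "m2 a b c d $$ (0, Suc 0) = b"
    "m2 a b c d $$ (Suc 0, 0) = c" "m2 a b c d $$ (Suc 0, Suc 0) = d"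
  by (auto simp: m2_def mat_of_rows_list_def)

lemma m3_carrier [simp]: "m3 a b c d e f g h i \<in> carrier_mat 3 3"
  and m3_dims [simp]: "dim_row (m3 a b c d e f g h i) = 3" "dim_col (m3 a b c d e f g h i) = 3"
  and m3_index [simp]:
    "m3 a b c d e f g h i $$ (0, 0) = a" "m3 a b c d e f g h i $$ (0, Suc 0) = b"
    "m3 a b c d e f g h i $$ (0, 2) = c" "m3 a b c d e f g h i $$ (Suc 0, 0) = d"
    "m3 a b c d e f g h i $$ (Suc 0, Suc 0) = e" "m3 a b c d e f g h i $$ (Suc 0, 2) = f"
    "m3 a b c d e f g h i $$ (2, 0) = g" "m3 a b c d e f g h i $$ (2, Suc 0) = h"
    "m3 a b c d e f g h i $$ (2, 2) = i"
  by (auto simp: m3_def mat_of_rows_list_def)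

lemma eq_m2_iff: "A \<in> carrier_mat 2 2 \<Longrightarrow> A = m2 a b c d \<longleftrightarrow>
    A $$ (0, 0) = a \<and> A $$ (0, Suc 0) = b \<and> A $$ (Suc 0, 0) = c \<and> A $$ (Suc 0, Suc 0) = d"
  by (auto intro!: eq_matI dest!: less_2_cases)

lemma eq_m3_iff: "A \<in> carrier_mat 3 3 \<Longrightarrow> A = m3 a b c d e f g h i \<longleftrightarrow>
    A $$ (0, 0) = a \<and> A $$ (0, Suc 0) = b \<and> A $$ (0, 2) = c \<and>
    A $$ (Suc 0, 0) = d \<and> A $$ (Suc 0, Suc 0) = e \<and> A $$ (Suc 0, 2) = f \<and>
    A $$ (2, 0) = g \<and> A $$ (2, Suc 0) = h \<and> A $$ (2, 2) = i"
  by (auto intro!: eq_matI dest!: less_3_cases)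

lemma m2_cases:
  assumes "A \<in> carrier_mat 2 2"
  obtains a b c d where "A = m2 a b c d"
  using eq_m2_iff[OF assms] by blast

lemma m3_cases:
  assumes "A \<in> carrier_mat 3 3"
  obtains a b c d e f g h i where "A = m3 a b c d e f g h i"
  using eq_m3_iff[OF assms] by blast

lemma m2_inject [simp]: "m2 a b c d = m2 a' b' c' d' \<longleftrightarrow> a = a' \<and> b = b' \<and> c = c' \<and> d = d'"
  by (simp add: eq_m2_iff)

lemma m3_inject [simp]: "m3 a b c d e f g h i = m3 a' b' c' d' e' f' g' h' i' \<longleftrightarrow>
    a = a' \<and> b = b' \<and> c = c' \<and> d = d' \<and> e = e' \<and> f = f' \<and> g = g' \<and> h = h' \<and> i = i'"
  by (simp add: eq_m3_iff)

lemma sum_2: "(\<Sum>i = 0..<2::nat. f i) = f 0 + f (Suc 0)"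
  and sum_3: "(\<Sum>i = 0..<3::nat. f i) = f 0 + f (Suc 0) + f 2"
  for f :: "nat \<Rightarrow> 'a::comm_ring_1"
  by (simp_all add: numeral_2_eq_2 numeral_3_eq_3)

lemma m2_mult [simp]:
  "m2 a b c d * m2 e f g h = m2 (a * e + b * g) (a * f + b * h) (c * e + d * g) (c * f + d * h)"
  by (subst eq_m2_iff) (auto simp: scalar_prod_def sum_2)

lemma m3_mult [simp]:
  "m3 a b c d e f g h i * m3 a' b' c' d' e' f' g' h' i' =
   m3 (a * a' + b * d' + c * g') (a * b' + b * e' + c * h') (a * c' + b * f' + c * i')
      (d * a' + e * d' + f * g') (d * b' + e * e' + f * h') (d * c' + e * f' + f * i')
      (g * a' + h * d' + i * g') (g * b' + h * e' + i * h') (g * c' + h * f' + i * i')"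
  by (subst eq_m3_iff) (auto simp: scalar_prod_def sum_3)

lemma m2_arith [simp]:
  "m2 a b c d + m2 a' b' c' d' = m2 (a + a') (b + b') (c + c') (d + d')"
  "m2 a b c d - m2 a' b' c' d' = m2 (a - a') (b - b') (c - c') (d - d')"
  "- m2 a b c d = m2 (- a) (- b) (- c) (- d)"
  by (subst eq_m2_iff; auto)+

lemma m3_arith [simp]:
  "m3 a b c d e f g h i + m3 a' b' c' d' e' f' g' h' i' =
     m3 (a + a') (b + b') (c + c') (d + d') (e + e') (f + f') (g + g') (h + h') (i + i')"
  "m3 a b c d e f g h i - m3 a' b' c' d' e' f' g' h' i' =
     m3 (a - a') (b - b') (c - c') (d - d') (e - e') (f - f') (g - g') (h - h') (i - i')"
  "- m3 a b c d e f g h i = m3 (- a) (- b) (- c) (- d) (- e) (- f) (- g) (- h) (- i)"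
  by (subst eq_m3_iff; auto)+

lemma one_m2: "1\<^sub>m 2 = m2 1 0 0 1" and zero_m2: "0\<^sub>m 2 2 = m2 0 0 0 0"
  by (subst eq_m2_iff; auto)+

lemma one_m3: "1\<^sub>m 3 = m3 1 0 0 0 1 0 0 0 1" and zero_m3: "0\<^sub>m 3 3 = m3 0 0 0 0 0 0 0 0 0"
  by (subst eq_m3_iff; auto)+

lemma sl2_inv_m2 [simp]: "sl2_inv (m2 a b c d) = m2 d (- b) (- c) a"
  by (simp add: sl2_inv_def m2_def mat_of_rows_list_def)

lemma rho_gen_m2 [simp]: "rho_gen x gu = m2 1 x 0 1" "rho_gen x gv = m2 1 0 x 1"
  by (simp_all add: rho_gen_def m2_def)

text \<open>For determinant 1 this is conjugation by M in the basis \<open>sl2_basis\<close>. It is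
  polynomial in the entries, free of the scalar 1/2, and multiplicative for all 2 by 2
  matrices.\<close>

definition sym2 :: "'a::comm_ring_1 mat \<Rightarrow> 'a mat" where
  "sym2 M = (let a = M $$ (0, 0); b = M $$ (0, 1); c = M $$ (1, 0); d = M $$ (1, 1)
     in m3 (a * a) (- (a * b)) (- (b * b))
           (- 2 * a * c) (a * d + b * c) (2 * b * d)
           (- (c * c)) (c * d) (d * d))"

lemma sym2_m2: "sym2 (m2 a b c d) = m3 (a * a) (- (a * b)) (- (b * b))
    (- 2 * a * c) (a * d + b * c) (2 * b * d) (- (c * c)) (c * d) (d * d)"
  by (simp add: sym2_def)

section \<open>The two representations on words and their symmetries\<close>

lemma rho1_Nil [simp]: "rho1 x [] = 1\<^sub>m 2"
  and rho1_Cons: "rho1 x ((g, t) # w) = (if t then rho_gen x g else sl2_inv (rho_gen x g)) * rho1 x w"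
  by (simp_all add: rho1_def)

lemma rho1_carrier [simp]: "rho1 x w \<in> carrier_mat 2 2"
proof (induction w)
  case (Cons a w)
  then show ?case by (cases a; cases "fst a") (auto simp: rho1_Cons)
qed simp

lemma rho1_append: "rho1 x (v @ w) = rho1 x v * rho1 x w"
proof (induction v)
  case (Cons a v)
  have "(case a of (g, t) \<Rightarrow> if t then rho_gen x g else sl2_inv (rho_gen x g)) \<in> carrier_mat 2 2"
    by (cases a; cases "fst a") auto
  then show ?case using Cons by (cases a) (simp add: rho1_Cons assoc_mult_mat[of _ 2 2 _ 2 _ 2])
qed (simp add: left_mult_one_mat[of _ 2 2])

interpretation rho1: word_rep 2 "rho1 x" for x :: "'a::comm_ring_1"
proof
  fix g t show "rho1 x [(g, t)] * rho1 x [(g, \<not> t)] = 1\<^sub>m 2"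
    by (cases g; cases t) (simp_all add: rho1_Cons one_m2)
qed (auto simp: rho1_append)

lemma det_rho1: "rho1 x w = m2 a b c d \<Longrightarrow> a * d - b * c = 1"
proof (induction w arbitrary: a b c d)
  case (Cons y w)
  obtain e f g h where w: "rho1 x w = m2 e f g h" using m2_cases[OF rho1_carrier] .
  show ?case using Cons.IH[OF w] Cons.prems w
    by (cases y; cases "fst y"; cases "snd y") (auto simp: rho1_Cons algebra_simps)
qed (simp add: one_m2)

lemma rho1_inv_word: "rho1 x (inv_word w) = sl2_inv (rho1 x w)"
proof (induction w)
  case (Cons y w)
  obtain e f g h where w: "rho1 x w = m2 e f g h" using m2_cases[OF rho1_carrier] .
  show ?case using Cons w
    by (cases y; cases "fst y"; cases "snd y")
       (auto simp: rho1_Cons inv_word_Cons rho1_append one_m2 algebra_simps)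
qed (simp add: one_m2)

text \<open>Transposition along the antidiagonal is an anti-automorphism that fixes the matrices of
  u and v.\<close>

lemma rho1_rev: "rho1 x w = m2 a b c d \<Longrightarrow> rho1 x (rev w) = m2 d b c a"
proof (induction w arbitrary: a b c d)
  case (Cons y w)
  obtain e f g h where w: "rho1 x w = m2 e f g h" using m2_cases[OF rho1_carrier] .
  show ?case using Cons.IH[OF w] Cons.prems w
    by (cases y; cases "fst y"; cases "snd y") (auto simp: rho1_Cons rho1_append one_m2 algebra_simps)
qed (simp add: one_m2)

definition exchange :: "gen \<times> bool \<Rightarrow> gen \<times> bool" where
  "exchange = (\<lambda>(g, t). (if g = gu then gv else gu, t))"

text \<open>Conjugation by the permutation matrix of size 2 exchanges the matrices of u and
  v.\<close>

lemma rho1_exchange: "rho1 x w = m2 a b c d \<Longrightarrow> rho1 x (map exchange w) = m2 d c b a"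
proof (induction w arbitrary: a b c d)
  case (Cons y w)
  obtain e f g h where w: "rho1 x w = m2 e f g h" using m2_cases[OF rho1_carrier] .
  show ?case using Cons.IH[OF w] Cons.prems w
    by (cases y; cases "fst y"; cases "snd y") (auto simp: rho1_Cons one_m2 exchange_def algebra_simps)
qed (simp add: one_m2)

lemma rho2_eq_sym2:
  assumes "2 * \<kappa> = (1 :: 'a::comm_ring_1)"
  shows "rho2 \<kappa> x w = sym2 (rho1 x w)"
proof -
  obtain a b c d where w: "rho1 x w = m2 a b c d" using m2_cases[OF rho1_carrier] .
  have k: "\<kappa> * (y * (z * 2)) = y * z" for y z
  proof -
    have "\<kappa> * (y * (z * 2)) = (2 * \<kappa>) * (y * z)" by (simp only: ac_simps)
    thus ?thesis by (simp add: assms)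
  qed
  have "rho2 \<kappa> x w = m3 (a * a) (- (a * b)) (- (b * b))
    (- 2 * a * c) (a * d + b * c) (2 * b * d) (- (c * c)) (c * d) (d * d)"
    unfolding rho2_def w
    by (subst eq_m3_iff, simp, simp add: sl2_basis_def sl2_coords_def del: index_mult_mat(1) flip: m2_def)
      (simp add: k algebra_simps)
  thus ?thesis by (simp add: w sym2_m2)
qed

lemma sym2_mult: "A \<in> carrier_mat 2 2 \<Longrightarrow> B \<in> carrier_mat 2 2 \<Longrightarrow> sym2 (A * B) = sym2 A * sym2 B"
  by (elim m2_cases) (simp add: sym2_m2 algebra_simps)

lemma word_rep_rho2:
  assumes "2 * \<kappa> = (1 :: 'a::comm_ring_1)"
  shows "word_rep 3 (rho2 \<kappa> x)"
proof
  have one: "sym2 (1\<^sub>m 2 :: 'a mat) = 1\<^sub>m 3" by (simp add: one_m2 one_m3 sym2_m2)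
  fix v w g t
  show "rho2 \<kappa> x w \<in> carrier_mat 3 3" by (simp add: rho2_def)
  show "rho2 \<kappa> x [] = 1\<^sub>m 3" by (simp add: rho2_eq_sym2[OF assms] one)
  show "rho2 \<kappa> x (v @ w) = rho2 \<kappa> x v * rho2 \<kappa> x w"
    by (simp add: rho2_eq_sym2[OF assms] rho1_append sym2_mult)
  show "rho2 \<kappa> x [(g, t)] * rho2 \<kappa> x [(g, \<not> t)] = 1\<^sub>m 3"
    by (simp add: rho2_eq_sym2[OF assms] rho1.rep_letter one flip: sym2_mult)
qed

section \<open>Words of the knot group\<close>

context word_rep
begin

text \<open>Reduces the derivative of the relator to that of w: in the derivative of w u w^-1 v^-1,
  the product w u w^-1 may be replaced by v.\<close>

lemma D_relator:
  assumes "\<rho> (tb_r p q) = 1\<^sub>m d"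
  shows "D g (tb_r p q) = (1\<^sub>m d - \<rho> [(gv, True)]) * D g (tb_w p q) +
    (\<rho> (tb_w p q) * D g [(gu, True)] + \<rho> [(gv, True)] * D g [(gv, False)])"
proof -
  let ?w = "tb_w p q"
  define W W' U V V' where defs: "W = \<rho> ?w" "W' = \<rho> (inv_word ?w)" "U = \<rho> [(gu, True)]"
    "V = \<rho> [(gv, True)]" "V' = \<rho> [(gv, False)]"
  have [simp]: "W \<in> carrier_mat d d" "W' \<in> carrier_mat d d" "U \<in> carrier_mat d d"
    "V \<in> carrier_mat d d" "V' \<in> carrier_mat d d"
    by (auto simp: defs)
  hence [simp]: "dim_col W = d" "dim_col U = d" "dim_row W' = d" "dim_row U = d"
    by (blast dest: carrier_matD)+
  have 1: "W * (U * (W' * V')) = 1\<^sub>m d"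
    using assms by (simp only: tb_r_def rep_append defs)
  have V: "V' * V = 1\<^sub>m d" using rep_letter[of gv False] by (simp add: defs)
  \<comment> \<open>w u w^-1 acts as v because the relator acts trivially.\<close>
  have 2: "W * (U * W') = V"
  proof -
    have "W * (U * W') = W * (U * (W' * (V' * V)))" by (simp add: V right_mult_one_mat[of _ d d])
    also have "\<dots> = (W * (U * (W' * V'))) * V" by (simp add: assoc_mult_mat[of _ d d _ d _ d])
    finally show ?thesis by (simp add: 1 left_mult_one_mat[of _ d d])
  qed
  have "D g (tb_r p q) = D g ?w + W * (D g [(gu, True)] + U * (- (W' * D g ?w) + W' * D g [(gv, False)]))"
    unfolding tb_r_def D_append D_inv defs ..
  also have "\<dots> = D g ?w + (W * D g [(gu, True)] + (- ((W * (U * W')) * D g ?w) + (W * (U * W')) * D g [(gv, False)]))"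
    by (simp add: mult_add_distrib_mat[of _ d d _ d] assoc_mult_mat[of _ d d _ d _ d])
  also have "\<dots> = (1\<^sub>m d - V) * D g ?w + (W * D g [(gu, True)] + V * D g [(gv, False)])"
    unfolding 2 by (auto simp: minus_mult_distrib_mat[of _ d d _ _ d] intro!: eq_matI simp del: index_mult_mat(1))
  finally show ?thesis by (simp only: defs)
qed

lemma D_relator_u:
  assumes "\<rho> (tb_r p q) = 1\<^sub>m d"
  shows "D gu (tb_r p q) = (1\<^sub>m d - \<rho> [(gv, True)]) * D gu (tb_w p q) + \<rho> (tb_w p q)"
  unfolding D_relator[OF assms] D_letter
  by (auto intro!: eq_matI simp: right_mult_one_mat[of _ d d] simp del: index_mult_mat(1))

lemma D_relator_v:
  assumes "\<rho> (tb_r p q) = 1\<^sub>m d"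
  shows "D gv (tb_r p q) = (1\<^sub>m d - \<rho> [(gv, True)]) * D gv (tb_w p q) - 1\<^sub>m d"
  unfolding D_relator[OF assms] D_letter using rep_letter[of gv True]
  by (auto intro!: eq_matI simp del: index_mult_mat(1))

lemma D_relator_fundamental:
  assumes "\<rho> (tb_r p q) = 1\<^sub>m d"
  shows "D gu (tb_r p q) * (\<rho> [(gu, True)] - 1\<^sub>m d) + D gv (tb_r p q) * (\<rho> [(gv, True)] - 1\<^sub>m d) = 0\<^sub>m d d"
  unfolding D_fundamental assms by (auto intro!: eq_matI)

end

section \<open>The matrices of w, of the relator, of the longitude and of the boundary chain\<close>

context two_bridge
begin

sublocale rho2: word_rep 3 "rho2 \<kappa> x"
  by (rule word_rep_rho2[OF two_\<kappa>])

lemma rho2_sym2: "rho2 \<kappa> x w = sym2 (rho1 x w)"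
  by (rule rho2_eq_sym2[OF two_\<kappa>])

definition prefix :: "nat \<Rightarrow> gword" where "prefix k = map (tb_letter p q) [1..<Suc k]"

lemma prefix_0 [simp]: "prefix 0 = []" and prefix_Suc: "prefix (Suc k) = prefix k @ [tb_letter p q (Suc k)]"
  by (simp_all add: prefix_def)

lemma tb_w_prefix: "tb_w p q = prefix (p - 1)"
  using p_ge_3 by (simp add: tb_w_def prefix_def)

lemma take_tb_w: "k < p \<Longrightarrow> take k (tb_w p q) = prefix k"
  by (auto simp: tb_w_def prefix_def take_map)

lemma sign_cases: "tb_sign p q k = 1 \<and> s k = 1 \<or> tb_sign p q k = -1 \<and> s k = - 1"
  by (auto simp: tb_sign_def s_def minus_one_power_iff)

lemma rho1_letter:
  "rho1 x [tb_letter p q k] = (if odd k then m2 1 (s k * x) 0 1 else m2 1 0 (s k * x) 1)"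
  using sign_cases[of k] by (auto simp: tb_letter_def rho1_Cons one_m2)

text \<open>Appending a letter adds a multiple of one column to the other, and on the first row this
  is the recursion of the \<open>P k\<close>.\<close>

lemma rho1_prefix: "\<exists>c d. rho1 x (prefix k) = (if even k then m2 (P k) (Q k) c d else m2 (Q k) (P k) c d)"
proof (induction k)
  case (Suc k)
  then obtain c d where "rho1 x (prefix k) = (if even k then m2 (P k) (Q k) c d else m2 (Q k) (P k) c d)" by blast
  thus ?case unfolding prefix_Suc rho1_append rho1_letter
    by (auto simp: P_Suc algebra_simps)
qed (simp add: one_m2)

text \<open>The image of the polynomial of index p - 2; it turns out to be a square root of
  -1.\<close>

definition \<iota> :: 'a where "\<iota> = Q (p - 1)"

text \<open>The signs are symmetric under k to p - k, and this map changes the parity of k as p is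
  odd, which exchanges u and v.\<close>

lemma rev_tb_w: "rev (tb_w p q) = map exchange (tb_w p q)"
proof (rule nth_equalityI)
  fix i assume "i < length (rev (tb_w p q))"
  hence i: "i < p - 1" by (simp add: tb_w_def)
  have "rev (tb_w p q) ! i = tb_letter p q (p - Suc i)"
    using i by (simp add: rev_nth tb_w_def Suc_diff_Suc)
  moreover have "odd (p - Suc i) = even (Suc i)" using i odd_p by (auto simp: even_diff_nat)
  ultimately show "rev (tb_w p q) ! i = map exchange (tb_w p q) ! i"
    using i tb_sign_palindrome[of p q "Suc i"] coprime_pq odd_q by (simp add: tb_w_def tb_letter_def exchange_def)
qed simp

text \<open>Since \<open>w\<close> is a palindrome up to exchanging the generators, its matrix is symmetric.\<close>

lemma rho1_tb_w: "\<exists>d. rho1 x (tb_w p q) = m2 0 \<iota> \<iota> d"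
  and iota_sq: "\<iota> * \<iota> = -1"
proof -
  obtain c d where "rho1 x (prefix (p - 1)) = (if even (p - 1) then m2 (P (p - 1)) (Q (p - 1)) c d
      else m2 (Q (p - 1)) (P (p - 1)) c d)"
    using rho1_prefix[of "p - 1"] by (elim exE)
  moreover have "even (p - 1)" using odd_p by simp
  ultimately have W: "rho1 x (tb_w p q) = m2 0 \<iota> c d"
    by (simp only: tb_w_prefix \<iota>_def P_last if_True)
  \<comment> \<open>The reversed word and the word with generators exchanged coincide, so their two
    matrices do.\<close>
  have "m2 d \<iota> c 0 = m2 d c \<iota> 0"
    using rho1_rev[OF W] rho1_exchange[OF W] unfolding rev_tb_w by (rule trans[OF sym])
  hence c: "c = \<iota>" unfolding m2_inject by (elim conjE)
  show "\<exists>d. rho1 x (tb_w p q) = m2 0 \<iota> \<iota> d" using W unfolding c by (rule exI)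
  have "0 * d - \<iota> * \<iota> = 1" using det_rho1[OF W] unfolding c .
  hence "- (0 * d - \<iota> * \<iota>) = - 1" by (rule arg_cong)
  thus "\<iota> * \<iota> = -1" by (simp only: minus_diff_eq mult_zero_left diff_zero)
qed

text \<open>With the shape of the matrix of w the product is the scalar minus iota squared. So the
  formulas do define a representation of the knot group.\<close>

lemma rho1_tb_r: "rho1 x (tb_r p q) = 1\<^sub>m 2"
proof -
  obtain d where "rho1 x (tb_w p q) = m2 0 \<iota> \<iota> d" using rho1_tb_w by blast
  hence "rho1 x (tb_r p q) = m2 0 \<iota> \<iota> d * (m2 1 x 0 1 * (m2 d (- \<iota>) (- \<iota>) 0 * m2 1 0 (- x) 1))"
    by (simp add: tb_r_def rho1_append rho1_Cons rho1_inv_word one_m2)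
  also have "\<dots> = m2 (- (\<iota> * \<iota>)) 0 0 (- (\<iota> * \<iota>))"
    by (simp add: algebra_simps)
  finally show ?thesis by (simp add: iota_sq one_m2)
qed

lemma rho2_tb_r: "rho2 \<kappa> x (tb_r p q) = 1\<^sub>m 3"
  by (simp add: rho2_sym2 rho1_tb_r one_m2 one_m3 sym2_m2)

lemma rho1_u_power: "\<exists>z. rho1 x (u_power n) = m2 1 z 0 1"
proof -
  have "\<exists>z. rho1 x (replicate k (gu, t)) = m2 1 z 0 1" for k t
    by (induction k; cases t) (auto simp: rho1_Cons one_m2)
  thus ?thesis by (simp add: u_power_def)
qed

text \<open>The reversed word has the matrix of w with its diagonal entries exchanged. The product
  is upper triangular with diagonal iota squared, and powers of u are unipotent.\<close>

lemma rho1_longitude: "\<exists>z. rho1 x (tb_longitude p q) = m2 (-1) z 0 (-1)"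
proof -
  obtain d where W: "rho1 x (tb_w p q) = m2 0 \<iota> \<iota> d" using rho1_tb_w by blast
  obtain z where "rho1 x (u_power (- 2 * (\<Sum>k=1..<p. tb_sign p q k))) = m2 1 z 0 1"
    using rho1_u_power by blast
  thus ?thesis
    unfolding tb_longitude_def rho1_append rho1_rev[OF W] W by (simp add: iota_sq)
qed

text \<open>The inverse of q modulo 2p is l or 2p - l according to the sign in the congruence. In
  both cases the first column of the matrix of \<open>h\<close> starts with
  \<open>P (l - 1)\<close>.\<close>

lemma boundary_chain_eq:
  assumes l: "0 < l" "l < p" "odd l" "[int q * int l = 1] (mod int p) \<or> [int q * int l = -1] (mod int p)"
  obtains h b c d where "boundary_chain p q = [(1, inv_word h), (-1, rev (tb_w p q))]"
    "rho1 x h = m2 (P (l - 1)) b c d"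
proof -
  define e where "e = (LEAST c. [q * c = 1] (mod 2 * p))"
  define h where "h = take (e - 1) (tb_r p q)"
  have bc: "boundary_chain p q = [(1, inv_word h), (-1, rev (tb_w p q))]"
    by (simp add: boundary_chain_def Let_def h_def e_def)
  have cop: "coprime q (2 * p)" using coprime_pq odd_q by (simp add: coprime_commute)
  have e_unique: "e = c" if c: "[q * c = 1] (mod 2 * p)" "c < 2 * p" for c
  proof -
    have e: "[q * e = 1] (mod 2 * p)" unfolding e_def using c(1) by (rule LeastI)
    have "e \<le> c" unfolding e_def using c(1) by (rule Least_le)
    moreover have "[e = c] (mod 2 * p)"
      using e c(1) cop by (metis cong_mult_lcancel_nat cong_sym cong_trans)
    ultimately show ?thesis using c(2) by (simp add: cong_def)
  qed
  \<comment> \<open>Both q and l are odd, so the congruence modulo p also holds modulo 2p.\<close>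
  have lift: "[int q * int l = z] (mod int (2 * p))" if "[int q * int l = z] (mod int p)" "odd z" for z
  proof -
    have "even (int q * int l - z)" using that(2) odd_q l(3) by simp
    moreover have "int p dvd int q * int l - z" using that(1) by (simp add: cong_iff_dvd_diff)
    moreover have "coprime 2 (int p)" using odd_p by simp
    ultimately have "2 * int p dvd int q * int l - z" by (metis divides_mult)
    thus ?thesis by (simp add: cong_iff_dvd_diff)
  qed
  from l(4) show thesis
  proof
    assume "[int q * int l = 1] (mod int p)"
    hence "[int (q * l) = int 1] (mod int (2 * p))" using lift[of 1] by simp
    hence "[q * l = 1] (mod 2 * p)" by (simp only: cong_int_iff)
    hence "e = l" using l(2) by (intro e_unique) simp_all
    \<comment> \<open>Here \<open>h\<close> ends within w. As l - 1 is even, its matrix starts with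
      \<open>P (l - 1)\<close>.\<close>
    hence "h = prefix (l - 1)"
      using l take_tb_w[of "l - 1"] by (simp add: h_def tb_r_def tb_w_def)
    thus thesis using that[OF bc] rho1_prefix[of "l - 1"] l by auto
  next
    assume "[int q * int l = -1] (mod int p)"
    hence 1: "[int q * int l = -1] (mod int (2 * p))" using lift[of "-1"] by simp
    have "[int (q * (2 * p - l)) = int 1] (mod int (2 * p))"
    proof -
      have "int (q * (2 * p - l)) = int (2 * p) * int q - int q * int l"
        using l(2) by (simp add: of_nat_diff algebra_simps)
      moreover have "[int (2 * p) * int q - int q * int l = 0 - (-1)] (mod int (2 * p))"
        by (intro cong_diff 1) (simp add: cong_def)
      ultimately show ?thesis by simp
    qed
    hence "[q * (2 * p - l) = 1] (mod 2 * p)" by (simp only: cong_int_iff)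
    hence e: "e = 2 * p - l" using l by (intro e_unique) simp_all
    have len: "length (tb_w p q) = p - 1" by (simp add: tb_w_def)
    \<comment> \<open>Here \<open>h\<close> extends beyond w, and what follows it in the relator is
      the inverse of v times the prefix of length l. Since the relator acts trivially,
      \<open>h\<close> acts as v times this prefix, and v on the left keeps the first row.\<close>
    have "drop (e - 1) (tb_r p q) = drop (p - 1 - l) (inv_word (tb_w p q)) @ [(gv, False)]"
    proof -
      let ?w = "tb_w p q @ [(gu, True)]" and ?w' = "inv_word (tb_w p q)"
      have r: "tb_r p q = ?w @ (?w' @ [(gv, False)])" by (simp add: tb_r_def)
      have "e - 1 = length ?w + (p - 1 - l)" using e l by (simp add: len)
      hence "drop (e - 1) (tb_r p q) = drop (p - 1 - l) (?w' @ [(gv, False)])"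
        unfolding r by (simp only: drop_append) simp
      thus ?thesis by (simp add: inv_word_def len)
    qed
    also have "drop (p - 1 - l) (inv_word (tb_w p q)) = inv_word (prefix l)"
      by (simp only: inv_word_def take_tb_w[OF l(2), symmetric] take_map[symmetric] rev_take length_map len)
    finally have "tb_r p q = h @ (inv_word (prefix l) @ [(gv, False)])"
      unfolding h_def by (metis append_take_drop_id)
    moreover have "inv_word ((gv, True) # prefix l) = inv_word (prefix l) @ [(gv, False)]"
      by (simp add: inv_word_Cons)
    ultimately have "rho1 x h * rho1 x (inv_word ((gv, True) # prefix l)) = 1\<^sub>m 2"
      using rho1_tb_r by (simp add: rho1_append)
    hence "rho1 x ((gv, True) # prefix l) = rho1 x h * (rho1 x (inv_word ((gv, True) # prefix l)) * rho1 x ((gv, True) # prefix l))"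
      by (simp add: assoc_mult_mat[of _ 2 2 _ 2 _ 2, symmetric] left_mult_one_mat[of _ 2 2])
    hence "rho1 x h = rho1 x ((gv, True) # prefix l)"
      by (simp add: rho1.inv_left right_mult_one_mat[of _ 2 2])
    moreover obtain c d where "rho1 x (prefix l) = m2 (Q l) (P l) c d" using rho1_prefix[of l] l(3) by auto
    ultimately have "rho1 x h = m2 (Q l) (P l) (x * Q l + c) (x * P l + d)"
      by (simp add: rho1_Cons)
    moreover have "Q l = P (l - 1)" using l(1) by (cases l) auto
    ultimately show thesis using that[OF bc] by metis
  qed
qed

text \<open>A letter v follows exactly the prefixes of odd length j. Their matrix has first row
  \<open>(Q j, P j)\<close>, whose second entry enters the corner of the adjoint matrix as minus its
  square; the last column of the adjoint matrix of v^-1 is a unit vector, so inverse letters change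
  only the sign.\<close>

lemma D_v_prefix: "rho2.D gv (prefix k) $$ (0, 2) = - (\<Sum>j<k. if odd j then s (Suc j) * (P j)\<^sup>2 else 0)"
proof (induction k)
  case (Suc k)
  obtain a b c d e f g h i where D: "rho2.D gv (prefix k) = m3 a b c d e f g h i"
    using m3_cases[OF rho2.D_carrier] .
  obtain y z where r: "rho1 x (prefix k) = (if even k then m2 (P k) (Q k) y z else m2 (Q k) (P k) y z)"
    using rho1_prefix by blast
  have c: "c = - (\<Sum>j<k. if odd j then s (Suc j) * (P j)\<^sup>2 else 0)" using Suc D by simp
  have r2: "rho2 \<kappa> x (prefix k) = (if even k then sym2 (m2 (P k) (Q k) y z) else sym2 (m2 (Q k) (P k) y z))"
    using r by (simp add: rho2_sym2)
  have v: "rho2 \<kappa> x [(gv, False)] = m3 1 0 0 (2 * x) 1 0 (- (x * x)) (- x) 1"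
    by (simp add: rho2_sym2 rho1_Cons one_m2 sym2_m2)
  show ?case using sign_cases[of "Suc k"]
    unfolding prefix_Suc rho2.D_append D r2 rho2.D_letter tb_letter_def sum.lessThan_Suc
    by (auto simp: v sym2_m2 one_m3 zero_m3 c power2_eq_square algebra_simps simp del: index_mult_mat(1))
qed (simp add: zero_m3)

lemma D_v_tb_w: "rho2.D gv (tb_w p q) $$ (0, 2) = - odd_sum"
proof -
  have "(\<Sum>j<p-1. if odd j then s (Suc j) * (P j)\<^sup>2 else 0) = (\<Sum>j<2*((p-1) div 2). if odd j then s (Suc j) * (P j)\<^sup>2 else 0)"
    using odd_p by simp
  also have "\<dots> = odd_sum" unfolding sum_double odd_sum_def by simp
  finally show ?thesis unfolding tb_w_prefix D_v_prefix by simp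
qed

end

section \<open>Invertibility of Omega\<close>

context two_bridge_frobenius
begin

lemma even_sum_minus_odd_sum_unit: "even_sum - odd_sum dvd 1"
proof -
  let ?m = "(p - 1) div 2"
  have sq: "(s k * P j)\<^sup>2 = (P j)\<^sup>2" for j k
    by (simp add: power2_eq_square mult.assoc mult.left_commute)
  have "s (2 * j + 1) * P (2 * j) \<in> R" for j
    using s_in_R P_in_R by (rule R_closed(4))
  then obtain r where r: "r \<in> R" "(\<Sum>j<?m. s (2 * j + 1) * P (2 * j))\<^sup>2 = (\<Sum>j<?m. (P (2 * j))\<^sup>2) + 2 * r"
    using sum_sq_mod_2[of ?m "\<lambda>j. s (2 * j + 1) * P (2 * j)"] unfolding sq by blast
  \<comment> \<open>A sign in front of a square changes it by twice an element of
    \<open>R\<close>.\<close>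
  have "\<exists>u\<in>R. (P (2 * j))\<^sup>2 = s (2 * j + 1) * (P (2 * j))\<^sup>2 + 2 * u" for j
  proof -
    have "(P (2 * j))\<^sup>2 = 1 * (P (2 * j))\<^sup>2 + 2 * (of_int 0)"
      "(P (2 * j))\<^sup>2 = (-1) * (P (2 * j))\<^sup>2 + 2 * (P (2 * j) * P (2 * j))"
      by (simp_all add: power2_eq_square)
    thus ?thesis using sign_cases[of "2 * j + 1"] R_closed(1)[of 0] R_closed(4)[OF P_in_R P_in_R] by metis
  qed
  then obtain u where u: "\<And>j. u j \<in> R" "\<And>j. (P (2 * j))\<^sup>2 = s (2 * j + 1) * (P (2 * j))\<^sup>2 + 2 * u j" by metis
  have "(\<Sum>j<?m. (P (2 * j))\<^sup>2) = (\<Sum>j<?m. s (2 * j + 1) * (P (2 * j))\<^sup>2 + 2 * u j)"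
    by (intro sum.cong refl u(2))
  also have "\<dots> = even_sum + 2 * (\<Sum>j<?m. u j)" by (simp add: even_sum_def sum.distrib sum_distrib_left)
  finally have "(\<Sum>j<?m. s (2 * j + 1) * P (2 * j))\<^sup>2 = even_sum + 2 * (sum u {..<?m} + r)"
    using r(2) by (simp add: algebra_simps)
  moreover have "x * (\<Sum>j<?m. s (2 * j + 1) * P (2 * j)) = \<iota>"
    unfolding \<iota>_def using sum_even_P[of ?m] odd_p by (simp add: sum_distrib_left mult.left_commute mult.assoc)
  moreover have "(x * (\<Sum>j<?m. s (2 * j + 1) * P (2 * j)))\<^sup>2 = x\<^sup>2 * (\<Sum>j<?m. s (2 * j + 1) * P (2 * j))\<^sup>2"
    by (rule power_mult_distrib)
  \<comment> \<open>The linear sum times x is iota, whose square is -1; the square of the linear sum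
    is \<open>even_sum\<close> modulo twice an element of \<open>R\<close>.\<close>
  ultimately have key: "x\<^sup>2 * even_sum + 2 * (x\<^sup>2 * (sum u {..<?m} + r)) = -1"
    using iota_sq by (simp add: power2_eq_square algebra_simps)
  define v where "v = x\<^sup>2 * (sum u {..<?m} + r)"
  have v: "- v \<in> R"
  proof -
    have "of_int (-1) * (x * x * (sum u {..<?m} + r)) \<in> R"
      by (intro R_closed R_sum u(1) r(1))
    thus ?thesis by (simp add: v_def power2_eq_square)
  qed
  have "even_sum dvd 1"
  proof (rule unit_if_nonzerodivisor)
    fix y assume y: "even_sum * y = 0"
    have "(x\<^sup>2 * even_sum + 2 * v) * y = - y" using key by (simp add: v_def)
    moreover have "(x\<^sup>2 * even_sum + 2 * v) * y = x\<^sup>2 * (even_sum * y) + 2 * v * y" by (simp add: algebra_simps)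
    \<comment> \<open>An element killed by \<open>even_sum\<close> is thus fixed by an even element
      of \<open>R\<close>, which forces it to be 0.\<close>
    ultimately have "- y = 2 * v * y" using y by simp
    hence "y = - (2 * v * y)" by (metis minus_minus)
    hence "y = 2 * (- v) * y" by simp
    thus "y = 0" using odd_nonzerodivisor[OF v] by blast
  qed
  moreover have "2 dvd (1 :: 'a)" using two_\<kappa> by (metis dvdI)
  ultimately have "2 * even_sum dvd 1 * 1" by (intro mult_dvd_mono)
  moreover have "even_sum - odd_sum = 2 * even_sum" using even_sum_odd_sum by (simp add: add_eq_0_iff)
  ultimately show ?thesis by (simp only: mult_1_right)
qed

end

section \<open>Peripheral relations\<close>

text \<open>Only F pairs nontrivially with E, and the trace of FE is 1: the form reads off the last
  coordinate.\<close>

lemma pair_E_list_mat: "pair_E \<kappa> = mat_of_rows_list 3 [[0, 0, 1]]"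
  by (rule eq_matI)
    (auto simp: pair_E_def sl2_basis_def mat_of_rows_list_def scalar_prod_def sum_2 dest!: less_3_cases)

context two_bridge
begin

text \<open>Determines all entries of D^1 that are needed; the quantity multiplied by
  \<open>P (l - 1)\<close> in the last equation is the minor of D^1 used for the torsion.\<close>

lemma boundary_rho1:
  assumes l: "0 < l" "l < p" "odd l" "[int q * int l = 1] (mod int p) \<or> [int q * int l = -1] (mod int p)"
  obtains m n where "rho1.D x gu (tb_r p q) = m2 0 \<iota> 0 m" "rho1.D x gv (tb_r p q) = m2 (-1) 0 n 0"
    "P (l - 1) * (\<iota> * n + m) = 2"
proof -
  obtain h b c d where bc: "boundary_chain p q = [(1, inv_word h), (-1, rev (tb_w p q))]"
    and h: "rho1 x h = m2 (P (l - 1)) b c d" using boundary_chain_eq[OF l] .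
  obtain d' where W: "rho1 x (tb_w p q) = m2 0 \<iota> \<iota> d'" using rho1_tb_w by blast
  obtain z where L: "rho1 x (tb_longitude p q) = m2 (-1) z 0 (-1)" using rho1_longitude by blast
  have U: "rho1 x [(gu, True)] = m2 1 x 0 1" and V: "rho1 x [(gv, True)] = m2 1 0 x 1"
    by (simp_all add: rho1_Cons one_m2)
  obtain k00 k01 k10 k11 where Du: "rho1.D x gu (tb_r p q) = m2 k00 k01 k10 k11"
    using m2_cases[OF rho1.D_carrier] .
  obtain l00 l01 l10 l11 where Dv: "rho1.D x gv (tb_r p q) = m2 l00 l01 l10 l11"
    using m2_cases[OF rho1.D_carrier] .
  obtain u00 u01 u10 u11 where Duw: "rho1.D x gu (tb_w p q) = m2 u00 u01 u10 u11"
    using m2_cases[OF rho1.D_carrier] .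
  obtain v00 v01 v10 v11 where Dvw: "rho1.D x gv (tb_w p q) = m2 v00 v01 v10 v11"
    using m2_cases[OF rho1.D_carrier] .
  \<comment> \<open>D^1 D^0 = 0 kills the first column of the u block and the second column of the v
    block.\<close>
  have "l01 * x = 0" "k00 * x = 0" "l11 * x = 0" "k10 * x = 0"
    using rho1.D_relator_fundamental[OF rho1_tb_r] unfolding Du Dv U V one_m2 zero_m2 by simp_all
  hence z: "l01 = 0" "k00 = 0" "l11 = 0" "k10 = 0"
    using cancel_x[of _ 0] by (simp_all add: mult.commute)
  have k: "k01 = \<iota>"
    using rho1.D_relator_u[OF rho1_tb_r] unfolding Du Duw U V W one_m2 by simp
  have ll: "l00 = -1"
    using rho1.D_relator_v[OF rho1_tb_r] unfolding Dv Dvw U V one_m2 by simp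
  obtain p00 p01 p10 p11 where Dul: "rho1.D x gu (tb_longitude p q) = m2 p00 p01 p10 p11"
    using m2_cases[OF rho1.D_carrier] .
  obtain q00 q01 q10 q11 where Dvl: "rho1.D x gv (tb_longitude p q) = m2 q00 q01 q10 q11"
    using m2_cases[OF rho1.D_carrier] .
  have B: "eval_chain 2 (rho1 x) (boundary_chain p q) = m2 (d - d') (- b - \<iota>) (- c - \<iota>) (P (l - 1))"
    unfolding bc by (simp add: rho1_inv_word h rho1_rev[OF W] zero_m2)
  note bound = rho1.boundary_chain_D[OF coprime_pq odd_p odd_q rho1_tb_r]
  \<comment> \<open>Bottom row of the boundary identity: u - 1 vanishes there and 1 minus the
    longitude contributes 2. The v block below then eliminates the unknown c.\<close>
  have "(- c - \<iota>) * \<iota> + P (l - 1) * k11 = 2"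
    using bound[of gu] unfolding B Du Dul L U one_m2 rho1.D_letter k by simp
  moreover have "- (- c - \<iota>) + P (l - 1) * l10 = 0"
    using bound[of gv] unfolding B Dv Dvl L U one_m2 zero_m2 rho1.D_letter ll by simp
  hence "P (l - 1) * l10 = - c - \<iota>" by (simp only: add_eq_0_iff minus_minus)
  moreover have "P (l - 1) * (\<iota> * l10 + k11) = (P (l - 1) * l10) * \<iota> + P (l - 1) * k11"
    by (simp add: algebra_simps)
  ultimately have "P (l - 1) * (\<iota> * l10 + k11) = 2" by (simp only:)
  thus thesis using that Du Dv unfolding z k ll by blast
qed

text \<open>All entries of the mapping cone up to a few unknowns, together with the relations that
  express that \<open>f2\<close> vanishes on the image of D^1.\<close>

lemma boundary_rho2:
  assumes l: "0 < l" "l < p" "odd l" "[int q * int l = 1] (mod int p) \<or> [int q * int l = -1] (mod int p)"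
  obtains n0 n1 s b2 b3 c2 c3 where
    "rho2.D gu (tb_r p q) = m3 0 0 1 (x * (even_sum - odd_sum)) (\<kappa> * x * (x * (even_sum - odd_sum))) b2 s (\<kappa> * x * s) c2"
    "rho2.D gv (tb_r p q) = m3 (-1) 0 0 b3 (- \<kappa> * x * (x * (even_sum - odd_sum))) (x * (even_sum - odd_sum)) c3 (- \<kappa> * x * s) s"
    "f2 p q \<kappa> x = mat_of_rows_list 3 [[n0, n1, (P (l - 1))\<^sup>2]]"
    "n1 * (x * (even_sum - odd_sum)) + (P (l - 1))\<^sup>2 * s = 0"
    "n0 + n1 * b2 + (P (l - 1))\<^sup>2 * c2 = 0" "- n0 + n1 * b3 + (P (l - 1))\<^sup>2 * c3 = 0"
proof -
  let ?a = "P (l - 1)"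
  obtain h b c d where bc: "boundary_chain p q = [(1, inv_word h), (-1, rev (tb_w p q))]"
    and h: "rho1 x h = m2 ?a b c d" using boundary_chain_eq[OF l] .
  obtain d' where W: "rho1 x (tb_w p q) = m2 0 \<iota> \<iota> d'" using rho1_tb_w by blast
  obtain z where L: "rho1 x (tb_longitude p q) = m2 (-1) z 0 (-1)" using rho1_longitude by blast
  have U: "rho2 \<kappa> x [(gu, True)] = m3 1 (- x) (- (x * x)) 0 1 (2 * x) 0 0 1"
    and V: "rho2 \<kappa> x [(gv, True)] = m3 1 0 0 (- 2 * x) 1 0 (- (x * x)) x 1"
    and W2: "rho2 \<kappa> x (tb_w p q) = m3 0 0 1 0 (- 1) (2 * \<iota> * d') 1 (\<iota> * d') (d' * d')"
    and L2: "rho2 \<kappa> x (tb_longitude p q) = m3 1 z (- (z * z)) 0 1 (- 2 * z) 0 0 1"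
    by (simp_all add: rho2_sym2 rho1_Cons one_m2 sym2_m2 W iota_sq L)
  obtain k0 k1 k2 t0 t1 b2 s0 s1 c2 where Du: "rho2.D gu (tb_r p q) = m3 k0 k1 k2 t0 t1 b2 s0 s1 c2"
    using m3_cases[OF rho2.D_carrier] .
  obtain l0 l1 l2 b3 t4 t5 c3 s4 s5 where Dv: "rho2.D gv (tb_r p q) = m3 l0 l1 l2 b3 t4 t5 c3 s4 s5"
    using m3_cases[OF rho2.D_carrier] .
  obtain u00 u01 u02 u10 u11 u12 u20 u21 u22 where
    Duw: "rho2.D gu (tb_w p q) = m3 u00 u01 u02 u10 u11 u12 u20 u21 u22"
    using m3_cases[OF rho2.D_carrier] .
  obtain v00 v01 v02 v10 v11 v12 v20 v21 v22 where
    Dvw: "rho2.D gv (tb_w p q) = m3 v00 v01 v02 v10 v11 v12 v20 v21 v22"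
    using m3_cases[OF rho2.D_carrier] .
  have v02: "v02 = - odd_sum" using D_v_tb_w Dvw by simp
  have k: "k0 = 0" "k1 = 0" "k2 = 1"
    using rho2.D_relator_u[OF rho2_tb_r] unfolding Du Duw V W2 one_m3 by simp_all
  have ll: "l0 = -1" "l1 = 0" "l2 = 0" "t5 = 2 * x * v02"
    using rho2.D_relator_v[OF rho2_tb_r] unfolding Dv Dvw V one_m3 by simp_all
  have odd_sum: "even_sum = - odd_sum" using even_sum_odd_sum by (simp add: eq_neg_iff_add_eq_0)
  \<comment> \<open>The relator formula gives minus twice x times \<open>odd_sum\<close>, which is x
    times Omega.\<close>
  have t5: "t5 = x * (even_sum - odd_sum)" unfolding ll v02 odd_sum by (simp add: algebra_simps)
  have fund: "t4 * (- 2 * x) + t5 * (- (x * x)) = 0" "s4 * (- 2 * x) + s5 * (- (x * x)) = 0"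
    "t0 * - x + t5 * x = 0" "s0 * - x + s5 * x = 0"
    "t0 * - (x * x) + t1 * (2 * x) = 0" "s0 * - (x * x) + s1 * (2 * x) = 0"
    using rho2.D_relator_fundamental[OF rho2_tb_r] unfolding Du Dv U V one_m3 zero_m3 by simp_all
  have t0: "t0 = t5" "s0 = s5"
  proof -
    have "y = y'" if "y * - x + y' * x = 0" for y y'
    proof (rule cancel_x)
      have "x * y' - x * y = y * - x + y' * x" by (simp add: algebra_simps)
      hence "x * y' - x * y = 0" by (simp only: that)
      thus "x * y = x * y'" by simp
    qed
    thus "t0 = t5" "s0 = s5" using fund(3,4) by blast+
  qed
  \<comment> \<open>Cancels x and halves; with D^1 D^0 = 0 this expresses the middle columns of both
    blocks through the outer ones.\<close>
  have half: "y = \<kappa> * x * y'" if "y' * - (x * x) + y * (2 * x) = 0" for y y'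
  proof -
    have "x * (2 * y) - x * (x * y') = y' * - (x * x) + y * (2 * x)" by (simp add: algebra_simps)
    hence "x * (2 * y) - x * (x * y') = 0" by (simp only: that)
    hence "x * (2 * y) = x * (x * y')" by (simp only: right_minus_eq)
    hence "2 * y = x * y'" by (rule cancel_x)
    moreover have "\<kappa> * (2 * y) = (2 * \<kappa>) * y" by (simp only: ac_simps)
    ultimately show ?thesis by (simp add: two_\<kappa> mult.assoc)
  qed
  have t1: "t1 = \<kappa> * x * t5" "s1 = \<kappa> * x * s5"
    by (rule half, rule fund(5)[unfolded t0]) (rule half, rule fund(6)[unfolded t0])
  have neg: "y * (- 2 * x) + y' * - (x * x) = 0 \<Longrightarrow> y' * - (x * x) + (- y) * (2 * x) = 0" for y y'
    by (simp add: algebra_simps)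
  have "- t4 = \<kappa> * x * t5" "- s4 = \<kappa> * x * s5"
    by (rule half, rule neg, rule fund(1)) (rule half, rule neg, rule fund(2))
  hence "- (- t4) = - (\<kappa> * x * t5)" "- (- s4) = - (\<kappa> * x * s5)" by (simp_all only:)
  hence t4: "t4 = - \<kappa> * x * t5" "s4 = - \<kappa> * x * s5" by (simp_all only: minus_minus mult_minus_left)
  obtain p00 p01 p02 p10 p11 p12 p20 p21 p22 where
    Dul: "rho2.D gu (tb_longitude p q) = m3 p00 p01 p02 p10 p11 p12 p20 p21 p22"
    using m3_cases[OF rho2.D_carrier] .
  obtain q00 q01 q02 q10 q11 q12 q20 q21 q22 where
    Dvl: "rho2.D gv (tb_longitude p q) = m3 q00 q01 q02 q10 q11 q12 q20 q21 q22"
    using m3_cases[OF rho2.D_carrier] .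
  \<comment> \<open>The last row of the adjoint matrix of the inverse of \<open>h\<close>, minus
    that of the reversed w, which is (1, 0, 0).\<close>
  define n0 n1 where "n0 = - (c * c) - 1" and "n1 = - (c * ?a)"
  obtain b00 b01 b02 b10 b11 b12 b20 b21 b22 where
    B0: "eval_chain 3 (rho2 \<kappa> x) (boundary_chain p q) = m3 b00 b01 b02 b10 b11 b12 b20 b21 b22"
    using m3_cases[OF rho2.eval_chain_carrier] .
  have "eval_chain 3 (rho2 \<kappa> x) (boundary_chain p q) =
      sym2 (m2 d (- b) (- c) ?a) + - sym2 (m2 d' \<iota> \<iota> 0)"
    unfolding bc by (simp add: rho2_sym2 rho1_inv_word h rho1_rev[OF W] zero_m3 sym2_m2)
  hence "b20 = n0 \<and> b21 = n1 \<and> b22 = ?a\<^sup>2"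
    unfolding B0 sym2_m2 m3_arith m3_inject by (simp add: iota_sq n0_def n1_def power2_eq_square)
  hence B: "eval_chain 3 (rho2 \<kappa> x) (boundary_chain p q) = m3 b00 b01 b02 b10 b11 b12 n0 n1 (?a\<^sup>2)"
    using B0 by (simp only:)
  note bound = rho2.boundary_chain_D[OF coprime_pq odd_p odd_q rho2_tb_r]
  \<comment> \<open>In the last row both u - 1 and 1 minus the longitude are zero, so the right side
    of the boundary identity drops out.\<close>
  have "n1 * t0 + ?a\<^sup>2 * s0 = 0" "n0 + n1 * b2 + ?a\<^sup>2 * c2 = 0"
    using bound[of gu] unfolding B Du Dul L2 U one_m3 rho2.D_letter k by simp_all
  moreover have "- n0 + n1 * b3 + ?a\<^sup>2 * c3 = 0"
    using bound[of gv] unfolding B Dv Dvl L2 U one_m3 zero_m3 rho2.D_letter ll by simp_all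
  moreover have "f2 p q \<kappa> x = mat_of_rows_list 3 [[n0, n1, ?a\<^sup>2]]"
    unfolding f2_def B pair_E_list_mat
    by (auto simp: mat_of_rows_list_def scalar_prod_def sum_3 intro!: eq_matI dest!: less_3_cases)
  moreover have "rho2.D gu (tb_r p q) =
      m3 0 0 1 (x * (even_sum - odd_sum)) (\<kappa> * x * (x * (even_sum - odd_sum))) b2 s5 (\<kappa> * x * s5) c2"
    unfolding Du k t0 t1 t5 ..
  moreover have "rho2.D gv (tb_r p q) =
      m3 (-1) 0 0 b3 (- \<kappa> * x * (x * (even_sum - odd_sum))) (x * (even_sum - odd_sum)) c3 (- \<kappa> * x * s5) s5"
    unfolding Dv ll(1-3) t4 t5 ..
  ultimately show thesis
    unfolding t0 t5 using that by blast
qed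

end

section \<open>Based complexes given by lists of rows\<close>

definition list_vec :: "'a list \<Rightarrow> 'a vec" where
  "list_vec xs = vec (length xs) ((!) xs)"

abbreviation list_mat :: "nat \<Rightarrow> 'a list list \<Rightarrow> 'a mat" where
  "list_mat \<equiv> mat_of_rows_list"

text \<open>The matrix-vector product on lists: kernels and images of explicit matrices become
  conditions on finitely many scalars.\<close>

definition apply_rows :: "'a::comm_ring_1 list list \<Rightarrow> 'a list \<Rightarrow> 'a list" where
  "apply_rows rs xs = map (\<lambda>r. sum_list (map2 (*) r xs)) rs"

lemma list_vec_simps [simp]:
  "dim_vec (list_vec xs) = length xs" "i < length xs \<Longrightarrow> list_vec xs $ i = xs ! i"
  by (simp_all add: list_vec_def)

lemma list_vec_eq_iff: "list_vec xs = list_vec ys \<longleftrightarrow> xs = ys"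
proof
  assume "list_vec xs = list_vec ys"
  hence "length xs = length ys" "\<And>i. i < length xs \<Longrightarrow> xs ! i = ys ! i"
    by (metis list_vec_simps(1), metis list_vec_simps)
  thus "xs = ys" by (rule nth_equalityI)
qed simp

lemma carrier_vec_lists: "carrier_vec n = list_vec ` {xs. length xs = n}"
proof -
  have "v \<in> list_vec ` {xs. length xs = n}" if v: "v \<in> carrier_vec n" for v :: "'a vec"
  proof (rule image_eqI)
    show "v = list_vec (list_of_vec v)" by (rule eq_vecI) (auto simp: list_of_vec_index)
    show "list_of_vec v \<in> {xs. length xs = n}" using v by simp
  qed
  thus ?thesis by (auto intro: carrier_vecI)
qed

lemma list_mat_mult_vec:
  assumes "length xs = n" "\<forall>r\<in>set rs. length r = n"
  shows "list_mat n rs *\<^sub>v list_vec xs = list_vec (apply_rows rs xs)"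
proof (rule eq_vecI)
  fix i assume "i < dim_vec (list_vec (apply_rows rs xs))"
  hence i: "i < length rs" by (simp add: apply_rows_def)
  hence "length (rs ! i) = n" using assms by simp
  thus "(list_mat n rs *\<^sub>v list_vec xs) $ i = list_vec (apply_rows rs xs) $ i"
    using i assms(1)
    by (simp add: mat_of_rows_list_def scalar_prod_def apply_rows_def sum_list_sum_nth)
qed (simp add: apply_rows_def mat_of_rows_list_def)

lemma list_mat_dims [simp]: "dim_row (list_mat n rs) = length rs" "dim_col (list_mat n rs) = n"
  by (simp_all add: mat_of_rows_list_def)

lemma mat_kernel_list_mat:
  assumes "\<forall>r\<in>set rs. length r = n"
  shows "mat_kernel (list_mat n rs) =
    list_vec ` {xs. length xs = n \<and> apply_rows rs xs = replicate (length rs) 0}"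
proof -
  have zero: "0\<^sub>v (length rs) = list_vec (replicate (length rs) 0)" by (rule eq_vecI) auto
  have "list_mat n rs *\<^sub>v list_vec xs = 0\<^sub>v (length rs) \<longleftrightarrow> apply_rows rs xs = replicate (length rs) 0"
    if "length xs = n" for xs
    unfolding zero list_mat_mult_vec[OF that assms] list_vec_eq_iff ..
  thus ?thesis unfolding mat_kernel_def list_mat_dims carrier_vec_lists by blast
qed

lemma mat_image_list_mat:
  assumes "\<forall>r\<in>set rs. length r = n"
  shows "mat_image (list_mat n rs) = list_vec ` apply_rows rs ` {xs. length xs = n}"
  unfolding mat_image_def list_mat_dims carrier_vec_lists image_image
  by (intro image_cong refl list_mat_mult_vec assms) simp

lemma length_eq_numeral_conv:
  "length xs = 1 \<longleftrightarrow> (\<exists>a. xs = [a])"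
  "length xs = 2 \<longleftrightarrow> (\<exists>a b. xs = [a, b])"
  "length xs = 3 \<longleftrightarrow> (\<exists>a b c. xs = [a, b, c])"
  "length xs = 4 \<longleftrightarrow> (\<exists>a b c d. xs = [a, b, c, d])"
  "length xs = 6 \<longleftrightarrow> (\<exists>a b c d e f. xs = [a, b, c, d, e, f])"
  by (auto simp: numeral_eq_Suc length_Suc_conv)

text \<open>The ring may have zero divisors, so cancellation is available for units only.\<close>

lemma unit_cancel: "a dvd (1::'a::comm_ring_1) \<Longrightarrow> a * b = a * c \<longleftrightarrow> b = c"
proof
  assume "a dvd 1" "a * b = a * c"
  then obtain y where y: "1 = a * y" by (auto elim: dvdE)
  have "b = (a * y) * b" "c = (a * y) * c" by (simp_all flip: y)
  thus "b = c" using \<open>a * b = a * c\<close> by (metis mult.assoc mult.commute)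
qed simp

lemma unit_cancel_0: "a dvd (1::'a::comm_ring_1) \<Longrightarrow> a * b = 0 \<longleftrightarrow> b = 0"
  using unit_cancel[of a b 0] by simp

section \<open>Minors of explicit matrices and constraints on invertible minors\<close>

lemma det_m2: "det (m2 a b c d) = a * d - b * c"
proof -
  have "mat_delete (m2 a b c d) 0 0 = mat 1 1 (\<lambda>_. d)" "mat_delete (m2 a b c d) 0 (Suc 0) = mat 1 1 (\<lambda>_. c)"
    by (auto simp: mat_delete_def insert_index_def intro!: eq_matI)
  moreover have "{..<2::nat} = {0, Suc 0}" by auto
  ultimately show ?thesis
    by (simp add: laplace_expansion_row[of "m2 a b c d" 2 0] cofactor_def det_single)
qed

lemma det_m3: "det (m3 a b c d e f g h i) = a * (e * i - f * h) - b * (d * i - f * g) + c * (d * h - e * g)"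
proof -
  have "mat_delete (m3 a b c d e f g h i) 0 0 = m2 e f h i"
    "mat_delete (m3 a b c d e f g h i) 0 (Suc 0) = m2 d f g i"
    "mat_delete (m3 a b c d e f g h i) 0 2 = m2 d e g h"
    by (subst eq_m2_iff; auto simp: mat_delete_def numeral_2_eq_2[symmetric])+
  moreover have "{..<3::nat} = {0, Suc 0, 2}" by auto
  ultimately show ?thesis
    by (simp add: laplace_expansion_row[of "m3 a b c d e f g h i" 3 0] cofactor_def det_m2 algebra_simps)
qed

lemma pick_2:
  assumes "a < b"
  shows "pick {a, b} 0 = a" "pick {a, b} (Suc 0) = b"
proof -
  show 0: "pick {a, b} 0 = a" using assms by (auto intro!: Least_equality)
  have "(LEAST x. x \<in> {a, b} \<and> a < x) = b" using assms by (intro Least_equality) auto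
  thus "pick {a, b} (Suc 0) = b" by (simp only: pick.simps(2) 0)
qed

lemma pick_3:
  assumes "a < b" "b < c"
  shows "pick {a, b, c} 0 = a" "pick {a, b, c} (Suc 0) = b" "pick {a, b, c} 2 = c"
proof -
  show 0: "pick {a, b, c} 0 = a" using assms by (auto intro!: Least_equality)
  have "(LEAST x. x \<in> {a, b, c} \<and> a < x) = b" using assms by (intro Least_equality) auto
  thus 1: "pick {a, b, c} (Suc 0) = b" by (simp only: pick.simps(2) 0)
  have "(LEAST x. x \<in> {a, b, c} \<and> b < x) = c" using assms by (intro Least_equality) auto
  hence "pick {a, b, c} (Suc (Suc 0)) = c" by (simp only: pick.simps(2)[of _ "Suc 0"] 1)
  thus "pick {a, b, c} 2 = c" by (simp only: numeral_2_eq_2)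
qed

lemma submatrix_m2:
  assumes "i0 < i1" "i1 < dim_row A" "j0 < j1" "j1 < dim_col A"
  shows "submatrix A {i0, i1} {j0, j1} =
    m2 (A $$ (i0, j0)) (A $$ (i0, j1)) (A $$ (i1, j0)) (A $$ (i1, j1))"
proof -
  have "{i. i < dim_row A \<and> i \<in> {i0, i1}} = {i0, i1}" "{j. j < dim_col A \<and> j \<in> {j0, j1}} = {j0, j1}"
    using assms by auto
  hence "card {i. i < dim_row A \<and> i \<in> {i0, i1}} = 2" "card {j. j < dim_col A \<and> j \<in> {j0, j1}} = 2"
    using assms by auto
  thus ?thesis
    by (subst eq_m2_iff)
      (auto simp: submatrix_def pick_2[OF assms(1)] pick_2[OF assms(3)] simp del: pick.simps)
qed

lemma submatrix_m3:
  assumes "i0 < i1" "i1 < i2" "i2 < dim_row A" "j0 < j1" "j1 < j2" "j2 < dim_col A"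
  shows "submatrix A {i0, i1, i2} {j0, j1, j2} =
    m3 (A $$ (i0, j0)) (A $$ (i0, j1)) (A $$ (i0, j2)) (A $$ (i1, j0)) (A $$ (i1, j1)) (A $$ (i1, j2))
      (A $$ (i2, j0)) (A $$ (i2, j1)) (A $$ (i2, j2))"
proof -
  have "{i. i < dim_row A \<and> i \<in> {i0, i1, i2}} = {i0, i1, i2}"
    "{j. j < dim_col A \<and> j \<in> {j0, j1, j2}} = {j0, j1, j2}"
    using assms by auto
  hence "card {i. i < dim_row A \<and> i \<in> {i0, i1, i2}} = 3" "card {j. j < dim_col A \<and> j \<in> {j0, j1, j2}} = 3"
    using assms by auto
  thus ?thesis
    by (subst eq_m3_iff)
      (auto simp: submatrix_def pick_3[OF assms(1,2)] pick_3[OF assms(4,5)] simp del: pick.simps)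
qed

lemma det_submatrix_1:
  assumes "i < dim_row A" "j < dim_col A"
  shows "det (submatrix A {i} {j}) = A $$ (i, j)"
proof -
  have sets: "{k. k < dim_row A \<and> k \<in> {i}} = {i}" "{k. k < dim_col A \<and> k \<in> {j}} = {j}"
    using assms by auto
  have pick: "pick {n} 0 = n" for n by (auto intro!: Least_equality)
  have "submatrix A {i} {j} = mat 1 1 (\<lambda>_. A $$ (i, j))"
    unfolding submatrix_def sets by (rule eq_matI) (auto simp: pick simp del: pick.simps)
  thus ?thesis by (simp add: det_single)
qed

text \<open>The determinant of a non-square matrix is 0 by convention, and 0 is not a unit.\<close>

lemma unit_minor_card:
  fixes A :: "'a::comm_ring_1 mat"
  assumes "det (submatrix A I C) dvd 1" "I \<subseteq> {..<dim_row A}" "C \<subseteq> {..<dim_col A}"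
  shows "card I = card C"
proof (rule ccontr)
  assume ne: "card I \<noteq> card C"
  have sets: "{i. i < dim_row A \<and> i \<in> I} = I" "{i. i < dim_col A \<and> i \<in> C} = C"
    using assms(2,3) by auto
  have "dim_row (submatrix A I C) \<noteq> dim_col (submatrix A I C)"
    using ne unfolding dim_submatrix sets .
  hence "det (submatrix A I C) = 0" by (simp add: det_def)
  thus False using assms(1) by simp
qed

lemma det_zero_row:
  fixes S :: "'a::comm_ring_1 mat"
  assumes "\<And>j. j < dim_col S \<Longrightarrow> S $$ (k, j) = 0" "k < dim_row S" "dim_row S = dim_col S"
  shows "det S = 0"
proof -
  have eq: "multrow k 0 S = S"
  proof (rule eq_matI)
    fix i j assume "i < dim_row S" "j < dim_col S"
    thus "multrow k 0 S $$ (i, j) = S $$ (i, j)" using assms(1)[of j] by (cases "i = k") auto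
  qed auto
  have "S \<in> carrier_mat (dim_row S) (dim_row S)" using assms(3) by (intro carrier_matI) auto
  with assms(2) have "det (multrow k 0 S) = 0 * det S" by (rule det_multrow)
  thus ?thesis unfolding eq by (simp only: mult_zero_left)
qed

text \<open>A chosen zero row would make the minor 0. This limits the row sets that can be used for
  D^0.\<close>

lemma unit_minor_row:
  fixes A :: "'a::comm_ring_1 mat"
  assumes unit: "det (submatrix A I C) dvd 1" and r: "r < dim_row A" "\<And>c. c < dim_col A \<Longrightarrow> A $$ (r, c) = 0"
    and C: "C \<subseteq> {..<dim_col A}"
  shows "r \<notin> I"
proof
  assume "r \<in> I"
  let ?S = "submatrix A I C"
  \<comment> \<open>The position of row r among the chosen rows, counted from 0.\<close>
  let ?k = "card {a \<in> I. a < r}"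
  have sq: "dim_row ?S = dim_col ?S" using unit by (cases "dim_row ?S = dim_col ?S") (auto simp: det_def)
  have "{a \<in> I. a < r} \<subset> {i. i < dim_row A \<and> i \<in> I}" using r \<open>r \<in> I\<close> by auto
  hence k: "?k < dim_row ?S" unfolding dim_submatrix by (intro psubset_card_mono) auto
  have "?S $$ (?k, j) = 0" if "j < dim_col ?S" for j
  proof -
    have "pick I ?k = r" using \<open>r \<in> I\<close> by (rule pick_card_in_set)
    have j: "j < card {c. c < dim_col A \<and> c \<in> C}" using that by (simp only: dim_submatrix)
    hence "pick C j < dim_col A" by (rule pick_le)
    moreover have "?S $$ (?k, j) = A $$ (pick I ?k, pick C j)"
      using k j unfolding dim_submatrix by (rule submatrix_index)
    ultimately show ?thesis using r(2) \<open>pick I ?k = r\<close> by (simp only:)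
  qed
  hence "det ?S = 0" using k sq by (rule det_zero_row)
  thus False using unit by simp
qed

lemma list_mat_index [simp]: "i < length rs \<Longrightarrow> j < n \<Longrightarrow> list_mat n rs $$ (i, j) = rs ! i ! j"
  by (simp add: mat_of_rows_list_def)

section \<open>Exactness of complexes given by lists of rows\<close>

lemma injective_list_mat:
  assumes "\<forall>r\<in>set rs. length r = n"
    and "\<And>xs. length xs = n \<Longrightarrow> apply_rows rs xs = replicate (length rs) 0 \<longleftrightarrow> xs = replicate n 0"
  shows "mat_kernel (list_mat n rs) = {0\<^sub>v (dim_col (list_mat n rs))}"
proof -
  have "list_vec (replicate n 0) = 0\<^sub>v n" by (rule eq_vecI) auto
  moreover have "{xs. length xs = n \<and> apply_rows rs xs = replicate (length rs) 0} = {replicate n 0}"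
    using assms(2) by auto
  ultimately show ?thesis unfolding mat_kernel_list_mat[OF assms(1)] by simp
qed

lemma exact_list_mat:
  assumes "\<forall>r\<in>set rs. length r = n" "\<forall>r\<in>set rs'. length r = n'" "length rs = n'"
    and "\<And>w. length w = n \<Longrightarrow> apply_rows rs' (apply_rows rs w) = replicate (length rs') 0"
    and "\<And>xs. length xs = n' \<Longrightarrow> apply_rows rs' xs = replicate (length rs') 0 \<Longrightarrow> \<exists>w. length w = n \<and> apply_rows rs w = xs"
  shows "mat_kernel (list_mat n' rs') = mat_image (list_mat n rs)"
proof -
  have "{xs. length xs = n' \<and> apply_rows rs' xs = replicate (length rs') 0} = apply_rows rs ` {xs. length xs = n}"
    (is "?A = ?B")
  proof
    show "?A \<subseteq> ?B" using assms(5) by blast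
    show "?B \<subseteq> ?A" using assms(3,4) by (auto simp: apply_rows_def[of rs])
  qed
  thus ?thesis unfolding mat_kernel_list_mat[OF assms(2)] mat_image_list_mat[OF assms(1)] by (rule arg_cong)
qed

lemma surjective_list_mat:
  assumes "\<forall>r\<in>set rs. length r = n"
    and "\<And>ys. length ys = length rs \<Longrightarrow> \<exists>xs. length xs = n \<and> apply_rows rs xs = ys"
  shows "mat_image (list_mat n rs) = carrier_vec (dim_row (list_mat n rs))"
proof -
  have "apply_rows rs ` {xs. length xs = n} = {ys. length ys = length rs}" (is "?A = ?B")
  proof
    show "?A \<subseteq> ?B" by (auto simp: apply_rows_def)
    show "?B \<subseteq> ?A" using assms(2) by blast
  qed
  thus ?thesis unfolding mat_image_list_mat[OF assms(1)] carrier_vec_lists list_mat_dims by (rule arg_cong)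
qed

lemma subset_lessThan_minus_one:
  assumes "J \<subseteq> {..<Suc n}" "card J = n"
  shows "\<exists>m<Suc n. J = {..<Suc n} - {m}"
proof -
  have "card ({..<Suc n} - J) = 1" using assms by (simp add: card_Diff_subset finite_subset)
  then obtain m where m: "{..<Suc n} - J = {m}" by (rule card_1_singletonE)
  hence "m < Suc n" "J = {..<Suc n} - {m}" using assms(1) by auto
  thus ?thesis by blast
qed

text \<open>\<open>I\<close> lists the rows kept, \<open>J\<close> the columns deleted: those
  already used as rows for the preceding differential.\<close>

definition minor :: "'a::comm_ring_1 mat \<Rightarrow> nat set \<Rightarrow> nat set \<Rightarrow> 'a" where
  "minor A I J = det (submatrix A I ({..<dim_col A} - J))"

text \<open>The first and the last basis set of a choice are forced, so only the set in the middle
  is free.\<close>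

lemma is_torsion_2:
  "is_torsion [A, B] \<tau> \<longleftrightarrow> acyclic_complex [A, B] \<and>
    (\<exists>J\<subseteq>{..<dim_row A}. minor A J {} dvd 1 \<and> minor B {..<dim_row B} J dvd 1 \<and>
      (\<tau> * minor A J {} = minor B {..<dim_row B} J \<or> \<tau> * minor A J {} = - minor B {..<dim_row B} J))"
    (is "_ \<longleftrightarrow> _ \<and> (\<exists>J\<subseteq>_. ?P J)")
proof -
  have sets: "{k. k < length [A, B] \<and> even k} = {0}" "{k. k < length [A, B] \<and> odd k} = {1}"
    by (auto simp: less_Suc_eq)
  have "(\<exists>J::nat \<Rightarrow> nat set. J 0 = {} \<and> J 2 = {..<dim_row B} \<and> J 1 \<subseteq> {..<dim_row A} \<and> ?P (J 1)) \<longleftrightarrow>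
      (\<exists>J\<subseteq>{..<dim_row A}. ?P J)"
  proof
    assume "\<exists>J\<subseteq>{..<dim_row A}. ?P J"
    then obtain J where J: "J \<subseteq> {..<dim_row A}" "?P J" by blast
    obtain K :: "nat \<Rightarrow> nat set" where "K 0 = {}" "K 1 = J" "K 2 = {..<dim_row B}"
      by (rule that[of "\<lambda>k. if k = 0 then {} else if k = 1 then J else {..<dim_row B}"]) simp_all
    thus "\<exists>J::nat \<Rightarrow> nat set. J 0 = {} \<and> J 2 = {..<dim_row B} \<and> J 1 \<subseteq> {..<dim_row A} \<and> ?P (J 1)"
      using J by - (rule exI[of _ K], simp)
  qed blast
  moreover have "is_torsion [A, B] \<tau> \<longleftrightarrow> acyclic_complex [A, B] \<and>
      (\<exists>J::nat \<Rightarrow> nat set. J 0 = {} \<and> J 2 = {..<dim_row B} \<and> J 1 \<subseteq> {..<dim_row A} \<and> ?P (J 1))"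
  proof -
    have "(J 0 = {} \<and> J (length [A, B]) = {..<dim_row (last [A, B])} \<and>
        (\<forall>i<length [A, B]. J (Suc i) \<subseteq> {..<dim_row ([A, B] ! i)} \<and> cayley_minor [A, B] J i dvd 1) \<and>
        (\<exists>s\<in>{1, -1}. \<tau> * (\<Prod>i\<in>{0}. cayley_minor [A, B] J i) = s * (\<Prod>i\<in>{1}. cayley_minor [A, B] J i))) \<longleftrightarrow>
      (J 0 = {} \<and> J 2 = {..<dim_row B} \<and> J 1 \<subseteq> {..<dim_row A} \<and> ?P (J 1))" for J
    proof (cases "J 0 = {} \<and> J 2 = {..<dim_row B}")
      case True
      hence "cayley_minor [A, B] J 0 = minor A (J 1) {}"
        "cayley_minor [A, B] J 1 = minor B {..<dim_row B} (J 1)"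
        by (simp_all add: cayley_minor_def minor_def numeral_2_eq_2)
      thus ?thesis using True by (auto simp: less_Suc_eq numeral_2_eq_2)
    qed (auto simp: numeral_2_eq_2)
    thus ?thesis unfolding is_torsion_def sets by simp
  qed
  ultimately show ?thesis by simp
qed

lemma is_torsion_3:
  "is_torsion [A, B, C] \<tau> \<longleftrightarrow> acyclic_complex [A, B, C] \<and>
    (\<exists>I\<subseteq>{..<dim_row A}. \<exists>J\<subseteq>{..<dim_row B}.
      minor A I {} dvd 1 \<and> minor B J I dvd 1 \<and> minor C {..<dim_row C} J dvd 1 \<and>
      (\<tau> * (minor A I {} * minor C {..<dim_row C} J) = minor B J I \<or>
       \<tau> * (minor A I {} * minor C {..<dim_row C} J) = - minor B J I))"
    (is "_ \<longleftrightarrow> _ \<and> (\<exists>I\<subseteq>_. \<exists>J\<subseteq>_. ?P I J)")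
proof -
  have sets: "{k. k < length [A, B, C] \<and> even k} = {0, 2}" "{k. k < length [A, B, C] \<and> odd k} = {1}"
    by (auto simp: less_Suc_eq)
  have "(\<exists>J::nat \<Rightarrow> nat set. J 0 = {} \<and> J 3 = {..<dim_row C} \<and> J 1 \<subseteq> {..<dim_row A} \<and> J 2 \<subseteq> {..<dim_row B} \<and>
        ?P (J 1) (J 2)) \<longleftrightarrow>
      (\<exists>I\<subseteq>{..<dim_row A}. \<exists>J\<subseteq>{..<dim_row B}. ?P I J)"
  proof
    assume "\<exists>I\<subseteq>{..<dim_row A}. \<exists>J\<subseteq>{..<dim_row B}. ?P I J"
    then obtain I J where J: "I \<subseteq> {..<dim_row A}" "J \<subseteq> {..<dim_row B}" "?P I J" by blast
    obtain K :: "nat \<Rightarrow> nat set" where "K 0 = {}" "K 1 = I" "K 2 = J" "K 3 = {..<dim_row C}"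
      by (rule that[of "\<lambda>k. if k = 0 then {} else if k = 1 then I else if k = 2 then J else {..<dim_row C}"])
        simp_all
    thus "\<exists>J::nat \<Rightarrow> nat set. J 0 = {} \<and> J 3 = {..<dim_row C} \<and> J 1 \<subseteq> {..<dim_row A} \<and> J 2 \<subseteq> {..<dim_row B} \<and>
        ?P (J 1) (J 2)"
      using J by - (rule exI[of _ K], simp)
  qed blast
  moreover have "is_torsion [A, B, C] \<tau> \<longleftrightarrow> acyclic_complex [A, B, C] \<and>
      (\<exists>J::nat \<Rightarrow> nat set. J 0 = {} \<and> J 3 = {..<dim_row C} \<and> J 1 \<subseteq> {..<dim_row A} \<and> J 2 \<subseteq> {..<dim_row B} \<and>
        ?P (J 1) (J 2))"
  proof -
    have "(J 0 = {} \<and> J (length [A, B, C]) = {..<dim_row (last [A, B, C])} \<and>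
        (\<forall>i<length [A, B, C]. J (Suc i) \<subseteq> {..<dim_row ([A, B, C] ! i)} \<and> cayley_minor [A, B, C] J i dvd 1) \<and>
        (\<exists>s\<in>{1, -1}. \<tau> * (\<Prod>i\<in>{0, 2}. cayley_minor [A, B, C] J i) =
           s * (\<Prod>i\<in>{1}. cayley_minor [A, B, C] J i))) \<longleftrightarrow>
      (J 0 = {} \<and> J 3 = {..<dim_row C} \<and> J 1 \<subseteq> {..<dim_row A} \<and> J 2 \<subseteq> {..<dim_row B} \<and>
        ?P (J 1) (J 2))" for J
    proof (cases "J 0 = {} \<and> J 3 = {..<dim_row C}")
      case True
      hence "cayley_minor [A, B, C] J 0 = minor A (J 1) {}"
        "cayley_minor [A, B, C] J 1 = minor B (J 2) (J 1)"
        "cayley_minor [A, B, C] J 2 = minor C {..<dim_row C} (J 2)"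
        by (simp_all add: cayley_minor_def minor_def numeral_2_eq_2 numeral_3_eq_3)
      thus ?thesis using True by (auto simp: less_Suc_eq numeral_2_eq_2 numeral_3_eq_3)
    qed (auto simp: numeral_3_eq_3)
    thus ?thesis unfolding is_torsion_def sets by simp
  qed
  ultimately show ?thesis by simp
qed

section \<open>The two torsions\<close>

text \<open>D^0 has only two nonzero rows, so there is a single admissible choice; its minors are
  \<open>- (x * x)\<close> and \<open>i * n + m\<close>.\<close>

lemma torsion_complex1:
  fixes x i m n :: "'a::comm_ring_1"
  assumes x: "x dvd 1" and \<Delta>: "i * n + m dvd 1"
  shows "is_torsion [list_mat 2 [[0, x], [0, 0], [0, 0], [x, 0]], list_mat 4 [[0, i, -1, 0], [0, m, n, 0]]] \<tau> \<longleftrightarrow>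
    \<tau> * x\<^sup>2 = i * n + m \<or> \<tau> * x\<^sup>2 = - (i * n + m)"
proof -
  let ?as = "[[0, x], [0, 0], [0, 0], [x, 0]]" and ?bs = "[[0, i, -1, 0], [0, m, n, 0]]"
  let ?A = "list_mat 2 ?as" and ?B = "list_mat 4 ?bs"
  obtain y where y: "1 = x * y" using x by (rule dvdE)
  obtain e where e: "1 = (i * n + m) * e" using \<Delta> by (rule dvdE)
  have y': "x * (y * a) = a" for a by (simp flip: mult.assoc y)
  have e': "(i * n + m) * (e * a) = a" for a by (simp flip: mult.assoc e)
  have 1: "mat_kernel ?A = {0\<^sub>v (dim_col ?A)}"
  proof (rule injective_list_mat)
    fix w :: "'a list" assume "length w = 2"
    then obtain a b where "w = [a, b]" by (auto simp: length_eq_numeral_conv)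
    thus "apply_rows ?as w = replicate (length ?as) 0 \<longleftrightarrow> w = replicate 2 0"
      by (auto simp: apply_rows_def unit_cancel_0[OF x] numeral_2_eq_2)
  qed simp
  have 2: "mat_kernel ?B = mat_image ?A"
  proof (rule exact_list_mat)
    fix w :: "'a list" assume "length w = 2"
    then obtain a b where "w = [a, b]" by (auto simp: length_eq_numeral_conv)
    thus "apply_rows ?bs (apply_rows ?as w) = replicate (length ?bs) 0"
      by (simp add: apply_rows_def)
  next
    fix xs assume "length xs = 4" and ker: "apply_rows ?bs xs = replicate (length ?bs) 0"
    then obtain a b c d where xs: "xs = [a, b, c, d]" by (auto simp: length_eq_numeral_conv)
    have c: "c = i * b" and 1: "m * b + n * c = 0"
      using ker by (simp_all add: xs apply_rows_def)
    have "(i * n + m) * b = m * b + n * c" by (simp add: c algebra_simps)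
    hence b: "b = 0" using 1 unit_cancel_0[OF \<Delta>] by simp
    have "apply_rows ?as [y * d, y * a] = xs"
      by (simp add: apply_rows_def xs y' c b)
    thus "\<exists>w. length w = 2 \<and> apply_rows ?as w = xs" by (intro exI[of _ "[y * d, y * a]"]) simp
  qed simp_all
  have 3: "mat_image ?B = carrier_vec (dim_row ?B)"
  proof (rule surjective_list_mat)
    fix ys :: "'a list" assume "length ys = length ?bs"
    then obtain a b where ys: "ys = [a, b]" by (auto simp: length_Suc_conv)
    \<comment> \<open>Solves for the second coordinate of a preimage whose outer coordinates are 0;
      the first row then fixes the third one.\<close>
    define u where "u = e * (n * a + b)"
    have u: "(i * n + m) * u = n * a + b" unfolding u_def by (rule e')
    have "m * u + n * (i * u - a) = (i * n + m) * u - n * a" by (simp add: algebra_simps)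
    hence "m * u + n * (i * u - a) = b" unfolding u by simp
    hence "apply_rows ?bs [0, u, i * u - a, 0] = ys"
      by (simp add: apply_rows_def ys)
    thus "\<exists>xs. length xs = 4 \<and> apply_rows ?bs xs = ys" by (intro exI[of _ "[0, u, i * u - a, 0]"]) simp
  qed simp
  have acyclic: "acyclic_complex [?A, ?B]"
    unfolding acyclic_complex_def using 1 2 3 by simp
  have dims: "dim_row ?A = 4" "dim_row ?B = 2" by simp_all
  have two: "{..<2::nat} = {0, 1}" by auto
  have "{..<4} - {0, 3} = {1, 2::nat}" by auto
  hence minors: "minor ?A {0, 3} {} = - (x * x)" "minor ?B {..<2} {0, 3} = i * n + m"
    by (simp_all add: minor_def two submatrix_m2 det_m2)
  have J: "J = {0, 3}" if J: "J \<subseteq> {..<4}" "minor ?A J {} dvd 1" for J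
  proof -
    have unit: "det (submatrix ?A J {..<dim_col ?A}) dvd 1" using J(2) by (simp add: minor_def)
    have "r \<notin> J" if "r = 1 \<or> r = 2" for r
    proof (rule unit_minor_row[OF unit])
      show "r < dim_row ?A" using that by auto
      fix c assume "c < dim_col ?A"
      hence "c = 0 \<or> c = 1" by auto
      thus "?A $$ (r, c) = 0" using that by auto
    qed simp
    moreover have "k = 0 \<or> k = 1 \<or> k = 2 \<or> k = 3" if "k \<in> J" for k using J(1) that by auto
    ultimately have "J \<subseteq> {0, 3}" by blast
    moreover have "card J = card {..<dim_col ?A}"
    proof (rule unit_minor_card[OF unit])
      show "J \<subseteq> {..<dim_row ?A}" using J(1) by (simp only: dims)
    qed simp
    hence "card J = card {0, 3::nat}" by simp
    ultimately show ?thesis by (intro card_subset_eq) auto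
  qed
  have xx: "x * x dvd 1" using mult_dvd_mono[OF x x] by simp
  have neg: "a = - b \<longleftrightarrow> - a = b" for a b :: 'a by auto
  have "is_torsion [?A, ?B] \<tau> \<longleftrightarrow> (\<tau> * - (x * x) = i * n + m \<or> \<tau> * - (x * x) = - (i * n + m))"
  proof -
    have "(\<exists>J\<subseteq>{..<4}. minor ?A J {} dvd 1 \<and> minor ?B {..<2} J dvd 1 \<and>
      (\<tau> * minor ?A J {} = minor ?B {..<2} J \<or> \<tau> * minor ?A J {} = - minor ?B {..<2} J)) \<longleftrightarrow>
      (\<tau> * minor ?A {0, 3} {} = minor ?B {..<2} {0, 3} \<or> \<tau> * minor ?A {0, 3} {} = - minor ?B {..<2} {0, 3})"
      (is "?L \<longleftrightarrow> ?R")
    proof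
      assume ?L
      thus ?R using J by blast
    next
      assume ?R
      moreover have "minor ?A {0, 3} {} dvd 1 \<and> minor ?B {..<2} {0, 3} dvd 1"
        unfolding minors using xx \<Delta> by simp
      moreover have "{0, 3} \<subseteq> {..<4::nat}" by simp
      ultimately show ?L by blast
    qed
    thus ?thesis unfolding is_torsion_2 dims minors using acyclic by blast
  qed
  also have "\<dots> \<longleftrightarrow> - (\<tau> * x\<^sup>2) = i * n + m \<or> - (\<tau> * x\<^sup>2) = - (i * n + m)"
    by (simp add: power2_eq_square)
  also have "\<dots> \<longleftrightarrow> \<tau> * x\<^sup>2 = i * n + m \<or> \<tau> * x\<^sup>2 = - (i * n + m)"
    unfolding neg_equal_iff_equal neg[of "\<tau> * x\<^sup>2", symmetric] by blast
  finally show ?thesis .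
qed


section \<open>Equality up to sign and the torsion of the mapping cone\<close>

definition eq_up_to_sign :: "'a::comm_ring_1 \<Rightarrow> 'a \<Rightarrow> bool" (infix "=\<^sub>\<plusminus>" 50) where
  "a =\<^sub>\<plusminus> b \<longleftrightarrow> a = b \<or> a = - b"

lemma eq_up_to_sign_trans [trans]: "a =\<^sub>\<plusminus> b \<Longrightarrow> b =\<^sub>\<plusminus> c \<Longrightarrow> a =\<^sub>\<plusminus> c"
  by (auto simp: eq_up_to_sign_def)

lemma eq_up_to_sign_sym: "a =\<^sub>\<plusminus> b \<Longrightarrow> b =\<^sub>\<plusminus> a"
  by (auto simp: eq_up_to_sign_def)

lemma eq_up_to_sign_mult: "a =\<^sub>\<plusminus> b \<Longrightarrow> c * a =\<^sub>\<plusminus> c * b"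
  by (auto simp: eq_up_to_sign_def)

lemma eq_up_to_sign_cong: "a =\<^sub>\<plusminus> b \<Longrightarrow> c =\<^sub>\<plusminus> d \<Longrightarrow> a =\<^sub>\<plusminus> c \<longleftrightarrow> b =\<^sub>\<plusminus> d"
  by (blast intro: eq_up_to_sign_trans eq_up_to_sign_sym)

lemma eq_up_to_sign_refl: "a =\<^sub>\<plusminus> a"
  by (simp add: eq_up_to_sign_def)

lemma eq_up_to_sign_cancel: "c dvd 1 \<Longrightarrow> c * a =\<^sub>\<plusminus> c * b \<longleftrightarrow> a =\<^sub>\<plusminus> b"
  using unit_cancel[of c a b] unit_cancel[of c a "- b"] by (auto simp: eq_up_to_sign_def)

lemma eq_up_to_sign_dvd_1: "a =\<^sub>\<plusminus> b \<Longrightarrow> b dvd 1 \<Longrightarrow> a dvd 1"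
  by (auto simp: eq_up_to_sign_def)

text \<open>An admissible choice omits one nonzero row j of D^0 and one row m of the second map at
  which \<open>f2\<close> has a unit coefficient. The factors depending on j and m cancel in the
  quotient, so all choices give the same torsion.\<close>

lemma torsion_cone2:
  fixes x \<kappa> t s b2 b3 c2 c3 n0 n1 n2 :: "'a::comm_ring_1"
  assumes x: "x dvd 1" and \<kappa>: "2 * \<kappa> = 1" and t: "t dvd 1" and n2: "n2 dvd 1"
    and rel: "n1 * t + n2 * s = 0" "n0 + n1 * b2 + n2 * c2 = 0" "- n0 + n1 * b3 + n2 * c3 = 0"
  shows "is_torsion
     [list_mat 3 [[0, - x, - (x * x)], [0, 0, 2 * x], [0, 0, 0], [0, 0, 0], [- 2 * x, 0, 0], [- (x * x), x, 0]],
      list_mat 6 [[0, 0, 1, -1, 0, 0], [t, \<kappa> * x * t, b2, b3, - \<kappa> * x * t, t],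
        [s, \<kappa> * x * s, c2, c3, - \<kappa> * x * s, s], [0, 0, 1, 0, 0, 0]],
      list_mat 4 [[n0, n1, n2, 0]]] \<tau> \<longleftrightarrow>
    \<tau> * (4 * x ^ 3 * n2) = t \<or> \<tau> * (4 * x ^ 3 * n2) = - t"
proof -
  let ?as = "[[0, - x, - (x * x)], [0, 0, 2 * x], [0, 0, 0], [0, 0, 0], [- 2 * x, 0, 0], [- (x * x), x, 0]]"
  let ?bs = "[[0, 0, 1, -1, 0, 0], [t, \<kappa> * x * t, b2, b3, - \<kappa> * x * t, t],
        [s, \<kappa> * x * s, c2, c3, - \<kappa> * x * s, s], [0, 0, 1, 0, 0, 0]]"
  let ?cs = "[[n0, n1, n2, 0]]"
  let ?A = "list_mat 3 ?as" and ?B = "list_mat 6 ?bs" and ?C = "list_mat 4 ?cs"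
  obtain y where y: "1 = x * y" using x by (rule dvdE)
  obtain y' where y': "1 = t * y'" using t by (rule dvdE)
  obtain y'' where y'': "1 = n2 * y''" using n2 by (rule dvdE)
  have two: "2 dvd (1::'a)" using \<kappa> by (metis dvdI)
  have k: "\<kappa> dvd 1" using \<kappa> by (metis dvdI mult.commute)
  have kk: "2 * (\<kappa> * a) = a" for a using \<kappa> by (simp flip: mult.assoc)
  have xy: "x * (y * a) = a" for a by (simp flip: mult.assoc y)
  have xk: "x * (\<kappa> * z) = \<kappa> * (x * z)" for z by (rule mult.left_commute)
  have ty: "t * (y' * a) = a" for a by (simp flip: mult.assoc y')
  have ny: "n2 * (y'' * a) = a" for a by (simp flip: mult.assoc y'')
  have 1: "mat_kernel ?A = {0\<^sub>v (dim_col ?A)}"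
  proof (rule injective_list_mat)
    fix w :: "'a list" assume "length w = 3"
    then obtain a b c where "w = [a, b, c]" by (auto simp: length_eq_numeral_conv)
    thus "apply_rows ?as w = replicate (length ?as) 0 \<longleftrightarrow> w = replicate 3 0"
      by (auto simp: apply_rows_def mult.assoc unit_cancel_0[OF x] unit_cancel_0[OF two] numeral_3_eq_3)
  qed simp
  have 2: "mat_kernel ?B = mat_image ?A"
  proof (rule exact_list_mat)
    fix w :: "'a list" assume "length w = 3"
    then obtain a b c where w: "w = [a, b, c]" by (auto simp: length_eq_numeral_conv)
    \<comment> \<open>Rows 1 and 2 of the second map contain the multiples by t and by s of the same
      linear form, which D^0 kills because 2 times kappa is 1.\<close>
    have z: "z * (- x * b - x * x * c) + \<kappa> * x * z * (2 * x * c) + - \<kappa> * x * z * (- 2 * x * a) +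
        z * (- (x * x) * a + x * b) = 0" for z
    proof -
      have "z * (- x * b - x * x * c) + \<kappa> * x * z * (2 * x * c) + - \<kappa> * x * z * (- 2 * x * a) +
        z * (- (x * x) * a + x * b) = (2 * \<kappa> - 1) * (z * x * x * (a + c))"
        by (simp add: algebra_simps)
      thus ?thesis by (simp add: \<kappa>)
    qed
    show "apply_rows ?bs (apply_rows ?as w) = replicate (length ?bs) 0"
      using z[of t] z[of s] by (simp add: apply_rows_def w algebra_simps)
  next
    fix xs assume "length xs = 6" and ker: "apply_rows ?bs xs = replicate (length ?bs) 0"
    then obtain v0 v1 v2 v3 v4 v5 where xs: "xs = [v0, v1, v2, v3, v4, v5]"
      by (auto simp: length_eq_numeral_conv)
    have v2: "v2 = 0" and v3: "v3 = 0" using ker by (auto simp: xs apply_rows_def)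
    have "t * (v0 + \<kappa> * x * v1 - \<kappa> * x * v4 + v5) = 0"
      using ker by (simp add: xs apply_rows_def v2 v3 algebra_simps)
    hence v5: "v5 = \<kappa> * x * v4 - v0 - \<kappa> * x * v1"
      unfolding unit_cancel_0[OF t] by (simp add: algebra_simps add_eq_0_iff)
    \<comment> \<open>Rows 0, 1 and 4 of D^0 determine the preimage; row 5 is then satisfied by
      \<open>v5\<close>.\<close>
    define a c b where "a = - (\<kappa> * (y * v4))" and "c = \<kappa> * (y * v1)" and "b = - (y * v0) - x * c"
    have xc: "x * c = \<kappa> * v1" and xa: "x * a = - (\<kappa> * v4)" and xb: "x * b = - v0 - x * (x * c)"
      by (simp_all add: a_def c_def b_def xk xy right_diff_distrib)
    have "- x * b + - (x * x) * c = v0" by (simp add: xb mult.assoc)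
    moreover have "2 * x * c = v1" "- 2 * x * a = v4" by (simp_all add: mult.assoc xc xa kk)
    moreover have "- (x * x) * a + x * b = v5"
      by (simp add: mult.assoc xa xb xc v5 xk)
    ultimately have "apply_rows ?as [a, b, c] = xs"
      by (simp add: apply_rows_def xs v2 v3)
    thus "\<exists>w. length w = 3 \<and> apply_rows ?as w = xs" by (intro exI[of _ "[a, b, c]"]) simp
  qed simp_all
  have c2: "n2 * c2 = - n0 - n1 * b2" and c3: "n2 * c3 = n0 - n1 * b3" and s: "n2 * s = - (n1 * t)"
    using rel by (simp_all add: algebra_simps add_eq_0_iff)
  have 3: "mat_kernel ?C = mat_image ?B"
  proof (rule exact_list_mat)
    fix w :: "'a list" assume "length w = 6"
    then obtain v0 v1 v2 v3 v4 v5 where w: "w = [v0, v1, v2, v3, v4, v5]"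
      by (auto simp: length_eq_numeral_conv)
    let ?z1 = "t * v0 + \<kappa> * x * t * v1 + b2 * v2 + b3 * v3 + - \<kappa> * x * t * v4 + t * v5"
    let ?z2 = "s * v0 + \<kappa> * x * s * v1 + c2 * v2 + c3 * v3 + - \<kappa> * x * s * v4 + s * v5"
    have "n0 * (v2 - v3) + n1 * ?z1 + n2 * ?z2 = (n1 * t + n2 * s) * (v0 + \<kappa> * x * v1 - \<kappa> * x * v4 + v5) +
       (n0 + n1 * b2 + n2 * c2) * v2 + (- n0 + n1 * b3 + n2 * c3) * v3"
      by (simp add: algebra_simps)
    hence "n0 * (v2 - v3) + n1 * ?z1 + n2 * ?z2 = 0" unfolding rel by simp
    thus "apply_rows ?cs (apply_rows ?bs w) = replicate (length ?cs) 0"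
      by (simp add: apply_rows_def w algebra_simps)
  next
    fix zs assume "length zs = 4" and ker: "apply_rows ?cs zs = replicate (length ?cs) 0"
    then obtain z0 z1 z2 z3 where zs: "zs = [z0, z1, z2, z3]"
      by (auto simp: length_eq_numeral_conv)
    have z2: "n0 * z0 + n1 * z1 + n2 * z2 = 0" using ker by (simp add: zs apply_rows_def add.assoc)
    \<comment> \<open>A preimage with coordinates 0, 1 and 4 equal to 0. Rows 3, 0 and 1 determine
      the rest; row 2 follows from the vanishing of \<open>?cs\<close> on \<open>zs\<close>, as
      \<open>n2\<close> is a unit.\<close>
    define w3 w5 where "w3 = z3 - z0" and "w5 = y' * (z1 - b2 * z3 - b3 * w3)"
    have w5: "t * w5 = z1 - b2 * z3 - b3 * w3" unfolding w5_def by (rule ty)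
    have "n2 * (c2 * z3 + c3 * w3 + s * w5) = (n2 * c2) * z3 + (n2 * c3) * w3 + (n2 * s) * w5"
      by (simp add: algebra_simps)
    also have "\<dots> = (- n0 - n1 * b2) * z3 + (n0 - n1 * b3) * w3 - n1 * (t * w5)"
      unfolding c2 c3 s by (simp add: algebra_simps)
    also have "\<dots> = - (n0 * z0 + n1 * z1)" unfolding w5 w3_def by (simp add: algebra_simps)
    also have "\<dots> = n2 * z2" using z2 by (simp add: add_eq_0_iff)
    finally have z2: "c2 * z3 + c3 * w3 + s * w5 = z2" by (simp add: unit_cancel[OF n2])
    have "apply_rows ?bs [0, 0, z3, w3, 0, w5] = zs"
      using w5 z2 by (simp add: apply_rows_def zs w3_def algebra_simps)
    thus "\<exists>w. length w = 6 \<and> apply_rows ?bs w = zs" by (intro exI[of _ "[0, 0, z3, w3, 0, w5]"]) simp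
  qed simp_all
  have 4: "mat_image ?C = carrier_vec (dim_row ?C)"
  proof (rule surjective_list_mat)
    fix ys :: "'a list" assume "length ys = length ?cs"
    then obtain a where ys: "ys = [a]" by (auto simp: length_Suc_conv)
    have "apply_rows ?cs [0, 0, y'' * a, 0] = ys"
      by (simp add: apply_rows_def ys ny)
    thus "\<exists>xs. length xs = 4 \<and> apply_rows ?cs xs = ys" by (intro exI[of _ "[0, 0, y'' * a, 0]"]) simp
  qed simp
  have acyclic: "acyclic_complex [?A, ?B, ?C]"
    unfolding acyclic_complex_def using 1 2 3 4 by (simp add: less_Suc_eq)
  have dims: "dim_row ?A = 6" "dim_row ?B = 4" "dim_row ?C = 1" by simp_all
  \<comment> \<open>Columns 0, 1, 4, 5 of the second map are multiples of one column, up to sign by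
    the factors \<open>cf j\<close>. Then \<open>E m\<close> is, up to sign, the minor without row m
    on this column and columns 2 and 3; \<open>nn\<close> lists the coefficients of
    \<open>f2\<close>.\<close>
  define cf where "cf j = (if j = 1 \<or> j = 4 then \<kappa> * x else 1)" for j :: nat
  define nn where "nn m = (if m = 0 then n0 else if m = 1 then n1 else n2)" for m :: nat
  define E where "E m = (if m = 0 then b3 * s - t * c3 else if m = 1 then s else t)" for m :: nat
  define I where "I j = {0, 1, 4, 5} - {j}" for j :: nat
  have cf: "cf j dvd 1" for j
    using mult_dvd_mono[OF k x] by (simp add: cf_def)
  have range: "{..<3} = {0, 1, 2::nat}" by auto
  have I: "I 0 = {1, 4, 5}" "I (Suc 0) = {0, 4, 5}" "I 4 = {0, 1, 5}" "I 5 = {0, 1, 4}"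
    by (auto simp: I_def)
  have I': "{..<6} - I 0 = {0, 2, 3}" "{..<6} - I (Suc 0) = {1, 2, 3}" "{..<6} - I 4 = {2, 3, 4}"
    "{..<6} - I 5 = {2, 3, 5}"
    by (auto simp: I_def)
  have J': "{..<4} - {0} = {1, 2, 3::nat}" "{..<4} - {Suc 0} = {0, 2, 3::nat}" "{..<4} - {2} = {0, 1, 3::nat}"
    "{..<4} - {3} = {0, 1, 2::nat}"
    by auto
  have minor_A: "minor ?A (I j) {} =\<^sub>\<plusminus> 4 * x ^ 3 * cf j" if "j = 0 \<or> j = 1 \<or> j = 4 \<or> j = 5" for j
  proof -
    have "4 * x ^ 3 * (\<kappa> * x) = 2 * (2 * \<kappa>) * x ^ 4" by (simp add: algebra_simps numeral_eq_Suc)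
    hence half: "4 * x ^ 3 * (\<kappa> * x) = 2 * x ^ 4" by (simp add: \<kappa>)
    have "minor ?A (I 0) {} = - (4 * x ^ 3)" "minor ?A (I 1) {} = 2 * x ^ 4"
      "minor ?A (I 4) {} = 2 * x ^ 4" "minor ?A (I 5) {} = 4 * x ^ 3"
      by (simp_all add: minor_def I range submatrix_m3 det_m3 algebra_simps power3_eq_cube power4_eq_xxxx)
    thus ?thesis using that half by (auto simp: eq_up_to_sign_def cf_def)
  qed
  have minor_B: "minor ?B ({..<4} - {m}) (I j) =\<^sub>\<plusminus> cf j * E m"
    if "j = 0 \<or> j = 1 \<or> j = 4 \<or> j = 5" "m = 0 \<or> m = 1 \<or> m = 2" for j m
    using that
    by (elim disjE; hypsubst; simp add: minor_def I' J' submatrix_m3 det_m3 eq_up_to_sign_def cf_def E_def algebra_simps)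
  have entry: "minor ?C {..<1} ({..<4} - {m}) = ?C $$ (0, m)" if "m < 4" for m
  proof -
    have sets: "{..<1::nat} = {0}" "{..<4} - ({..<4} - {m}) = {m}" using that by auto
    show ?thesis unfolding minor_def list_mat_dims sets using that by (intro det_submatrix_1) simp_all
  qed
  have minor_C: "minor ?C {..<1} ({..<4} - {m}) = nn m" if "m = 0 \<or> m = 1 \<or> m = 2" for m
    using that by (elim disjE; hypsubst; subst entry; simp add: nn_def)
  have minor_C3: "minor ?C {..<1} ({..<4} - {3}) = 0"
    by (subst entry) simp_all
  \<comment> \<open>The composite with \<open>f2\<close> is zero, so the maximal minors of the
    second map are proportional to the coefficients of \<open>f2\<close>.\<close>
  have E: "n2 * E m =\<^sub>\<plusminus> nn m * t" if "m = 0 \<or> m = 1 \<or> m = 2" for m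
  proof -
    have "n2 * (b3 * s - t * c3) = b3 * (n2 * s) - t * (n2 * c3)" by (simp add: algebra_simps)
    also have "\<dots> = - (n0 * t)" unfolding s c3 by (simp add: algebra_simps)
    finally show ?thesis using that s by (auto simp: E_def nn_def eq_up_to_sign_def mult.commute)
  qed
  have main: "\<tau> * (minor ?A (I j) {} * minor ?C {..<1} ({..<4} - {m})) =\<^sub>\<plusminus> minor ?B ({..<4} - {m}) (I j) \<longleftrightarrow>
      \<tau> * (4 * x ^ 3 * n2) =\<^sub>\<plusminus> t"
    if jm: "j = 0 \<or> j = 1 \<or> j = 4 \<or> j = 5" "m = 0 \<or> m = 1 \<or> m = 2" and u: "nn m dvd 1" for j m
  proof -
    let ?a = "4 * x ^ 3"
    have lhs: "\<tau> * (minor ?A (I j) {} * minor ?C {..<1} ({..<4} - {m})) =\<^sub>\<plusminus> cf j * (\<tau> * ?a * nn m)"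
      using eq_up_to_sign_mult[OF minor_A[OF jm(1)], of "\<tau> * nn m"] by (simp only: minor_C[OF jm(2)] ac_simps)
    have "\<tau> * (minor ?A (I j) {} * minor ?C {..<1} ({..<4} - {m})) =\<^sub>\<plusminus> minor ?B ({..<4} - {m}) (I j) \<longleftrightarrow>
        cf j * (\<tau> * ?a * nn m) =\<^sub>\<plusminus> cf j * E m"
      by (rule eq_up_to_sign_cong[OF lhs minor_B[OF jm]])
    also have "\<dots> \<longleftrightarrow> n2 * (\<tau> * ?a * nn m) =\<^sub>\<plusminus> n2 * E m"
      by (simp only: eq_up_to_sign_cancel[OF cf] eq_up_to_sign_cancel[OF n2])
    also have "n2 * (\<tau> * ?a * nn m) = nn m * (\<tau> * (?a * n2))" by (simp only: ac_simps)
    also have "\<dots> =\<^sub>\<plusminus> n2 * E m \<longleftrightarrow> \<dots> =\<^sub>\<plusminus> nn m * t"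
      by (rule eq_up_to_sign_cong[OF eq_up_to_sign_refl E[OF jm(2)]])
    also have "\<dots> \<longleftrightarrow> \<tau> * (?a * n2) =\<^sub>\<plusminus> t"
      by (rule eq_up_to_sign_cancel[OF u])
    finally show ?thesis .
  qed
  have rows: "\<exists>j. (j = 0 \<or> j = 1 \<or> j = 4 \<or> j = 5) \<and> K = I j" if K: "K \<subseteq> {..<6}" "minor ?A K {} dvd 1" for K
  proof -
    have unit: "det (submatrix ?A K {..<dim_col ?A}) dvd 1" using K(2) by (simp add: minor_def)
    have "r \<notin> K" if "r = 2 \<or> r = 3" for r
    proof (rule unit_minor_row[OF unit])
      show "r < dim_row ?A" using that by auto
      fix c assume "c < dim_col ?A"
      hence "c = 0 \<or> c = 1 \<or> c = 2" by auto
      thus "?A $$ (r, c) = 0" using that by auto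
    qed simp
    moreover have "k = 0 \<or> k = 1 \<or> k = 2 \<or> k = 3 \<or> k = 4 \<or> k = 5" if "k \<in> K" for k using K(1) that by auto
    ultimately have sub: "K \<subseteq> {0, 1, 4, 5}" by blast
    have "card K = card {..<dim_col ?A}"
    proof (rule unit_minor_card[OF unit])
      show "K \<subseteq> {..<dim_row ?A}" using K(1) by (simp only: dims)
    qed simp
    hence card: "card K = 3" by simp
    have "card ({0, 1, 4, 5} - K) = card {0, 1, 4, 5::nat} - card K"
      using sub by (intro card_Diff_subset finite_subset[OF sub]) simp_all
    hence "card ({0, 1, 4, 5} - K) = 1" unfolding card by simp
    then obtain j where "{0, 1, 4, 5} - K = {j}" by (rule card_1_singletonE)
    hence "K = I j" "j \<in> {0, 1, 4, 5}" using sub unfolding I_def by blast+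
    thus ?thesis by blast
  qed
  have cols: "\<exists>m. (m = 0 \<or> m = 1 \<or> m = 2) \<and> J = {..<4} - {m}"
    if J: "J \<subseteq> {..<4}" "minor ?B J (I j) dvd 1" "minor ?C {..<1} J dvd 1" and j: "j = 0 \<or> j = 1 \<or> j = 4 \<or> j = 5"
    for J j
  proof -
    have "card J = card ({..<6} - I j)"
      using J(2) unfolding minor_def list_mat_dims
    proof (rule unit_minor_card)
      show "J \<subseteq> {..<dim_row ?B}" using J(1) by (simp only: dims)
    next
      show "{..<6} - I j \<subseteq> {..<dim_col ?B}" unfolding list_mat_dims by blast
    qed
    also have "\<dots> = 3" using j by (elim disjE; hypsubst; simp add: I')
    finally have "card J = 3" .
    moreover have four: "Suc 3 = 4" by simp
    ultimately obtain m where m: "m < 4" "J = {..<4} - {m}"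
      using subset_lessThan_minus_one[of J 3] J(1) unfolding four by blast
    have "m \<noteq> 3"
    proof
      assume "m = 3"
      \<comment> \<open>Omitting the row of \<open>f1\<close> would leave the zero column of the
        last map.\<close>
      hence "minor ?C {..<1} J = 0" using minor_C3 m(2) by (simp only:)
      thus False using J(3) by simp
    qed
    hence "m = 0 \<or> m = 1 \<or> m = 2" using m(1) by linarith
    thus ?thesis using m(2) by blast
  qed
  have "is_torsion [?A, ?B, ?C] \<tau> \<longleftrightarrow> \<tau> * (4 * x ^ 3 * n2) =\<^sub>\<plusminus> t"
    unfolding is_torsion_3 dims eq_up_to_sign_def[symmetric]
  proof
    assume "acyclic_complex [?A, ?B, ?C] \<and> (\<exists>I\<subseteq>{..<6}. \<exists>J\<subseteq>{..<4}.
      minor ?A I {} dvd 1 \<and> minor ?B J I dvd 1 \<and> minor ?C {..<1} J dvd 1 \<and>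
      \<tau> * (minor ?A I {} * minor ?C {..<1} J) =\<^sub>\<plusminus> minor ?B J I)"
    then obtain K J where K: "K \<subseteq> {..<6}" "minor ?A K {} dvd 1" and J: "J \<subseteq> {..<4}" "minor ?B J K dvd 1"
      "minor ?C {..<1} J dvd 1" and eq: "\<tau> * (minor ?A K {} * minor ?C {..<1} J) =\<^sub>\<plusminus> minor ?B J K"
      by blast
    obtain j where j: "j = 0 \<or> j = 1 \<or> j = 4 \<or> j = 5" "K = I j" using rows[OF K] by blast
    obtain m where m: "m = 0 \<or> m = 1 \<or> m = 2" "J = {..<4} - {m}"
      using cols[OF J(1) _ J(3) j(1)] J(2) j(2) by blast
    have "nn m dvd 1" using J(3) minor_C[OF m(1)] m(2) by simp
    thus "\<tau> * (4 * x ^ 3 * n2) =\<^sub>\<plusminus> t" using main[OF j(1) m(1)] eq unfolding j(2) m(2) by blast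
  next
    assume eq: "\<tau> * (4 * x ^ 3 * n2) =\<^sub>\<plusminus> t"
    \<comment> \<open>For existence, omit row 5 of D^0 and row 2 of the second map; there all three
      minors are units.\<close>
    have "nn 2 = n2" "cf 5 = 1" "E 2 = t" by (simp_all add: nn_def cf_def E_def)
    have "4 * x ^ 3 dvd 1"
      using mult_dvd_mono[OF mult_dvd_mono[OF two two] mult_dvd_mono[OF x mult_dvd_mono[OF x x]]]
      by (simp add: power3_eq_cube mult.assoc)
    hence u1: "minor ?A (I 5) {} dvd 1"
      using minor_A[of 5] \<open>cf 5 = 1\<close> by (auto intro: eq_up_to_sign_dvd_1)
    have u2: "minor ?B ({..<4} - {2}) (I 5) dvd 1"
      using minor_B[of 5 2] t \<open>cf 5 = 1\<close> \<open>E 2 = t\<close> by (auto intro: eq_up_to_sign_dvd_1)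
    have u3: "minor ?C {..<1} ({..<4} - {2}) dvd 1" using minor_C[of 2] n2 \<open>nn 2 = n2\<close> by simp
    have "\<tau> * (minor ?A (I 5) {} * minor ?C {..<1} ({..<4} - {2})) =\<^sub>\<plusminus> minor ?B ({..<4} - {2}) (I 5)"
      using main[of 5 2] eq n2 \<open>nn 2 = n2\<close> by simp
    moreover have "I 5 \<subseteq> {..<6}" "{..<4} - {2} \<subseteq> {..<4::nat}" by (auto simp: I_def)
    ultimately show "acyclic_complex [?A, ?B, ?C] \<and> (\<exists>I\<subseteq>{..<6}. \<exists>J\<subseteq>{..<4}.
      minor ?A I {} dvd 1 \<and> minor ?B J I dvd 1 \<and> minor ?C {..<1} J dvd 1 \<and>
      \<tau> * (minor ?A I {} * minor ?C {..<1} J) =\<^sub>\<plusminus> minor ?B J I)"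
      using acyclic u1 u2 u3 by blast
  qed
  thus ?thesis by (simp only: eq_up_to_sign_def)
qed

section \<open>The two complexes of the knot as explicit matrices\<close>

lemma append_rows_list_mat: "list_mat n rs @\<^sub>r list_mat n rs' = list_mat n (rs @ rs')"
  by (rule eq_matI) (auto simp: append_rows_def nth_append mat_of_rows_list_def)

lemma hconcat_list_mat:
  assumes "length rs = length rs'" "\<forall>r\<in>set rs. length r = n"
  shows "hconcat (list_mat n rs) (list_mat n' rs') = list_mat (n + n') (map2 (@) rs rs')"
  using assms by (intro eq_matI) (auto simp: hconcat_def nth_append mat_of_rows_list_def)

lemma zero_list_mat: "0\<^sub>m (Suc 0) (Suc 0) = list_mat (Suc 0) [[0]]" "0\<^sub>m (Suc 0) 3 = list_mat 3 [[0, 0, 0]]"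
  by (auto simp: mat_of_rows_list_def less_Suc_eq numeral_eq_Suc intro!: eq_matI)

context two_bridge
begin

lemma complex1_list_mat:
  assumes "rho1.D x gu (tb_r p q) = m2 0 \<iota> 0 m" "rho1.D x gv (tb_r p q) = m2 (-1) 0 n 0"
  shows "complex1 p q x = [list_mat 2 [[0, x], [0, 0], [0, 0], [x, 0]], list_mat 4 [[0, \<iota>, -1, 0], [0, m, n, 0]]]"
proof -
  have "D0 2 (rho1 x) = m2 0 x 0 0 @\<^sub>r m2 0 0 x 0"
    by (simp add: D0_def rho1_Cons one_m2)
  moreover have "D1 p q 2 (rho1 x) = hconcat (m2 0 \<iota> 0 m) (m2 (-1) 0 n 0)"
    using assms by (simp add: D1_def rho1.D_def)
  ultimately show ?thesis
    by (simp add: complex1_def m2_def append_rows_list_mat hconcat_list_mat)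
qed

lemma cone2_list_mat:
  assumes "rho2.D gu (tb_r p q) = m3 a0 a1 a2 a3 a4 a5 a6 a7 a8"
    "rho2.D gv (tb_r p q) = m3 b0 b1 b2 b3 b4 b5 b6 b7 b8"
    and "f2 p q \<kappa> x = list_mat 3 [[n0, n1, n2]]"
  shows "cone2 p q \<kappa> x =
     [list_mat 3 [[0, - x, - (x * x)], [0, 0, 2 * x], [0, 0, 0], [0, 0, 0], [- 2 * x, 0, 0], [- (x * x), x, 0]],
      list_mat 6 [[a0, a1, a2, b0, b1, b2], [a3, a4, a5, b3, b4, b5], [a6, a7, a8, b6, b7, b8], [0, 0, 1, 0, 0, 0]],
      list_mat 4 [[n0, n1, n2, 0]]]"
proof -
  have "D0 3 (rho2 \<kappa> x) = m3 0 (- x) (- (x * x)) 0 0 (2 * x) 0 0 0 @\<^sub>r m3 0 0 0 (- 2 * x) 0 0 (- (x * x)) x 0"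
    by (simp add: D0_def rho2_sym2 rho1_Cons one_m2 sym2_m2 one_m3)
  moreover have "D1 p q 3 (rho2 \<kappa> x) = hconcat (m3 a0 a1 a2 a3 a4 a5 a6 a7 a8) (m3 b0 b1 b2 b3 b4 b5 b6 b7 b8)"
    using assms(1,2) by (simp add: D1_def rho2.D_def)
  ultimately show ?thesis
    by (simp add: cone2_def m3_def f1_def pair_E_list_mat assms(3) zero_list_mat append_rows_list_mat hconcat_list_mat)
qed

end

text \<open>V is only a ring, so each quotient is expressed by saying that its denominator is a unit
  and that the torsion times the denominator is the numerator up to sign. Since such a value exists,
  the equivalences include acyclicity and independence of the chosen minors.\<close>

theorem theorem1:
  fixes p q l :: nat
    and \<pi> :: "rat poly \<Rightarrow> 'a::comm_ring_1"
    and x \<Omega> \<kappa> P :: 'a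
  assumes "0 < q" "q < p" "coprime p q" "odd p" "odd q"
    and "tb_algebra p q \<pi>"
    and "x = \<pi> [:0, 1:]"
    and "\<kappa> = \<pi> [:1/2:]"
    and "is_Omega p q \<pi> \<Omega>"
    and "0 < l" "l < p" "odd l"
    and "[int q * int l = 1] (mod int p) \<or> [int q * int l = -1] (mod int p)"
    and "P = \<pi> (tb_rat_poly p q (l - 1))"
  shows "x\<^sup>2 * P dvd 1 \<and>
      (\<forall>\<tau>. is_torsion (complex1 p q x) \<tau> \<longleftrightarrow>
         \<tau> * (x\<^sup>2 * P) = 2 \<or> \<tau> * (x\<^sup>2 * P) = - 2) \<and>
    4 * x\<^sup>2 * P\<^sup>2 dvd 1 \<and>
      (\<forall>\<tau>. is_torsion (cone2 p q \<kappa> x) \<tau> \<longleftrightarrow>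
         \<tau> * (4 * x\<^sup>2 * P\<^sup>2) = \<Omega> \<or> \<tau> * (4 * x\<^sup>2 * P\<^sup>2) = - \<Omega>)"
proof -
  obtain \<epsilon> N a b where \<epsilon>: "frobenius_form p q \<pi> \<epsilon>" and inv: "inverse_form \<pi> \<epsilon> N a b"
    and \<Omega>: "\<Omega> = (\<Sum>i<N. a i * b i)"
    using assms(9) unfolding is_Omega_def by blast
  interpret V: two_bridge_frobenius p q \<pi> \<epsilon>
    using assms \<epsilon> by unfold_locales
  have x: "x = V.x" and \<kappa>: "\<kappa> = V.\<kappa>" and P: "P = V.P (l - 1)"
    using assms by (simp_all add: V.x_def V.\<kappa>_def V.P_def)
  have \<Omega>: "\<Omega> = V.even_sum - V.odd_sum" unfolding \<Omega> by (rule V.Omega_eq[OF inv])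
  have xu: "x dvd 1" unfolding x by (rule V.x_unit)
  have two: "2 * \<kappa> = 1" unfolding \<kappa> by (rule V.two_\<kappa>)
  hence two': "2 dvd (1 :: 'a)" by (metis dvdI)
  obtain m n where Du: "rho1.D V.x gu (tb_r p q) = m2 0 V.\<iota> 0 m" and Dv: "rho1.D V.x gv (tb_r p q) = m2 (-1) 0 n 0"
    and Pe: "P * (V.\<iota> * n + m) = 2"
    using V.boundary_rho1[OF assms(10-13)] unfolding P by blast
  define e where "e = V.\<iota> * n + m"
  have Pe: "P * e = 2" using Pe by (simp only: e_def)
  \<comment> \<open>2 is a unit of V, so both factors are units; this is what makes the first
    complex acyclic.\<close>
  have "P * e dvd 1" unfolding Pe by (rule two')
  hence Pu: "P dvd 1" and eu: "V.\<iota> * n + m dvd 1"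
    unfolding e_def[symmetric] by (auto dest: dvd_mult_left dvd_mult_right)
  have x2: "x\<^sup>2 dvd 1" using mult_dvd_mono[OF xu xu] by (simp add: power2_eq_square)
  have P2: "P\<^sup>2 dvd 1" using mult_dvd_mono[OF Pu Pu] by (simp add: power2_eq_square)
  have u1: "x\<^sup>2 * P dvd 1" using mult_dvd_mono[OF x2 Pu] by simp
  have u2: "4 * x\<^sup>2 * P\<^sup>2 dvd 1"
    using mult_dvd_mono[OF mult_dvd_mono[OF mult_dvd_mono[OF two' two'] x2] P2] by simp
  have t1: "is_torsion (complex1 p q x) \<tau> \<longleftrightarrow> \<tau> * (x\<^sup>2 * P) = 2 \<or> \<tau> * (x\<^sup>2 * P) = - 2" for \<tau>
  proof -
    have "is_torsion (complex1 p q x) \<tau> \<longleftrightarrow> \<tau> * x\<^sup>2 =\<^sub>\<plusminus> e"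
      using torsion_complex1[OF xu eu] V.complex1_list_mat[OF Du Dv]
      by (simp only: x eq_up_to_sign_def e_def)
    also have "\<dots> \<longleftrightarrow> P * (\<tau> * x\<^sup>2) =\<^sub>\<plusminus> P * e"
      by (rule eq_up_to_sign_cancel[OF Pu, symmetric])
    also have "P * (\<tau> * x\<^sup>2) = \<tau> * (x\<^sup>2 * P)" by (simp only: ac_simps)
    finally show ?thesis by (simp only: Pe eq_up_to_sign_def)
  qed
  have t2: "is_torsion (cone2 p q \<kappa> x) \<tau> \<longleftrightarrow>
      \<tau> * (4 * x\<^sup>2 * P\<^sup>2) = \<Omega> \<or> \<tau> * (4 * x\<^sup>2 * P\<^sup>2) = - \<Omega>" for \<tau>
  proof -
    have xt: "x * \<Omega> dvd 1" using mult_dvd_mono[OF xu V.even_sum_minus_odd_sum_unit] by (simp add: \<Omega>)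
    obtain n0 n1 s b2 b3 c2 c3 where
      Du: "V.rho2.D gu (tb_r p q) = m3 0 0 1 (x * \<Omega>) (\<kappa> * x * (x * \<Omega>)) b2 s (\<kappa> * x * s) c2" and
      Dv: "V.rho2.D gv (tb_r p q) = m3 (-1) 0 0 b3 (- \<kappa> * x * (x * \<Omega>)) (x * \<Omega>) c3 (- \<kappa> * x * s) s" and
      f2: "f2 p q V.\<kappa> V.x = list_mat 3 [[n0, n1, P\<^sup>2]]" and
      rel: "n1 * (x * \<Omega>) + P\<^sup>2 * s = 0" "n0 + n1 * b2 + P\<^sup>2 * c2 = 0" "- n0 + n1 * b3 + P\<^sup>2 * c3 = 0"
      using V.boundary_rho2[OF assms(10-13)] unfolding P x \<kappa> \<Omega> .
    have "is_torsion (cone2 p q \<kappa> x) \<tau> \<longleftrightarrow> \<tau> * (4 * x ^ 3 * P\<^sup>2) =\<^sub>\<plusminus> x * \<Omega>"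
      using torsion_cone2[OF xu two xt P2 rel] V.cone2_list_mat[OF Du Dv f2]
      by (simp only: x \<kappa> eq_up_to_sign_def)
    \<comment> \<open>The minor of the second map is x times Omega up to sign, and this x cancels
      one of the three from D^0.\<close>
    also have "\<tau> * (4 * x ^ 3 * P\<^sup>2) = x * (\<tau> * (4 * x\<^sup>2 * P\<^sup>2))"
      by (simp only: power3_eq_cube power2_eq_square ac_simps)
    also have "\<dots> =\<^sub>\<plusminus> x * \<Omega> \<longleftrightarrow> \<tau> * (4 * x\<^sup>2 * P\<^sup>2) =\<^sub>\<plusminus> \<Omega>"
      by (rule eq_up_to_sign_cancel[OF xu])
    finally show ?thesis by (simp only: eq_up_to_sign_def)
  qed
  show ?thesis using u1 u2 t1 t2 by blast
qed

end
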